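(* Let $\Sigma$ be a finite, connected, flag $2$-complex. Suppose that $\Sigma$ is not $1$-acyclic. Then $\mathrm{adef}(\Gamma_n)\to\infty$ as $n\to\infty$.
   Context: A flag complex is a simplicial complex in which every set of pairwise adjacent vertices spans a simplex. For a finite flag complex $\Sigma$ with vertices $a_1,\dots,a_N$, $G_\Sigma=\langle e_1,\dots,e_N \mid [e_i,e_j]\text{ for each edge }\{a_i,a_j\}\in\Sigma\rangle$, $\pi:G_\Sigma\to\mathbf{Z}$ is the surjection sending every $e_i$ to $1$, and $\Gamma_n=\pi^{-1}(n\mathbf{Z})$ for $n\ge1$. $\Sigma$ is $1$-acyclic if its reduced integral homology vanishes in degrees $\le 1$. For a finite presentation $F/R$ of a group $\Gamma$ ($F$ free of finite rank $d(F)$), $R_{\mathrm{ab}}=R/[R,R]$ is a $\mathbf{Z}\Gamma$-module via conjugation by $F$, and the abelianized deficiency of the presentation is the minimal number of $\mathbf{Z}\Gamma$-module generators of $R_{\mathrm{ab}}$ minus $d(F)$. For a finitely presented group $\Gamma$, $\mathrm{adef}(\Gamma)$ is the infimum of the abelianized deficiencies of its finite presentations. *)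

theory Defs
  imports
    "HOL-Algebra.Free_Abelian_Groups"
    "HOL-Algebra.Elementary_Groups"
    "HOL-Algebra.Generated_Groups"
    "HOL-Algebra.Module"
    "HOL-Library.Extended_Real"
begin

section \<open>Finite simplicial complexes\<close>

text \<open>
  An abstract simplicial complex is identified with its set of simplices. The empty simplex is
  included; it has dimension \<open>-1\<close> and gives the augmentation in reduced homology.
\<close>

definition abstract_complex :: "'v set set \<Rightarrow> bool" where
  "abstract_complex K \<longleftrightarrow>
     {} \<in> K \<and> (\<forall>\<sigma>\<in>K. finite \<sigma>) \<and> (\<forall>\<sigma>\<in>K. \<forall>\<tau>. \<tau> \<subseteq> \<sigma> \<longrightarrow> \<tau> \<in> K)"

definition vertices :: "'v set set \<Rightarrow> 'v set" where
  "vertices K = \<Union>K"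

definition adjacent :: "'v set set \<Rightarrow> 'v \<Rightarrow> 'v \<Rightarrow> bool" where
  "adjacent K u v \<longleftrightarrow> u \<noteq> v \<and> {u, v} \<in> K"

definition flag_complex :: "'v set set \<Rightarrow> bool" where
  "flag_complex K \<longleftrightarrow> abstract_complex K \<and>
     (\<forall>A. finite A \<and> A \<subseteq> vertices K \<and> pairwise (adjacent K) A \<longrightarrow> A \<in> K)"

definition dim_le :: "int \<Rightarrow> 'v set set \<Rightarrow> bool" where
  "dim_le d K \<longleftrightarrow> (\<forall>\<sigma>\<in>K. int (card \<sigma>) - 1 \<le> d)"

definition connected_complex :: "'v set set \<Rightarrow> bool" where
  "connected_complex K \<longleftrightarrow> vertices K \<noteq> {} \<and>
     (\<forall>u\<in>vertices K. \<forall>v\<in>vertices K. (adjacent K)\<^sup>*\<^sup>* u v)"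

subsection \<open>Reduced integral simplicial homology\<close>

text \<open>
  Simplices are oriented by the linear order of the vertices, and the chain complex is augmented
  by the group in degree \<open>-1\<close> that is generated by the empty simplex.
\<close>

definition simplices :: "int \<Rightarrow> 'v set set \<Rightarrow> 'v set set" where
  "simplices p K = {\<sigma>\<in>K. int (card \<sigma>) = p + 1}"

definition simplicial_chain_group :: "int \<Rightarrow> 'v set set \<Rightarrow> ('v set \<Rightarrow>\<^sub>0 int) monoid" where
  "simplicial_chain_group p K = free_Abelian_group (simplices p K)"

definition simplicial_boundary :: "('v::linorder set \<Rightarrow>\<^sub>0 int) \<Rightarrow> ('v set \<Rightarrow>\<^sub>0 int)" where
  "simplicial_boundary =
     frag_extend (\<lambda>\<sigma>. \<Sum>i<card \<sigma>.
       frag_cmul ((-1) ^ i) (frag_of (\<sigma> - {sorted_list_of_set \<sigma> ! i})))"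

definition simplicial_cycles :: "int \<Rightarrow> 'v::linorder set set \<Rightarrow> ('v set \<Rightarrow>\<^sub>0 int) set" where
  "simplicial_cycles p K =
     kernel (simplicial_chain_group p K) (simplicial_chain_group (p - 1) K) simplicial_boundary"

definition simplicial_boundaries :: "int \<Rightarrow> 'v::linorder set set \<Rightarrow> ('v set \<Rightarrow>\<^sub>0 int) set" where
  "simplicial_boundaries p K =
     simplicial_boundary ` carrier (simplicial_chain_group (p + 1) K)"

definition reduced_simplicial_homology ::
    "int \<Rightarrow> 'v::linorder set set \<Rightarrow> ('v set \<Rightarrow>\<^sub>0 int) set monoid" where
  "reduced_simplicial_homology p K =
     subgroup_generated (simplicial_chain_group p K) (simplicial_cycles p K)
       Mod simplicial_boundaries p K"

definition acyclic_up_to :: "int \<Rightarrow> 'v::linorder set set \<Rightarrow> bool" where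
  "acyclic_up_to n K \<longleftrightarrow> (\<forall>p\<le>n. trivial_group (reduced_simplicial_homology p K))"

section \<open>Free groups and presentations\<close>

text \<open>
  Elements of the free group are reduced words. The letter \<open>(x, True)\<close> stands for the generator
  \<open>x\<close> and \<open>(x, False)\<close> for its inverse.
\<close>

type_synonym 'a word = "('a \<times> bool) list"

definition inv_letter :: "'a \<times> bool \<Rightarrow> 'a \<times> bool" where
  "inv_letter l = (fst l, \<not> snd l)"

definition reduced_word :: "'a word \<Rightarrow> bool" where
  "reduced_word = successively (\<lambda>l m. m \<noteq> inv_letter l)"

fun cancel_cons :: "'a \<times> bool \<Rightarrow> 'a word \<Rightarrow> 'a word" where
  "cancel_cons l [] = [l]"
| "cancel_cons l (m # w) = (if m = inv_letter l then w else l # m # w)"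

definition free_group :: "'a set \<Rightarrow> 'a word monoid" where
  "free_group S =
     \<lparr>carrier = {w. reduced_word w \<and> fst ` set w \<subseteq> S},
      monoid.mult = (\<lambda>u v. foldr cancel_cons u v),
      one = []\<rparr>"

definition free_gen :: "'a \<Rightarrow> 'a word" where
  "free_gen x = [(x, True)]"

definition normal_closure :: "('a, 'b) monoid_scheme \<Rightarrow> 'a set \<Rightarrow> 'a set" where
  "normal_closure G T = \<Inter>{N. N \<lhd> G \<and> T \<subseteq> N}"

definition presented_group :: "'a set \<Rightarrow> 'a word set \<Rightarrow> 'a word set monoid" where
  "presented_group S T = free_group S Mod normal_closure (free_group S) T"

lemma inv_letter_inv_letter [simp]: "inv_letter (inv_letter l) = l"
  by (simp add: inv_letter_def)

lemma inv_letter_neq [simp]: "inv_letter l \<noteq> l" "l \<noteq> inv_letter l"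
  by (auto simp: inv_letter_def prod_eq_iff)

lemma fst_inv_letter [simp]: "fst (inv_letter l) = fst l"
  by (simp add: inv_letter_def)

lemma reduced_word_Nil [simp]: "reduced_word []"
  and reduced_word_single [simp]: "reduced_word [l]"
  and reduced_word_Cons: "reduced_word (l # m # w) \<longleftrightarrow> m \<noteq> inv_letter l \<and> reduced_word (m # w)"
  by (simp_all add: reduced_word_def)

lemma reduced_word_tl: "reduced_word (l # w) \<Longrightarrow> reduced_word w"
  by (cases w) (auto simp: reduced_word_Cons)

lemma reduced_word_cancel_cons: "reduced_word w \<Longrightarrow> reduced_word (cancel_cons l w)"
  by (cases w) (auto simp: reduced_word_Cons dest: reduced_word_tl)

lemma reduced_word_foldr: "reduced_word v \<Longrightarrow> reduced_word (foldr cancel_cons u v)"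
  by (induction u) (auto intro: reduced_word_cancel_cons)

lemma set_cancel_cons: "set (cancel_cons l w) \<subseteq> insert l (set w)"
  by (cases w) auto

lemma set_foldr_cancel_cons: "set (foldr cancel_cons u v) \<subseteq> set u \<union> set v"
  by (induction u) (use set_cancel_cons in fastforce)+

lemma cancel_cons_inv: "reduced_word w \<Longrightarrow> cancel_cons (inv_letter l) (cancel_cons l w) = w"
proof (cases w)
  case (Cons m w')
  assume "reduced_word w"
  then show ?thesis using Cons by (cases w') (auto simp: reduced_word_Cons)
qed simp

lemma foldr_cancel_cons:
  assumes "reduced_word w"
  shows "foldr cancel_cons (cancel_cons l u) w = cancel_cons l (foldr cancel_cons u w)"
proof (cases u)
  case (Cons m u')
  show ?thesis
  proof (cases "m = inv_letter l")
    case True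
    then show ?thesis
      using Cons assms cancel_cons_inv[of "foldr cancel_cons u' w" "inv_letter l"]
      by (simp add: reduced_word_foldr)
  qed (use Cons in auto)
qed simp

lemma foldr_cancel_cons_assoc:
  assumes "reduced_word w"
  shows "foldr cancel_cons (foldr cancel_cons u v) w = foldr cancel_cons u (foldr cancel_cons v w)"
  by (induction u) (simp_all add: foldr_cancel_cons assms)

lemma foldr_cancel_cons_Nil: "reduced_word u \<Longrightarrow> foldr cancel_cons u [] = u"
proof (induction u)
  case (Cons l u)
  then show ?case by (cases u) (auto simp: reduced_word_Cons)
qed simp

lemma free_group_left_inverse:
  assumes "reduced_word u"
  shows "\<exists>v. reduced_word v \<and> fst ` set v \<subseteq> fst ` set u \<and> foldr cancel_cons v u = []"
  using assms
proof (induction u)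
  case (Cons l u)
  then obtain v where v: "reduced_word v" "fst ` set v \<subseteq> fst ` set u" "foldr cancel_cons v u = []"
    by (blast dest: reduced_word_tl)
  let ?v = "foldr cancel_cons v [inv_letter l]"
  have red: "reduced_word u" and eq: "cancel_cons (inv_letter l) (l # u) = u"
    using Cons.prems by (auto dest: reduced_word_tl)
  have "foldr cancel_cons ?v (l # u) = foldr cancel_cons v (foldr cancel_cons [inv_letter l] (l # u))"
    by (rule foldr_cancel_cons_assoc[OF Cons.prems])
  also have "\<dots> = []" using eq v by simp
  finally have "foldr cancel_cons ?v (l # u) = []" .
  moreover have "reduced_word ?v" by (simp add: reduced_word_foldr)
  moreover have "fst ` set ?v \<subseteq> fst ` set (l # u)"
    using image_mono[OF set_foldr_cancel_cons[of v "[inv_letter l]"], of fst] v(2) by auto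
  ultimately show ?case by blast
qed simp

lemma group_free_group: "group (free_group S)"
proof (rule groupI)
  fix x y assume "x \<in> carrier (free_group S)" "y \<in> carrier (free_group S)"
  then show "x \<otimes>\<^bsub>free_group S\<^esub> y \<in> carrier (free_group S)"
    using set_foldr_cancel_cons[of x y]
    by (fastforce simp: free_group_def reduced_word_foldr)
next
  fix x assume "x \<in> carrier (free_group S)"
  then show "\<exists>y\<in>carrier (free_group S). y \<otimes>\<^bsub>free_group S\<^esub> x = \<one>\<^bsub>free_group S\<^esub>"
    using free_group_left_inverse[of x] by (fastforce simp: free_group_def)
qed (auto simp: free_group_def foldr_cancel_cons_assoc)

lemma free_gen_in_carrier: "x \<in> S \<Longrightarrow> free_gen x \<in> carrier (free_group S)"
  by (simp add: free_group_def free_gen_def)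

lemma (in group) normal_closure_normal:
  assumes "T \<subseteq> carrier G"
  shows "normal_closure G T \<lhd> G"
proof -
  have ne: "carrier G \<in> {N. N \<lhd> G \<and> T \<subseteq> N}"
    using assms normal_invI[OF subgroup_self] by simp
  have sub: "subgroup (normal_closure G T) G"
    unfolding normal_closure_def
    by (rule subgroups_Inter) (use ne in \<open>auto simp: normal_imp_subgroup\<close>)
  show ?thesis
    by (rule normal_invI[OF sub]) (auto simp: normal_closure_def normal_inv_iff)
qed

lemma normal_closure_incl: "T \<subseteq> normal_closure G T"
  by (auto simp: normal_closure_def)

lemma normal_closure_least: "N \<lhd> G \<Longrightarrow> T \<subseteq> N \<Longrightarrow> normal_closure G T \<subseteq> N"
  by (auto simp: normal_closure_def)

section \<open>The groups \<open>G\<^sub>\<Sigma>\<close> and \<open>\<Gamma>\<^sub>n\<close>\<close>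

definition commutator :: "('a, 'b) monoid_scheme \<Rightarrow> 'a \<Rightarrow> 'a \<Rightarrow> 'a" where
  "commutator G x y = x \<otimes>\<^bsub>G\<^esub> y \<otimes>\<^bsub>G\<^esub> inv\<^bsub>G\<^esub> x \<otimes>\<^bsub>G\<^esub> inv\<^bsub>G\<^esub> y"

definition raag_relators :: "'v set set \<Rightarrow> 'v word set" where
  "raag_relators K =
     {commutator (free_group (vertices K)) (free_gen u) (free_gen v) | u v. adjacent K u v}"

definition raag :: "'v set set \<Rightarrow> 'v word set monoid" where
  "raag K = presented_group (vertices K) (raag_relators K)"

definition raag_gen :: "'v set set \<Rightarrow> 'v \<Rightarrow> 'v word set" where
  "raag_gen K v =
     normal_closure (free_group (vertices K)) (raag_relators K) #>\<^bsub>free_group (vertices K)\<^esub> free_gen v"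

definition exponent_sum :: "'a word \<Rightarrow> int" where
  "exponent_sum w = (\<Sum>l\<leftarrow>w. if snd l then 1 else -1)"

text \<open>
  All words in a coset have the same exponent sum, so the homomorphism \<open>\<pi>\<close> can be read off from
  any of them; see \<open>raag_pi_hom\<close> and \<open>raag_pi_gen\<close> below.
\<close>

definition raag_pi :: "'v word set \<Rightarrow> int" where
  "raag_pi c = the_elem (exponent_sum ` c)"

definition raag_Gamma :: "'v set set \<Rightarrow> nat \<Rightarrow> 'v word set monoid" where
  "raag_Gamma K n = (raag K)\<lparr>carrier := {g \<in> carrier (raag K). int n dvd raag_pi g}\<rparr>"

lemma exponent_sum_cancel_cons:
  "exponent_sum (cancel_cons l w) = (if snd l then 1 else -1) + exponent_sum w"
  by (cases w) (auto simp: exponent_sum_def inv_letter_def)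

lemma exponent_sum_hom: "exponent_sum \<in> hom (free_group S) integer_group"
proof -
  have "exponent_sum (foldr cancel_cons u v) = exponent_sum u + exponent_sum v" for u v :: "'a word"
    by (induction u) (simp_all add: exponent_sum_cancel_cons, simp_all add: exponent_sum_def)
  then show ?thesis by (auto simp: hom_def free_group_def integer_group_def)
qed

lemma raag_relators_in_carrier: "raag_relators K \<subseteq> carrier (free_group (vertices K))"
proof -
  interpret group "free_group (vertices K)" by (rule group_free_group)
  have "u \<in> vertices K" "v \<in> vertices K" if "adjacent K u v" for u v
    using that by (auto simp: adjacent_def vertices_def)
  then show ?thesis
    by (auto simp: raag_relators_def commutator_def free_gen_in_carrier)
qed

lemma normal_raag_relators:
  "normal_closure (free_group (vertices K)) (raag_relators K) \<lhd> free_group (vertices K)"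
  by (rule group.normal_closure_normal[OF group_free_group raag_relators_in_carrier])

lemma group_raag: "group (raag K)"
  unfolding raag_def presented_group_def
  by (rule normal.factorgroup_is_group[OF normal_raag_relators])

lemma raag_pi_coset:
  assumes "w \<in> carrier (free_group (vertices K))"
  shows "raag_pi (normal_closure (free_group (vertices K)) (raag_relators K)
                    #>\<^bsub>free_group (vertices K)\<^esub> w) = exponent_sum w"
proof -
  let ?F = "free_group (vertices K)"
  let ?N = "normal_closure ?F (raag_relators K)"
  interpret F: group ?F by (rule group_free_group)
  interpret h: group_hom ?F integer_group exponent_sum
    by (simp add: group_hom_def group_hom_axioms_def exponent_sum_hom group_free_group)
  have carr: "u \<in> vertices K" "v \<in> vertices K" if "adjacent K u v" for u v
    using that by (auto simp: adjacent_def vertices_def)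
  have "raag_relators K \<subseteq> kernel ?F integer_group exponent_sum"
    using raag_relators_in_carrier[of K]
    by (auto simp: kernel_def raag_relators_def commutator_def free_gen_in_carrier carr)
  then have sub: "?N \<subseteq> kernel ?F integer_group exponent_sum"
    by (rule normal_closure_least[OF h.normal_kernel])
  have "exponent_sum x = exponent_sum w" if "x \<in> ?N #>\<^bsub>?F\<^esub> w" for x
    using that sub assms by (auto simp: r_coset_def kernel_def)
  moreover have "w \<in> ?N #>\<^bsub>?F\<^esub> w"
    using F.rcos_self[OF assms] normal_raag_relators normal_imp_subgroup by blast
  ultimately have "exponent_sum ` (?N #>\<^bsub>?F\<^esub> w) = {exponent_sum w}" by blast
  then show ?thesis by (simp add: raag_pi_def)
qed

lemma raag_pi_hom: "raag_pi \<in> hom (raag K) integer_group"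
proof -
  let ?F = "free_group (vertices K)"
  let ?N = "normal_closure ?F (raag_relators K)"
  interpret N: normal ?N ?F by (rule normal_raag_relators)
  have "raag_pi (x <#>\<^bsub>?F\<^esub> y) = raag_pi x + raag_pi y"
    if xy: "x \<in> carrier (raag K)" "y \<in> carrier (raag K)" for x y
  proof -
    obtain u v where uv: "u \<in> carrier ?F" "v \<in> carrier ?F" "x = ?N #>\<^bsub>?F\<^esub> u" "y = ?N #>\<^bsub>?F\<^esub> v"
      using xy by (auto simp: raag_def presented_group_def carrier_FactGroup)
    then have "x <#>\<^bsub>?F\<^esub> y = ?N #>\<^bsub>?F\<^esub> (u \<otimes>\<^bsub>?F\<^esub> v)" by (simp add: N.rcos_sum)
    then show ?thesis
      using uv hom_mult[OF exponent_sum_hom uv(1,2)] by (simp add: raag_pi_coset)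
  qed
  then show ?thesis by (auto simp: hom_def raag_def presented_group_def)
qed

lemma raag_pi_gen: "v \<in> vertices K \<Longrightarrow> raag_pi (raag_gen K v) = 1"
  by (simp add: raag_gen_def raag_pi_coset free_gen_in_carrier)
     (simp add: exponent_sum_def free_gen_def)

section \<open>Group rings and relation modules\<close>

definition integral_group_ring :: "('a, 'b) monoid_scheme \<Rightarrow> ('a \<Rightarrow>\<^sub>0 int) ring" where
  "integral_group_ring G =
     \<lparr>carrier = {a. Poly_Mapping.keys a \<subseteq> carrier G},
      monoid.mult = (\<lambda>a b. frag_extend (\<lambda>g. frag_extend (\<lambda>h. frag_of (g \<otimes>\<^bsub>G\<^esub> h)) b) a),
      one = frag_of \<one>\<^bsub>G\<^esub>,
      zero = 0,
      add = (+)\<rparr>"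

text \<open>
  The library locale for modules is restricted to commutative rings, but its module records and its
  submodules are not. Only the additive part and the scalar multiplication of a module record are
  used here.
\<close>

definition module_generates ::
    "('r, 's) ring_scheme \<Rightarrow> ('r, 'm, 't) module_scheme \<Rightarrow> 'm set \<Rightarrow> bool" where
  "module_generates R M X \<longleftrightarrow>
     X \<subseteq> carrier M \<and> (\<forall>H. submodule H R M \<and> X \<subseteq> H \<longrightarrow> H = carrier M)"

definition min_generators :: "('r, 's) ring_scheme \<Rightarrow> ('r, 'm, 't) module_scheme \<Rightarrow> nat" where
  "min_generators R M = (LEAST d. \<exists>X. finite X \<and> card X = d \<and> module_generates R M X)"

definition abelianization :: "('a, 'b) monoid_scheme \<Rightarrow> 'a set \<Rightarrow> 'a set monoid" where
  "abelianization F R = (F\<lparr>carrier := R\<rparr>) Mod derived F R"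

text \<open>
  The action of a coset \<open>g\<close> of \<open>R\<close> on a coset \<open>m\<close> of \<open>[R, R]\<close>: conjugating \<open>m\<close> by any
  element of \<open>g\<close> gives the same coset, which is therefore the union over all of \<open>g\<close>; see
  \<open>conj_action_coset\<close> below.
\<close>

definition conj_action :: "('a, 'b) monoid_scheme \<Rightarrow> 'a set \<Rightarrow> 'a set \<Rightarrow> 'a set" where
  "conj_action F g m = (\<Union>f\<in>g. (\<lambda>r. f \<otimes>\<^bsub>F\<^esub> r \<otimes>\<^bsub>F\<^esub> inv\<^bsub>F\<^esub> f) ` m)"

definition relation_module ::
    "('a, 'b) monoid_scheme \<Rightarrow> 'a set \<Rightarrow> ('a set \<Rightarrow>\<^sub>0 int, 'a set) module" where
  "relation_module F R =
     \<lparr>carrier = carrier (abelianization F R),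
      monoid.mult = undefined,
      one = undefined,
      zero = one (abelianization F R),
      add = monoid.mult (abelianization F R),
      smult = (\<lambda>a m. finprod (abelianization F R)
                 (\<lambda>g. conj_action F g m [^]\<^bsub>abelianization F R\<^esub> Poly_Mapping.lookup a g)
                 (Poly_Mapping.keys a))\<rparr>"

lemma comm_group_abelianization: "R \<lhd> F \<Longrightarrow> comm_group (abelianization F R)"
  unfolding abelianization_def
  by (rule group.derived_quot_of_subgroup_is_comm_group) (auto simp: normal_def)

lemma conj_action_coset:
  fixes F (structure)
  assumes R: "R \<lhd> F" and f: "f \<in> carrier F" and r: "r \<in> R"
  shows "conj_action F (R #> f) (derived F R #> r) = derived F R #> (f \<otimes> r \<otimes> inv f)"
proof -
  interpret R: normal R F by (rule R)
  let ?D = "derived F R"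
  interpret D: normal ?D F by (rule R.derived_is_normal[OF R])
  have rc: "r \<in> carrier F" and rR: "f \<otimes> r \<otimes> inv f \<in> R"
    using f r R.inv_op_closed2 R.subset by auto
  show ?thesis
  proof (intro equalityI subsetI)
    fix x assume "x \<in> conj_action F (R #> f) (?D #> r)"
    then obtain s d where s: "s \<in> R" and d: "d \<in> ?D"
      and x: "x = (s \<otimes> f) \<otimes> (d \<otimes> r) \<otimes> inv (s \<otimes> f)"
      by (auto simp: conj_action_def r_coset_def)
    have sc: "s \<in> carrier F" and dc: "d \<in> carrier F"
      using s d R.subset D.subset by auto
    define q where "q = f \<otimes> r \<otimes> inv f"
    have q: "q \<in> R" "q \<in> carrier F" using rR R.subset by (auto simp: q_def)
    define e where "e = (s \<otimes> f) \<otimes> d \<otimes> inv (s \<otimes> f)"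
    have e: "e \<in> ?D" unfolding e_def using sc f d by (intro D.inv_op_closed2) auto
    define c where "c = s \<otimes> q \<otimes> inv s \<otimes> inv q"
    have c: "c \<in> ?D" unfolding c_def derived_def using s q by (intro generate.incl) auto
    have conj_mult: "p \<otimes> (a \<otimes> b) \<otimes> inv p = p \<otimes> a \<otimes> inv p \<otimes> (p \<otimes> b \<otimes> inv p)"
      if "p \<in> carrier F" "a \<in> carrier F" "b \<in> carrier F" for p a b
    proof -
      have "inv p \<otimes> (p \<otimes> (b \<otimes> inv p)) = b \<otimes> inv p"
        using that by (simp flip: R.m_assoc)
      then show ?thesis using that by (simp add: R.m_assoc)
    qed
    have "x = e \<otimes> ((s \<otimes> f) \<otimes> r \<otimes> inv (s \<otimes> f))"
      unfolding x e_def using conj_mult[OF R.m_closed[OF sc f] dc rc] .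
    also have "(s \<otimes> f) \<otimes> r \<otimes> inv (s \<otimes> f) = s \<otimes> q \<otimes> inv s"
      unfolding q_def using sc f rc by (simp add: R.m_assoc R.inv_mult_group)
    also have "\<dots> = c \<otimes> q"
      unfolding c_def using sc q(2) by (simp add: R.m_assoc)
    finally have "x = e \<otimes> c \<otimes> q"
      using e c q(2) D.subset by (auto simp: R.m_assoc subset_iff)
    then show "x \<in> ?D #> (f \<otimes> r \<otimes> inv f)"
      using e c by (auto simp: r_coset_def q_def)
  next
    fix x assume "x \<in> ?D #> (f \<otimes> r \<otimes> inv f)"
    then obtain d where d: "d \<in> ?D" and x: "x = d \<otimes> (f \<otimes> r \<otimes> inv f)"
      by (auto simp: r_coset_def)
    have dc: "d \<in> carrier F" using d D.subset by auto
    define e where "e = inv f \<otimes> d \<otimes> f"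
    have e: "e \<in> ?D" unfolding e_def using f d by (intro D.inv_op_closed1) auto
    have fde: "f \<otimes> e = d \<otimes> f"
      unfolding e_def using f dc by (simp add: flip: R.m_assoc)
    have ec: "e \<in> carrier F" using e D.subset by auto
    have "x = (d \<otimes> f) \<otimes> r \<otimes> inv f" using x dc f rc by (simp add: R.m_assoc)
    also have "\<dots> = f \<otimes> (e \<otimes> r) \<otimes> inv f"
      unfolding fde[symmetric] using f ec rc by (simp add: R.m_assoc)
    finally have "x = f \<otimes> (e \<otimes> r) \<otimes> inv f" .
    moreover have "f \<in> R #> f" using f by (rule R.rcos_self[OF _ R.subgroup_axioms])
    moreover have "e \<otimes> r \<in> ?D #> r" using e by (auto simp: r_coset_def)
    ultimately show "x \<in> conj_action F (R #> f) (?D #> r)"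
      unfolding conj_action_def by blast
  qed
qed

section \<open>Abelianized deficiency\<close>

text \<open>
  The free group of a finite presentation is taken to be the one on \<open>{..<k}\<close>; this represents all
  free groups of finite rank up to isomorphism.
\<close>

definition finite_presentation ::
    "nat \<Rightarrow> nat word set \<Rightarrow> ('g, 'm) monoid_scheme \<Rightarrow> bool" where
  "finite_presentation k R G \<longleftrightarrow>
     (\<exists>T. finite T \<and> T \<subseteq> carrier (free_group {..<k}) \<and> R = normal_closure (free_group {..<k}) T) \<and>
     (free_group {..<k} Mod R) \<cong> G"

definition presentation_adef :: "nat \<Rightarrow> nat word set \<Rightarrow> int" where
  "presentation_adef k R =
     int (min_generators (integral_group_ring (free_group {..<k} Mod R))
                         (relation_module (free_group {..<k}) R)) - int k"

text \<open>
  The infimum is taken in the extended reals, which avoids presupposing that it is finite. It is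
  meaningful for finitely presented groups only; otherwise it is the infimum of the empty set.
\<close>

definition adef :: "('g, 'm) monoid_scheme \<Rightarrow> ereal" where
  "adef G = Inf {ereal (real_of_int (presentation_adef k R)) | k R. finite_presentation k R G}"

end

theory Submission
  imports Defs
begin

text \<open>
  Since \<open>\<Sigma>\<close> is connected but not \<open>1\<close>-acyclic, it carries a \<open>1\<close>-cocycle \<open>z\<close> with values in a finite
  cyclic group \<open>Q\<close> that is not a coboundary. For a set \<open>S\<close> of residues modulo \<open>n\<close>, placing \<open>z\<close> on
  the squares of the universal cover of the Salvetti complex whose lowest vertex has height in \<open>S\<close>
  gives a \<open>\<Gamma>\<^sub>n\<close>-invariant \<open>2\<close>-cocycle. It is the coboundary of a \<open>1\<close>-cochain, and integrating the
  latter along relations of a presentation \<open>F/R\<close> of \<open>\<Gamma>\<^sub>n\<close> gives an \<open>F\<close>-invariant homomorphism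
  \<open>R \<rightarrow> Q\<close>. Different sets give homomorphisms whose difference does not extend to \<open>F\<close>, and
  \<open>Hom(\<Gamma>\<^sub>n, Q)\<close> has at most \<open>\<bar>Q\<bar>\<close> to the power \<open>N + 1\<close> elements, where \<open>N\<close> is the number of vertices.
  An \<open>F\<close>-invariant homomorphism is determined by its values on generators of the relation module, so
  if there are \<open>m\<close> of these and \<open>F\<close> has rank \<open>k\<close>, then \<open>\<bar>Q\<bar>\<close> to the power \<open>m + N + 1 - k\<close> is at
  least \<open>2\<close> to the power \<open>n\<close>.
\<close>

section \<open>The circle group\<close>

\<comment> \<open>The count rests on the exact sequence 0 -> Hom(Gamma, Q) -> Hom(F, Q) -> Hom_F(R,
  Q) -> H^2(Gamma, Q) of a presentation F/R: the 2^n cochains give distinct classes in H^2 while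
  Hom(Gamma_n, Q) stays bounded, so the relation module needs ever more generators than F has.
  Taking Q finite turns exactness into a comparison of cardinalities. The order of Q depends on the
  homology of \<Sigma>, so every finite cyclic group is realised inside the circle R/Z; a cochain
  may take values anywhere in the circle as long as its integrals around loops lie in Q. Arbitrary
  sets of residues are allowed because opposite faces of a 3-cube have lowest corners at heights h
  and h + 1, and the terms at each of these heights cancel on their own by the cocycle condition of
  z. To see that a single height j matters, a generator t is fixed: the elements t^j u t^-(j+1) have
  height 0, so they lie in every Gamma_n, and four of them or their inverses multiply to a conjugate
  of the commutator of u and v. The Cayley graph and integration along words stand in for the
  universal cover.\<close>
quotient_type circle = real / "\<lambda>x y. x - y \<in> \<int>"
proof (rule equivpI)
  show "reflp (\<lambda>x y :: real. x - y \<in> \<int>)" by (simp add: reflp_def)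
  show "symp (\<lambda>x y :: real. x - y \<in> \<int>)"
    by (metis (no_types, lifting) Ints_minus minus_diff_eq sympI)
  show "transp (\<lambda>x y :: real. x - y \<in> \<int>)"
  proof (rule transpI)
    fix x y z :: real assume "x - y \<in> \<int>" "y - z \<in> \<int>"
    then show "x - z \<in> \<int>" using Ints_add by fastforce
  qed
qed

lift_definition circle_of :: "real \<Rightarrow> circle" is "\<lambda>x. x" .

instantiation circle :: ab_group_add
begin

lift_definition zero_circle :: circle is 0 .

lift_definition plus_circle :: "circle \<Rightarrow> circle \<Rightarrow> circle" is "(+)"
  by (metis Ints_add add_diff_add)

lift_definition uminus_circle :: "circle \<Rightarrow> circle" is uminus
  by (metis Ints_minus minus_diff_minus)

lift_definition minus_circle :: "circle \<Rightarrow> circle \<Rightarrow> circle" is "(-)"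
  by (smt (verit) Ints_diff)

instance
  by standard (transfer, simp)+

end

lemma circle_of_0 [simp]: "circle_of 0 = 0"
  by transfer simp

lemma circle_of_eq_0_iff: "circle_of x = 0 \<longleftrightarrow> x \<in> \<int>"
  by transfer simp

lemma circle_of_diff: "circle_of (x - y) = circle_of x - circle_of y"
  by transfer simp

lemma circle_of_surj: "\<exists>x. circle_of x = c"
proof transfer
  fix c :: real
  show "\<exists>x. x - c \<in> \<int>" by (rule exI[of _ c]) simp
qed

text \<open>One notion covers subgroups of the circle, of the integers and of chain groups, all of
  which live in types of class \<open>ab_group_add\<close>.\<close>

definition additive_subgroup :: "'a::ab_group_add set \<Rightarrow> bool" where
  "additive_subgroup Q \<longleftrightarrow> 0 \<in> Q \<and> (\<forall>x\<in>Q. \<forall>y\<in>Q. x - y \<in> Q)"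

lemma additive_subgroupD:
  assumes "additive_subgroup Q"
  shows "0 \<in> Q" "x \<in> Q \<Longrightarrow> y \<in> Q \<Longrightarrow> x - y \<in> Q" "x \<in> Q \<Longrightarrow> - x \<in> Q"
    "x \<in> Q \<Longrightarrow> y \<in> Q \<Longrightarrow> x + y \<in> Q"
proof -
  show 0: "0 \<in> Q" and d: "\<And>x y. x \<in> Q \<Longrightarrow> y \<in> Q \<Longrightarrow> x - y \<in> Q"
    using assms unfolding additive_subgroup_def by blast+
  show m: "- x \<in> Q" if "x \<in> Q" for x using d[OF 0 that] by simp
  show "x \<in> Q \<Longrightarrow> y \<in> Q \<Longrightarrow> x + y \<in> Q" using d[of x "- y"] m[of y] by simp
qed

section \<open>Cochains on labelled groups\<close>

definition letter_val :: "('g, 'm) monoid_scheme \<Rightarrow> ('i \<Rightarrow> 'g) \<Rightarrow> 'i \<times> bool \<Rightarrow> 'g" where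
  "letter_val G e l = (if snd l then e (fst l) else inv\<^bsub>G\<^esub> e (fst l))"

fun path_end :: "('g, 'm) monoid_scheme \<Rightarrow> ('i \<Rightarrow> 'g) \<Rightarrow> 'g \<Rightarrow> 'i word \<Rightarrow> 'g" where
  "path_end G e g [] = g"
| "path_end G e g (l # w) = path_end G e (g \<otimes>\<^bsub>G\<^esub> letter_val G e l) w"

text \<open>
  A function \<open>d\<close> assigns the value \<open>d i g\<close> to the edge of the Cayley graph that leads from \<open>g\<close>
  to \<open>g \<otimes> e i\<close>; \<open>path_sum\<close> is its integral along the path that starts at \<open>g\<close> and is
  labelled by a word.
\<close>

fun path_sum :: "('g, 'm) monoid_scheme \<Rightarrow> ('i \<Rightarrow> 'g) \<Rightarrow> ('i \<Rightarrow> 'g \<Rightarrow> 'a::ab_group_add) \<Rightarrow>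
    'g \<Rightarrow> 'i word \<Rightarrow> 'a" where
  "path_sum G e d g [] = 0"
| "path_sum G e d g (l # w) =
     (if snd l then d (fst l) g else - d (fst l) (g \<otimes>\<^bsub>G\<^esub> inv\<^bsub>G\<^esub> e (fst l))) +
     path_sum G e d (g \<otimes>\<^bsub>G\<^esub> letter_val G e l) w"

definition inv_word :: "'a word \<Rightarrow> 'a word" where
  "inv_word w = rev (map inv_letter w)"

lemma inv_word_simps [simp]:
  "inv_word [] = []" "inv_word (u @ v) = inv_word v @ inv_word u"
  "inv_word (l # w) = inv_word w @ [inv_letter l]" "fst ` set (inv_word w) = fst ` set w"
  "inv_word (inv_word w) = w"
  by (simp_all add: inv_word_def rev_map image_image comp_def)

text \<open>Paths concatenate as unreduced words, whereas \<open>free_group\<close> consists of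
  reduced ones; \<open>reduction\<close> passes from the former to the latter and changes neither
  end points nor integrals.\<close>

definition reduction :: "'a word \<Rightarrow> 'a word" where
  "reduction w = foldr cancel_cons w []"

lemma reduction_in_carrier: "fst ` set w \<subseteq> S \<Longrightarrow> reduction w \<in> carrier (free_group S)"
  using set_foldr_cancel_cons[of w "[]"] reduced_word_foldr[of "[]" w]
  by (auto simp: free_group_def reduction_def)

lemma mult_free_group: "u \<otimes>\<^bsub>free_group S\<^esub> v = foldr cancel_cons u v"
  and one_free_group: "\<one>\<^bsub>free_group S\<^esub> = []"
  by (simp_all add: free_group_def)

lemma carrier_free_groupD:
  "w \<in> carrier (free_group S) \<Longrightarrow> reduced_word w"
  "w \<in> carrier (free_group S) \<Longrightarrow> fst ` set w \<subseteq> S"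
  by (auto simp: free_group_def)

text \<open>Only membership of the labels is assumed, so that three labellings of one Artin group
  can coexist: its standard generators, these with some replaced by the identity, and the images of
  the generators of a presentation of \<open>\<Gamma>\<^sub>n\<close>.\<close>

locale labelled_group = group G for G (structure) +
  fixes S :: "'i set" and e :: "'i \<Rightarrow> 'a"
  assumes label_closed [simp, intro]: "i \<in> S \<Longrightarrow> e i \<in> carrier G"
begin

abbreviation "pend \<equiv> path_end G e"
abbreviation "psum \<equiv> path_sum G e"

lemma letter_val_closed [simp]: "fst l \<in> S \<Longrightarrow> letter_val G e l \<in> carrier G"
  by (auto simp: letter_val_def)

lemma letter_val_inv_letter [simp]:
  "fst l \<in> S \<Longrightarrow> letter_val G e (inv_letter l) = inv (letter_val G e l)"
  by (auto simp: letter_val_def inv_letter_def)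

lemma pend_closed [simp]:
  "g \<in> carrier G \<Longrightarrow> fst ` set w \<subseteq> S \<Longrightarrow> pend g w \<in> carrier G"
  by (induction w arbitrary: g) auto

lemma pend_append [simp]: "pend g (u @ v) = pend (pend g u) v"
  by (induction u arbitrary: g) auto

lemma psum_append [simp]: "psum d g (u @ v) = psum d g u + psum d (pend g u) v"
  by (induction u arbitrary: g) (auto simp: add.assoc)

lemma pend_mult:
  "g \<in> carrier G \<Longrightarrow> h \<in> carrier G \<Longrightarrow> fst ` set w \<subseteq> S \<Longrightarrow> pend (g \<otimes> h) w = g \<otimes> pend h w"
  by (induction w arbitrary: h) (auto simp: m_assoc)

lemma pend_eq: "g \<in> carrier G \<Longrightarrow> fst ` set w \<subseteq> S \<Longrightarrow> pend g w = g \<otimes> pend \<one> w"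
  using pend_mult[of g \<one> w] by simp

lemma pend_inv_cancel:
  "g \<in> carrier G \<Longrightarrow> fst l \<in> S \<Longrightarrow> g \<otimes> letter_val G e l \<otimes> letter_val G e (inv_letter l) = g"
  by (simp add: m_assoc)

lemma psum_inv_cancel:
  "g \<in> carrier G \<Longrightarrow> fst l \<in> S \<Longrightarrow> psum d g (l # inv_letter l # w) = psum d g w"
  by (cases l) (auto simp: letter_val_def inv_letter_def m_assoc)

lemma pend_cancel_cons:
  assumes "g \<in> carrier G" "fst l \<in> S"
  shows "pend g (cancel_cons l w) = pend g (l # w)"
  using pend_inv_cancel[OF assms] by (cases w) auto

lemma psum_cancel_cons:
  assumes "g \<in> carrier G" "fst l \<in> S"
  shows "psum d g (cancel_cons l w) = psum d g (l # w)"
proof (cases w)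
  case (Cons m v)
  show ?thesis
  proof (cases "m = inv_letter l")
    case True
    show ?thesis unfolding Cons True psum_inv_cancel[OF assms] by simp
  qed (simp add: Cons)
qed simp

lemma pend_foldr:
  "g \<in> carrier G \<Longrightarrow> fst ` set u \<subseteq> S \<Longrightarrow> pend g (foldr cancel_cons u v) = pend g (u @ v)"
  by (induction u arbitrary: g) (auto simp: pend_cancel_cons)

lemma psum_foldr:
  "g \<in> carrier G \<Longrightarrow> fst ` set u \<subseteq> S \<Longrightarrow> psum d g (foldr cancel_cons u v) = psum d g (u @ v)"
  by (induction u arbitrary: g) (auto simp: psum_cancel_cons)

lemma pend_reduction:
  "g \<in> carrier G \<Longrightarrow> fst ` set w \<subseteq> S \<Longrightarrow> pend g (reduction w) = pend g w"
  by (simp add: reduction_def pend_foldr)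

lemma psum_reduction:
  "g \<in> carrier G \<Longrightarrow> fst ` set w \<subseteq> S \<Longrightarrow> psum d g (reduction w) = psum d g w"
  by (simp add: reduction_def psum_foldr)

lemma pend_inv_word:
  "g \<in> carrier G \<Longrightarrow> fst ` set w \<subseteq> S \<Longrightarrow> pend (pend g w) (inv_word w) = g"
proof (induction w arbitrary: g)
  case (Cons l w)
  then have "pend (pend (g \<otimes> letter_val G e l) w) (inv_word w) = g \<otimes> letter_val G e l" by simp
  then show ?case using Cons.prems pend_inv_cancel[of g l] by simp
qed simp

lemma psum_inv_word:
  "g \<in> carrier G \<Longrightarrow> fst ` set w \<subseteq> S \<Longrightarrow> psum d (pend g w) (inv_word w) = - psum d g w"
proof (induction w arbitrary: g)
  case (Cons l w)
  let ?h = "g \<otimes> letter_val G e l"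
  have "psum d ?h [inv_letter l] = - psum d g [l]"
    using psum_inv_cancel[of g l d "[]"] Cons.prems by (simp add: add_eq_0_iff)
  then show ?case
    using Cons.IH[of ?h] Cons.prems pend_inv_word[of ?h w] by simp
qed simp

lemma psum_diff:
  "psum (\<lambda>i g. d i g - d' i g) g w = psum d g w - psum d' g w"
  by (induction w arbitrary: g) (auto simp: algebra_simps)

lemma pend_foldr_hom:
  assumes "u \<in> carrier (free_group S)" "v \<in> carrier (free_group S)"
  shows "pend \<one> (u \<otimes>\<^bsub>free_group S\<^esub> v) = pend \<one> u \<otimes> pend \<one> v"
  using carrier_free_groupD[OF assms(1)] carrier_free_groupD[OF assms(2)]
  by (simp add: mult_free_group pend_foldr pend_eq[of "pend \<one> u"])

lemma pend_hom: "pend \<one> \<in> hom (free_group S) G"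
  using pend_foldr_hom by (auto simp: hom_def dest: carrier_free_groupD)

text \<open>Conjugating a loop moves its base point by a right multiplication. Hence the integrals
  from all base points are controlled at once, and the invariant \<open>\<rho>\<close> of the base
  point has to be compatible with right multiplication. It will be constant or the height modulo
  \<open>n\<close>.\<close>

lemma loops_normal:
  fixes d :: "'i \<Rightarrow> 'a \<Rightarrow> 'c::ab_group_add"
  assumes Q: "additive_subgroup Q"
    and \<rho>: "\<And>g g' h. g \<in> carrier G \<Longrightarrow> g' \<in> carrier G \<Longrightarrow> h \<in> carrier G \<Longrightarrow> \<rho> g = \<rho> g' \<Longrightarrow>
          \<rho> (g \<otimes> h) = \<rho> (g' \<otimes> h)"
  shows "{w \<in> carrier (free_group S). pend \<one> w = \<one> \<and> (\<forall>g\<in>carrier G. psum d g w \<in> Q) \<and>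
      (\<forall>g\<in>carrier G. \<forall>g'\<in>carrier G. \<rho> g = \<rho> g' \<longrightarrow> psum d g w = psum d g' w)} \<lhd> free_group S"
    (is "?N \<lhd> ?F")
proof -
  interpret F: group ?F by (rule group_free_group)
  interpret h: group_hom ?F G "pend \<one>"
    by (simp add: group_hom_def group_hom_axioms_def pend_hom F.group_axioms group_axioms)
  have loop: "pend g w = g" if "g \<in> carrier G" "w \<in> carrier ?F" "pend \<one> w = \<one>" for g w
    using that pend_eq[of g w] carrier_free_groupD(2)[of w] by simp
  have mult: "psum d g (u \<otimes>\<^bsub>?F\<^esub> v) = psum d g u + psum d (pend g u) v"
    if "g \<in> carrier G" "u \<in> carrier ?F" for g u v
    using that carrier_free_groupD(2)[of u] by (simp add: mult_free_group psum_foldr)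
  have inv: "psum d (pend g u) (inv\<^bsub>?F\<^esub> u) = - psum d g u"
    if "g \<in> carrier G" "u \<in> carrier ?F" for g u
    using mult[OF that, of "inv\<^bsub>?F\<^esub> u"] that by (simp add: one_free_group eq_neg_iff_add_eq_0 add.commute)
  have N_I: "w \<in> ?N" if "w \<in> carrier ?F" "pend \<one> w = \<one>"
      "\<And>g. g \<in> carrier G \<Longrightarrow> psum d g w \<in> Q"
      "\<And>g g'. g \<in> carrier G \<Longrightarrow> g' \<in> carrier G \<Longrightarrow> \<rho> g = \<rho> g' \<Longrightarrow> psum d g w = psum d g' w" for w
    using that by blast
  have N_D: "w \<in> carrier ?F" "pend \<one> w = \<one>" "g \<in> carrier G \<Longrightarrow> psum d g w \<in> Q"
      "g \<in> carrier G \<Longrightarrow> g' \<in> carrier G \<Longrightarrow> \<rho> g = \<rho> g' \<Longrightarrow> psum d g w = psum d g' w"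
    if "w \<in> ?N" for w g g'
    using that by blast+
  have sub: "subgroup ?N ?F"
  proof (rule F.subgroupI)
    show "?N \<subseteq> carrier ?F" by blast
    have "\<one>\<^bsub>?F\<^esub> \<in> ?N"
      by (rule N_I) (use additive_subgroupD(1)[OF Q] in \<open>auto simp: one_free_group free_group_def\<close>)
    then show "?N \<noteq> {}" by blast
  next
    fix u assume u: "u \<in> ?N"
    have eq: "psum d g (inv\<^bsub>?F\<^esub> u) = - psum d g u" if "g \<in> carrier G" for g
      using inv[OF that N_D(1)[OF u]] loop[OF that N_D(1,2)[OF u]] by simp
    show "inv\<^bsub>?F\<^esub> u \<in> ?N"
    proof (rule N_I)
      fix g g' assume g: "g \<in> carrier G" "g' \<in> carrier G" "\<rho> g = \<rho> g'"
      show "psum d g (inv\<^bsub>?F\<^esub> u) = psum d g' (inv\<^bsub>?F\<^esub> u)"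
        unfolding eq[OF g(1)] eq[OF g(2)] N_D(4)[OF u g] ..
    qed (use N_D(1-3)[OF u] eq additive_subgroupD(3)[OF Q] in auto)
  next
    fix u v assume u: "u \<in> ?N" and v: "v \<in> ?N"
    have eq: "psum d g (u \<otimes>\<^bsub>?F\<^esub> v) = psum d g u + psum d g v" if "g \<in> carrier G" for g
      using mult[OF that N_D(1)[OF u]] loop[OF that N_D(1,2)[OF u]] by simp
    show "u \<otimes>\<^bsub>?F\<^esub> v \<in> ?N"
    proof (rule N_I)
      fix g g' assume g: "g \<in> carrier G" "g' \<in> carrier G" "\<rho> g = \<rho> g'"
      show "psum d g (u \<otimes>\<^bsub>?F\<^esub> v) = psum d g' (u \<otimes>\<^bsub>?F\<^esub> v)"
        unfolding eq[OF g(1)] eq[OF g(2)] N_D(4)[OF u g] N_D(4)[OF v g] ..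
    qed (use N_D(1-3)[OF u] N_D(1-3)[OF v] eq additive_subgroupD(4)[OF Q] in auto)
  qed
  show ?thesis
  proof (rule F.normal_invI[OF sub])
    fix f u assume f: "f \<in> carrier ?F" and u: "u \<in> ?N"
    note [simp] = N_D(1,2)[OF u]
    have pf: "pend g f \<in> carrier G" if "g \<in> carrier G" for g
      using that f by (auto dest: carrier_free_groupD)
    \<comment> \<open>As \<open>u\<close> is a loop, the way back along the inverse of
      \<open>f\<close> starts where \<open>f\<close> ended and cancels it; only the base point of
      \<open>u\<close> has moved.\<close>
    have conj: "psum d g (f \<otimes>\<^bsub>?F\<^esub> u \<otimes>\<^bsub>?F\<^esub> inv\<^bsub>?F\<^esub> f) = psum d (pend g f) u"
      if g: "g \<in> carrier G" for g
    proof -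
      have e: "pend g (f \<otimes>\<^bsub>?F\<^esub> u) = pend g f"
        using g f loop[OF pf[OF g], of u] carrier_free_groupD(2)[OF f]
        by (simp add: mult_free_group pend_foldr)
      show ?thesis using g f mult[of g "f \<otimes>\<^bsub>?F\<^esub> u" "inv\<^bsub>?F\<^esub> f"] mult[of g f u] inv[OF g f] e
        by simp
    qed
    have cls: "\<rho> (pend g f) = \<rho> (pend g' f)"
      if "g \<in> carrier G" "g' \<in> carrier G" "\<rho> g = \<rho> g'" for g g'
      using that f \<rho>[of g g' "pend \<one> f"] pend_eq[of g f] pend_eq[of g' f] carrier_free_groupD(2)[OF f]
      by simp
    show "f \<otimes>\<^bsub>?F\<^esub> u \<otimes>\<^bsub>?F\<^esub> inv\<^bsub>?F\<^esub> f \<in> ?N"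
    proof (rule N_I)
      fix g g' assume g: "g \<in> carrier G" "g' \<in> carrier G" "\<rho> g = \<rho> g'"
      show "psum d g (f \<otimes>\<^bsub>?F\<^esub> u \<otimes>\<^bsub>?F\<^esub> inv\<^bsub>?F\<^esub> f) = psum d g' (f \<otimes>\<^bsub>?F\<^esub> u \<otimes>\<^bsub>?F\<^esub> inv\<^bsub>?F\<^esub> f)"
        unfolding conj[OF g(1)] conj[OF g(2)]
        by (rule N_D(4)[OF u pf[OF g(1)] pf[OF g(2)] cls[OF g]])
    qed (use f N_D(3)[OF u pf] conj in auto)
  qed
qed

end

section \<open>Cochains with prescribed coboundary on right-angled Artin groups\<close>

lemma labelled_group_raag: "labelled_group (raag K) (vertices K) (raag_gen K)"
proof -
  have "raag_gen K v \<in> carrier (raag K)" if "v \<in> vertices K" for v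
    using free_gen_in_carrier[OF that]
    by (auto simp: raag_def presented_group_def carrier_FactGroup raag_gen_def)
  then show ?thesis
    by (simp add: labelled_group_def labelled_group_axioms_def group_raag)
qed

lemma inv_free_group_single:
  assumes "x \<in> S"
  shows "inv\<^bsub>free_group S\<^esub> [(x, b)] = [(x, \<not> b)]"
proof -
  interpret F: group "free_group S" by (rule group_free_group)
  show ?thesis
    by (rule F.inv_equality) (use assms in \<open>auto simp: free_group_def inv_letter_def\<close>)
qed

lemma raag_path_end:
  assumes "w \<in> carrier (free_group (vertices K))"
  shows "path_end (raag K) (raag_gen K) \<one>\<^bsub>raag K\<^esub> w =
    normal_closure (free_group (vertices K)) (raag_relators K) #>\<^bsub>free_group (vertices K)\<^esub> w"
  using assms
proof (induction w)
  let ?F = "free_group (vertices K)"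
  let ?N = "normal_closure ?F (raag_relators K)"
  interpret F: group ?F by (rule group_free_group)
  interpret N: normal ?N ?F by (rule normal_raag_relators)
  interpret G: labelled_group "raag K" "vertices K" "raag_gen K" by (rule labelled_group_raag)
  {
    case Nil
    have "?N #>\<^bsub>?F\<^esub> \<one>\<^bsub>?F\<^esub> = ?N" by (rule F.coset_mult_one[OF N.subset])
    then show ?case by (simp add: one_free_group raag_def presented_group_def)
  next
    case (Cons l w)
    have w: "w \<in> carrier ?F" and l: "fst l \<in> vertices K"
      using Cons.prems by (auto simp: free_group_def dest: reduced_word_tl)
    then have ll: "[l] \<in> carrier ?F" by (simp add: free_group_def)
    have "letter_val (raag K) (raag_gen K) l = ?N #>\<^bsub>?F\<^esub> [l]"
    proof (cases "snd l")
      case True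
      then have "l = (fst l, True)" by (simp add: prod_eq_iff)
      then show ?thesis by (metis True free_gen_def letter_val_def raag_gen_def)
    next
      case False
      then have eq: "l = (fst l, False)" by (simp add: prod_eq_iff)
      have g: "[(fst l, True)] \<in> carrier ?F" using l by (simp add: free_group_def)
      have "inv\<^bsub>raag K\<^esub> (raag_gen K (fst l)) = ?N #>\<^bsub>?F\<^esub> inv\<^bsub>?F\<^esub> [(fst l, True)]"
        unfolding raag_gen_def raag_def presented_group_def free_gen_def
        using g by (simp add: N.inv_FactGroup carrier_FactGroup N.rcos_inv)
      then show ?thesis using False inv_free_group_single[OF l, of True] eq
        by (simp add: letter_val_def)
    qed
    moreover have "[l] \<otimes>\<^bsub>?F\<^esub> w = l # w"
      using Cons.prems by (cases w) (auto simp: free_group_def reduced_word_Cons)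
    moreover have "(?N #>\<^bsub>?F\<^esub> [l]) \<otimes>\<^bsub>raag K\<^esub> (?N #>\<^bsub>?F\<^esub> w) = ?N #>\<^bsub>?F\<^esub> ([l] \<otimes>\<^bsub>?F\<^esub> w)"
      using N.rcos_sum[OF ll w] by (simp add: raag_def presented_group_def)
    moreover have "G.pend \<one>\<^bsub>raag K\<^esub> (l # w) = letter_val (raag K) (raag_gen K) l \<otimes>\<^bsub>raag K\<^esub> G.pend \<one>\<^bsub>raag K\<^esub> w"
      using G.pend_eq[OF G.letter_val_closed[OF l] carrier_free_groupD(2)[OF w]] l by simp
    ultimately show ?case
      using Cons.IH[OF w] by simp
  }
qed

lemma raag_path_end_one_iff:
  assumes "w \<in> carrier (free_group (vertices K))"
  shows "path_end (raag K) (raag_gen K) \<one>\<^bsub>raag K\<^esub> w = \<one>\<^bsub>raag K\<^esub> \<longleftrightarrow>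
    w \<in> normal_closure (free_group (vertices K)) (raag_relators K)"
proof -
  let ?F = "free_group (vertices K)"
  interpret F: group ?F by (rule group_free_group)
  interpret N: normal "normal_closure ?F (raag_relators K)" ?F by (rule normal_raag_relators)
  have one: "\<one>\<^bsub>raag K\<^esub> = normal_closure ?F (raag_relators K)"
    by (simp add: raag_def presented_group_def)
  have "path_end (raag K) (raag_gen K) \<one>\<^bsub>raag K\<^esub> w = \<one>\<^bsub>raag K\<^esub> \<longleftrightarrow>
      normal_closure ?F (raag_relators K) #>\<^bsub>?F\<^esub> w = normal_closure ?F (raag_relators K)"
    by (subst raag_path_end[OF assms]) (simp only: one)
  also have "\<dots> \<longleftrightarrow> w \<in> normal_closure ?F (raag_relators K)"
    by (rule iffI[OF F.coset_join1[OF _ assms N.subgroup_axioms] F.coset_join2[OF assms N.subgroup_axioms]])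
  finally show ?thesis .
qed

lemma raag_surj:
  assumes "g \<in> carrier (raag K)"
  obtains w where "w \<in> carrier (free_group (vertices K))"
    "path_end (raag K) (raag_gen K) \<one>\<^bsub>raag K\<^esub> w = g"
proof -
  obtain w where "w \<in> carrier (free_group (vertices K))"
    "g = normal_closure (free_group (vertices K)) (raag_relators K) #>\<^bsub>free_group (vertices K)\<^esub> w"
    using assms by (auto simp: raag_def presented_group_def carrier_FactGroup)
  then show ?thesis using that raag_path_end by metis
qed

lemma adjacent_vertices: "adjacent K u v \<Longrightarrow> u \<in> vertices K" "adjacent K u v \<Longrightarrow> v \<in> vertices K"
  by (auto simp: adjacent_def vertices_def)

lemma adjacent_sym: "adjacent K u v \<Longrightarrow> adjacent K v u"
  by (auto simp: adjacent_def insert_commute)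

lemma commutator_free_gen:
  assumes "u \<in> S" "v \<in> S" "u \<noteq> v"
  shows "commutator (free_group S) (free_gen u) (free_gen v) =
    [(u, True), (v, True), (u, False), (v, False)]"
  using assms inv_free_group_single[of u S True] inv_free_group_single[of v S True]
  by (simp add: commutator_def free_gen_def mult_free_group inv_letter_def)

text \<open>A discrete Stokes theorem: \<open>r\<close> is the integral around the square of a
  commutator and depends only on the class of its corner, and \<open>loops_normal\<close> spreads
  this from the relators to their normal closure. The labelled group is arbitrary apart from the
  commutation relations, which admits labels obtained from a retraction.\<close>

lemma raag_loop:
  fixes d :: "'v \<Rightarrow> 'g \<Rightarrow> 'a::ab_group_add" and G (structure)
  assumes "labelled_group G (vertices K) e" and Q: "additive_subgroup Q"
    and \<rho>: "\<And>g g' h. g \<in> carrier G \<Longrightarrow> g' \<in> carrier G \<Longrightarrow> h \<in> carrier G \<Longrightarrow> \<rho> g = \<rho> g' \<Longrightarrow>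
          \<rho> (g \<otimes> h) = \<rho> (g' \<otimes> h)"
    and comm: "\<And>u v. adjacent K u v \<Longrightarrow> e u \<otimes> e v = e v \<otimes> e u"
    and r: "\<And>u v g. adjacent K u v \<Longrightarrow> g \<in> carrier G \<Longrightarrow>
          d u g + d v (g \<otimes> e u) - d v g - d u (g \<otimes> e v) = r u v (\<rho> g)"
    and rQ: "\<And>u v g. adjacent K u v \<Longrightarrow> g \<in> carrier G \<Longrightarrow> r u v (\<rho> g) \<in> Q"
    and w: "w \<in> normal_closure (free_group (vertices K)) (raag_relators K)"
  shows "path_end G e \<one> w = \<one>" "g \<in> carrier G \<Longrightarrow> path_sum G e d g w \<in> Q"
    "g \<in> carrier G \<Longrightarrow> g' \<in> carrier G \<Longrightarrow> \<rho> g = \<rho> g' \<Longrightarrow> path_sum G e d g w = path_sum G e d g' w"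
proof -
  let ?F = "free_group (vertices K)"
  interpret labelled_group G "vertices K" e by fact
  let ?N = "{w \<in> carrier ?F. pend \<one> w = \<one> \<and> (\<forall>g\<in>carrier G. psum d g w \<in> Q) \<and>
      (\<forall>g\<in>carrier G. \<forall>g'\<in>carrier G. \<rho> g = \<rho> g' \<longrightarrow> psum d g w = psum d g' w)}"
  have "raag_relators K \<subseteq> ?N"
  proof
    fix x assume x: "x \<in> raag_relators K"
    then obtain u v where adj: "adjacent K u v"
      and "x = commutator ?F (free_gen u) (free_gen v)"
      by (auto simp: raag_relators_def)
    then have x_eq: "x = [(u, True), (v, True), (u, False), (v, False)]"
      using commutator_free_gen adjacent_vertices[OF adj] by (metis adjacent_def)
    have uv [simp]: "u \<in> vertices K" "v \<in> vertices K" using adjacent_vertices[OF adj] by auto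
    \<comment> \<open>An inverse letter read at a point counts minus the edge that ends there. By
      commutation the third side of the square is therefore the \<open>u\<close>-edge that starts at
      \<open>g \<otimes> e v\<close>.\<close>
    have c: "g \<otimes> e u \<otimes> e v \<otimes> inv e u = g \<otimes> e v" if "g \<in> carrier G" for g
      using that comm[OF adj] by (simp add: m_assoc r_inv)
    have "psum d g x = r u v (\<rho> g)" if "g \<in> carrier G" for g
      using that c[OF that] r[OF adj that]
      by (simp add: x_eq letter_val_def m_assoc algebra_simps)
    moreover have "pend \<one> x = \<one>"
      using c[of \<one>] by (simp add: x_eq letter_val_def)
    ultimately show "x \<in> ?N"
      using rQ[OF adj] raag_relators_in_carrier x by auto
  qed
  moreover have "?N \<lhd> ?F"
    by (rule loops_normal[OF Q]) (rule \<rho>)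
  ultimately have sub: "normal_closure ?F (raag_relators K) \<subseteq> ?N"
    by (intro normal_closure_least)
  show "path_end G e \<one> w = \<one>" "g \<in> carrier G \<Longrightarrow> path_sum G e d g w \<in> Q"
    "g \<in> carrier G \<Longrightarrow> g' \<in> carrier G \<Longrightarrow> \<rho> g = \<rho> g' \<Longrightarrow> path_sum G e d g w = path_sum G e d g' w"
    using subsetD[OF sub w] by blast+
qed

lemma path_sum_label_cong:
  assumes "\<And>i. i \<in> fst ` set w \<Longrightarrow> e i = e' i \<and> d i = d' i"
  shows "path_sum G e d g w = path_sum G e' d' g w"
  using assms by (induction w arbitrary: g) (auto simp: letter_val_def)

lemma raag_comm:
  assumes "adjacent K u v"
  shows "raag_gen K u \<otimes>\<^bsub>raag K\<^esub> raag_gen K v = raag_gen K v \<otimes>\<^bsub>raag K\<^esub> raag_gen K u"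
proof -
  interpret G: labelled_group "raag K" "vertices K" "raag_gen K" by (rule labelled_group_raag)
  let ?F = "free_group (vertices K)"
  have uv: "u \<in> vertices K" "v \<in> vertices K" "u \<noteq> v"
    using adjacent_vertices[OF assms] assms by (auto simp: adjacent_def)
  let ?x = "[(u, True), (v, True), (u, False), (v, False)]"
  have xr: "?x \<in> raag_relators K"
    using assms commutator_free_gen[OF uv] by (force simp: raag_relators_def)
  have x: "?x \<in> normal_closure ?F (raag_relators K)" "?x \<in> carrier ?F"
    by (rule subsetD[OF normal_closure_incl xr]) (rule subsetD[OF raag_relators_in_carrier xr])
  have "G.pend \<one>\<^bsub>raag K\<^esub> ?x = \<one>\<^bsub>raag K\<^esub>"
    by (rule iffD2[OF raag_path_end_one_iff[OF x(2)] x(1)])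
  then have "(raag_gen K u \<otimes>\<^bsub>raag K\<^esub> raag_gen K v) \<otimes>\<^bsub>raag K\<^esub> inv\<^bsub>raag K\<^esub> (raag_gen K v \<otimes>\<^bsub>raag K\<^esub> raag_gen K u) = \<one>\<^bsub>raag K\<^esub>"
    using uv by (simp add: letter_val_def G.m_assoc G.inv_mult_group)
  then have "inv\<^bsub>raag K\<^esub> (inv\<^bsub>raag K\<^esub> (raag_gen K v \<otimes>\<^bsub>raag K\<^esub> raag_gen K u)) = raag_gen K u \<otimes>\<^bsub>raag K\<^esub> raag_gen K v"
    using uv(1,2) by (intro G.inv_equality G.inv_closed G.m_closed G.label_closed)
  then show ?thesis
    using G.inv_inv[OF G.m_closed[OF G.label_closed[OF uv(2)] G.label_closed[OF uv(1)]]] by argo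
qed

text \<open>
  Labelling the vertices outside \<open>L\<close> by the identity is the retraction onto the subgroup generated
  by \<open>L\<close>; it turns a relation between the vertices in \<open>L\<close> into a consequence of those commutators
  that only involve \<open>L\<close>.
\<close>

lemma raag_potential:
  fixes a :: "'v \<Rightarrow> 'v word set \<Rightarrow> 'a::ab_group_add" and K
  defines "G \<equiv> raag K" and "e \<equiv> raag_gen K"
  assumes L: "L \<subseteq> vertices K"
    and closed: "\<And>u v g. u \<in> L \<Longrightarrow> v \<in> L \<Longrightarrow> adjacent K u v \<Longrightarrow> g \<in> carrier G \<Longrightarrow>
      a u g + a v (g \<otimes>\<^bsub>G\<^esub> e u) = a v g + a u (g \<otimes>\<^bsub>G\<^esub> e v)"
  shows "\<exists>b. \<forall>u\<in>L. \<forall>g\<in>carrier G. b (g \<otimes>\<^bsub>G\<^esub> e u) - b g = a u g"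
proof -
  let ?V = "vertices K"
  interpret G: labelled_group G ?V e unfolding G_def e_def by (rule labelled_group_raag)
  have zero: "G.psum a g w = 0"
    if w: "fst ` set w \<subseteq> L" "G.pend \<one>\<^bsub>G\<^esub> w = \<one>\<^bsub>G\<^esub>" and g: "g \<in> carrier G" for w g
  proof -
    define e' where "e' u = (if u \<in> L then e u else \<one>\<^bsub>G\<^esub>)" for u
    define a' where "a' u = (if u \<in> L then a u else (\<lambda>_. 0))" for u
    interpret G': labelled_group G ?V e'
      by standard (auto simp: e'_def)
    have wV: "fst ` set w \<subseteq> ?V" using w L by blast
    have "G.pend \<one>\<^bsub>G\<^esub> (reduction w) = \<one>\<^bsub>G\<^esub>" using G.pend_reduction[OF G.one_closed wV] w by simp
    then have red: "reduction w \<in> normal_closure (free_group ?V) (raag_relators K)"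
      using raag_path_end_one_iff[OF reduction_in_carrier[OF wV]] unfolding G_def e_def by blast
    \<comment> \<open>A vertex outside \<open>L\<close> now contributes trivial steps of value 0, so
      the integral around every commutator square vanishes. This permits \<open>Q = {0}\<close> and
      a constant \<open>\<rho>\<close>.\<close>
    have "G'.psum a' g (reduction w) \<in> {0}"
    proof (rule raag_loop(2)[OF G'.labelled_group_axioms, where \<rho> = "\<lambda>_. ()" and r = "\<lambda>_ _ _. 0"])
      fix u v assume adj: "adjacent K u v"
      show "e' u \<otimes>\<^bsub>G\<^esub> e' v = e' v \<otimes>\<^bsub>G\<^esub> e' u"
        using raag_comm[OF adj] adjacent_vertices[OF adj] by (auto simp: e'_def G_def[symmetric] e_def[symmetric])
      fix g assume g: "g \<in> carrier G"
      show "a' u g + a' v (g \<otimes>\<^bsub>G\<^esub> e' u) - a' v g - a' u (g \<otimes>\<^bsub>G\<^esub> e' v) = 0"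
        using closed[OF _ _ adj g] g by (auto simp: a'_def e'_def)
    qed (auto simp: additive_subgroup_def g red)
    then have "G'.psum a' g w = 0" by (simp add: G'.psum_reduction[OF g wV])
    moreover have "G'.psum a' g w = G.psum a g w"
      by (rule path_sum_label_cong) (use w in \<open>auto simp: a'_def e'_def\<close>)
    ultimately show ?thesis by simp
  qed
  have unique: "G.psum a x w = G.psum a x w'"
    if x: "x \<in> carrier G" and w: "fst ` set w \<subseteq> L" "fst ` set w' \<subseteq> L" "G.pend x w = G.pend x w'"
    for x w w'
  proof -
    have wV: "fst ` set w \<subseteq> ?V" "fst ` set w' \<subseteq> ?V" using w L by auto
    let ?u = "w @ inv_word w'"
    have uV: "fst ` set ?u \<subseteq> L" "fst ` set ?u \<subseteq> ?V" using w wV by (auto simp: image_Un)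
    have "G.pend x ?u = x" using G.pend_inv_word[OF x wV(2)] w by simp
    then have "G.pend \<one>\<^bsub>G\<^esub> ?u = \<one>\<^bsub>G\<^esub>"
      using G.pend_eq[OF x uV(2)] x uV(2) G.pend_closed[OF G.one_closed uV(2)]
      by (metis G.l_cancel_one)
    then have "G.psum a x ?u = 0" by (rule zero[OF uV(1) _ x])
    then show ?thesis using G.psum_inv_word[OF x wV(2), of a] w(3) by simp
  qed
  \<comment> \<open>\<open>C g\<close> is the left coset of \<open>g\<close> under the subgroup
    generated by \<open>L\<close>. The base point \<open>x g\<close> is chosen from the set
    \<open>C g\<close>, so equal cosets share it, and \<open>b\<close> integrates \<open>a\<close>
    from there; \<open>unique\<close> is path independence.\<close>
  define C where "C g = {G.pend g w | w. fst ` set w \<subseteq> L}" for g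
  define x where "x g = (SOME y. y \<in> C g)" for g
  have self: "g \<in> C g" for g unfolding C_def by (intro CollectI exI[of _ "[]"]) auto
  have x_C: "x g \<in> C g" for g unfolding x_def using self by (rule someI)
  have C_sub: "C g \<subseteq> carrier G" if "g \<in> carrier G" for g
    using that L by (auto simp: C_def intro!: G.pend_closed)
  have C_trans: "C h \<subseteq> C g" if "h \<in> C g" for g h
  proof
    fix y assume "y \<in> C h"
    then obtain w where "fst ` set w \<subseteq> L" "y = G.pend h w" unfolding C_def by blast
    moreover obtain w' where "fst ` set w' \<subseteq> L" "h = G.pend g w'"
      using \<open>h \<in> C g\<close> unfolding C_def by blast
    ultimately have "y = G.pend g (w' @ w)" "fst ` set (w' @ w) \<subseteq> L" by (auto simp: image_Un)
    then show "y \<in> C g" unfolding C_def by blast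
  qed
  have C_sym: "g \<in> C h" if h: "h \<in> C g" and g: "g \<in> carrier G" for g h
  proof -
    obtain w where w: "fst ` set w \<subseteq> L" "h = G.pend g w" using h by (auto simp: C_def)
    then have "g = G.pend h (inv_word w)" "fst ` set (inv_word w) \<subseteq> L"
      using G.pend_inv_word[OF g, of w] L by auto
    then show "g \<in> C h" unfolding C_def by blast
  qed
  have C_eq: "C h = C g" if "h \<in> C g" "g \<in> carrier G" for g h
    using C_trans[OF that(1)] C_trans[OF C_sym[OF that]] by blast
  define W where "W g = (SOME w. fst ` set w \<subseteq> L \<and> G.pend (x g) w = g)" for g
  define b where "b g = G.psum a (x g) (W g)" for g
  have W: "fst ` set (W g) \<subseteq> L \<and> G.pend (x g) (W g) = g" if g: "g \<in> carrier G" for g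
  proof -
    have "g \<in> C (x g)" using C_sym[OF x_C g] .
    then obtain w where "fst ` set w \<subseteq> L" "g = G.pend (x g) w" unfolding C_def by blast
    then have "\<exists>w. fst ` set w \<subseteq> L \<and> G.pend (x g) w = g" by metis
    then show ?thesis unfolding W_def by (rule someI_ex)
  qed
  have "b (g \<otimes>\<^bsub>G\<^esub> e u) - b g = a u g" if u: "u \<in> L" and g: "g \<in> carrier G" for u g
  proof -
    let ?h = "g \<otimes>\<^bsub>G\<^esub> e u"
    have h: "?h \<in> carrier G" using u g L by auto
    have "?h \<in> C g" unfolding C_def
      using u by (intro CollectI exI[of _ "[(u, True)]"]) (auto simp: letter_val_def)
    then have xx: "x ?h = x g" unfolding x_def using C_eq g by simp
    have xg: "x g \<in> carrier G" using x_C C_sub[OF g] by blast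
    have "b ?h = G.psum a (x g) (W ?h)" by (simp add: b_def xx)
    also have "\<dots> = G.psum a (x g) (W g @ [(u, True)])"
      by (rule unique[OF xg])
        (use W[OF g] W[OF h] u in \<open>auto simp: xx letter_val_def image_Un\<close>)
    also have "\<dots> = b g + a u g" using W[OF g] by (simp add: b_def)
    finally show ?thesis by simp
  qed
  then show ?thesis by blast
qed

text \<open>
  By induction on the vertices: the values on the edges labelled by a new vertex \<open>v\<close> are a potential
  on the cosets of the subgroup generated by the link of \<open>v\<close>.
\<close>

lemma raag_cochain_exists:
  fixes c :: "int \<Rightarrow> 'v \<Rightarrow> 'v \<Rightarrow> 'a::ab_group_add" and K
  defines "G \<equiv> raag K" and "e \<equiv> raag_gen K"
  assumes anti: "\<And>h u v. adjacent K u v \<Longrightarrow> c h v u = - c h u v"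
    and cocycle: "\<And>h u v w. adjacent K u v \<Longrightarrow> adjacent K v w \<Longrightarrow> adjacent K u w \<Longrightarrow>
      c h u w = c h u v + c h v w"
    and "finite W" "W \<subseteq> vertices K"
  shows "\<exists>d. \<forall>u\<in>W. \<forall>v\<in>W. adjacent K u v \<longrightarrow> (\<forall>g\<in>carrier G.
    d u g + d v (g \<otimes>\<^bsub>G\<^esub> e u) - d v g - d u (g \<otimes>\<^bsub>G\<^esub> e v) = c (raag_pi g) u v)"
  using assms(5,6)
proof (induction W)
  case (insert v W)
  interpret G: labelled_group G "vertices K" e unfolding G_def e_def by (rule labelled_group_raag)
  have vV: "v \<in> vertices K" using insert.prems by simp
  have pi: "raag_pi (g \<otimes>\<^bsub>G\<^esub> e u) = raag_pi g + 1" if "g \<in> carrier G" "u \<in> vertices K" for g u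
    using that hom_mult[OF raag_pi_hom, of g K "e u"] G.label_closed[OF that(2)] raag_pi_gen[OF that(2)]
    by (simp add: G_def e_def)
  obtain d where "\<forall>u\<in>W. \<forall>v\<in>W. adjacent K u v \<longrightarrow> (\<forall>g\<in>carrier G.
    d u g + d v (g \<otimes>\<^bsub>G\<^esub> e u) - d v g - d u (g \<otimes>\<^bsub>G\<^esub> e v) = c (raag_pi g) u v)"
    using insert by blast
  then have d: "d u (g \<otimes>\<^bsub>G\<^esub> e v) = d u g + d v (g \<otimes>\<^bsub>G\<^esub> e u) - d v g - c (raag_pi g) u v"
    if "u \<in> W" "v \<in> W" "adjacent K u v" "g \<in> carrier G" for u v g
    using that by (auto simp: algebra_simps)
  define L where "L = {u \<in> W. adjacent K u v}"
  \<comment> \<open>The equation wanted for the square of \<open>u\<close> and the new vertex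
    \<open>v\<close>, solved for the increment along \<open>u\<close> of the unknown
    \<open>b\<close> that is to be the cochain on \<open>v\<close>-edges.\<close>
  define a where "a u g = d u (g \<otimes>\<^bsub>G\<^esub> e v) - d u g + c (raag_pi g) u v" for u g
  have "\<exists>b. \<forall>u\<in>L. \<forall>g\<in>carrier G. b (g \<otimes>\<^bsub>G\<^esub> e u) - b g = a u g"
    unfolding G_def e_def
  proof (rule raag_potential, fold G_def e_def)
    show "L \<subseteq> vertices K" using insert.prems by (auto simp: L_def)
    fix u w g assume u: "u \<in> L" and w: "w \<in> L" and adj: "adjacent K u w" and g: "g \<in> carrier G"
    have [simp]: "u \<in> vertices K" "w \<in> vertices K"
      using adjacent_vertices[OF adj] by auto
    have uv: "adjacent K u v" "adjacent K w v" "u \<in> W" "w \<in> W"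
      using u w by (auto simp: L_def)
    have comm: "g \<otimes>\<^bsub>G\<^esub> e u \<otimes>\<^bsub>G\<^esub> e v = g \<otimes>\<^bsub>G\<^esub> e v \<otimes>\<^bsub>G\<^esub> e u" "g \<otimes>\<^bsub>G\<^esub> e w \<otimes>\<^bsub>G\<^esub> e v = g \<otimes>\<^bsub>G\<^esub> e v \<otimes>\<^bsub>G\<^esub> e w"
      using g vV raag_comm[OF uv(1), folded G_def e_def] raag_comm[OF uv(2), folded G_def e_def]
      by (simp_all add: G.m_assoc)
    let ?h = "raag_pi g"
    have 1: "d u (g \<otimes>\<^bsub>G\<^esub> e w) = d u g + d w (g \<otimes>\<^bsub>G\<^esub> e u) - d w g - c ?h u w"
      by (rule d[OF uv(3,4) adj g])
    have 2: "d u (g \<otimes>\<^bsub>G\<^esub> e v \<otimes>\<^bsub>G\<^esub> e w) = d u (g \<otimes>\<^bsub>G\<^esub> e v) + d w (g \<otimes>\<^bsub>G\<^esub> e v \<otimes>\<^bsub>G\<^esub> e u)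
        - d w (g \<otimes>\<^bsub>G\<^esub> e v) - c (?h + 1) u w"
      using d[OF uv(3,4) adj, of "g \<otimes>\<^bsub>G\<^esub> e v"] g vV by (simp add: pi)
    \<comment> \<open>Used at \<open>h\<close> and at \<open>h + 1\<close>: in the cube spanned by
      \<open>u\<close>, \<open>w\<close> and \<open>v\<close> the prescribed values at the lower and
      at the upper height cancel separately.\<close>
    have 3: "c h u v = c h u w + c h w v" for h
      using cocycle[OF adj uv(2,1)] .
    show "a u g + a w (g \<otimes>\<^bsub>G\<^esub> e u) = a w g + a u (g \<otimes>\<^bsub>G\<^esub> e w)"
      unfolding a_def using g by (simp add: comm pi 1 2 3)
  qed
  then obtain b where b: "\<And>u g. u \<in> L \<Longrightarrow> g \<in> carrier G \<Longrightarrow> b (g \<otimes>\<^bsub>G\<^esub> e u) - b g = a u g"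
    by blast
  have new: "d u g + b (g \<otimes>\<^bsub>G\<^esub> e u) - b g - d u (g \<otimes>\<^bsub>G\<^esub> e v) = c (raag_pi g) u v"
    if "u \<in> W" "adjacent K u v" "g \<in> carrier G" for u g
    using b[of u g] that by (auto simp: L_def a_def algebra_simps)
  have new': "b g + d u (g \<otimes>\<^bsub>G\<^esub> e v) - d u g - b (g \<otimes>\<^bsub>G\<^esub> e u) = c (raag_pi g) v u"
    if "u \<in> W" "adjacent K v u" "g \<in> carrier G" for u g
    using new[OF that(1) adjacent_sym[OF that(2)] that(3)] anti[OF adjacent_sym[OF that(2)], of "raag_pi g"]
    by (simp add: algebra_simps)
  show ?case
  proof (intro exI[of _ "d(v := b)"] ballI impI)
    fix u w g assume uw: "u \<in> insert v W" "w \<in> insert v W" "adjacent K u w" and g: "g \<in> carrier G"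
    then consider "u = v" "w \<in> W" "w \<noteq> v" | "u \<in> W" "w = v" "u \<noteq> v" | "u \<in> W" "w \<in> W" "u \<noteq> v" "w \<noteq> v"
      using insert.hyps(2) by (auto simp: adjacent_def)
    then show "(d(v := b)) u g + (d(v := b)) w (g \<otimes>\<^bsub>G\<^esub> e u) - (d(v := b)) w g - (d(v := b)) u (g \<otimes>\<^bsub>G\<^esub> e w)
      = c (raag_pi g) u w"
      by cases (use new[of u g] new'[of w g] d[of u w g] uw g in auto)
  qed
qed simp

section \<open>Generators of relation modules\<close>

lemma subgroup_add_monoid_relation_module:
  "subgroup H (add_monoid (relation_module F R)) \<longleftrightarrow> subgroup H (abelianization F R)"
  by (simp add: subgroup_def m_inv_def relation_module_def)

lemma (in comm_group) finprod_mem_subgroup: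
  assumes H: "subgroup H G" and "\<And>i. i \<in> I \<Longrightarrow> f i \<in> H"
  shows "finprod G f I \<in> H"
proof (cases "finite I")
  case True
  then show ?thesis using assms(2)
  proof (induction I)
    case (insert i I)
    have "f \<in> insert i I \<rightarrow> carrier G" using insert.prems subgroup.mem_carrier[OF H] by auto
    then show ?case using insert subgroup.m_closed[OF H] by (simp add: Pi_iff)
  qed (simp add: subgroup.one_closed[OF H])
qed (simp add: subgroup.one_closed[OF H])

locale normal_relations = normal R F for R and F (structure)
begin

abbreviation "D \<equiv> derived F R"
abbreviation "A \<equiv> abelianization F R"

lemma D_normal: "D \<lhd> F"
  by (rule derived_is_normal) (rule normal_axioms)

lemma D_subset: "D \<subseteq> R"
  by (rule derived_incl[OF subset_refl subgroup_axioms])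

lemma A_comm_group: "comm_group A"
  by (rule comm_group_abelianization) (rule normal_axioms)

lemma carrier_A: "carrier A = (\<lambda>r. D #> r) ` R"
  by (simp add: abelianization_def carrier_FactGroup r_coset_def)

lemma one_A: "\<one>\<^bsub>A\<^esub> = D"
  by (simp add: abelianization_def)

lemma mult_A:
  assumes "r \<in> R" "s \<in> R"
  shows "(D #> r) \<otimes>\<^bsub>A\<^esub> (D #> s) = D #> (r \<otimes> s)"
proof -
  have "x <#>\<^bsub>F\<lparr>carrier := R\<rparr>\<^esub> y = x <#> y" for x y by (simp add: set_mult_def)
  then show ?thesis
    using normal.rcos_sum[OF D_normal] assms subset by (simp add: abelianization_def subset_iff)
qed

lemma inv_A:
  assumes "r \<in> R"
  shows "inv\<^bsub>A\<^esub> (D #> r) = D #> inv r"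
proof -
  interpret A: comm_group A by (rule A_comm_group)
  have ir: "inv r \<in> R" using assms by (rule m_inv_closed)
  have "D #> \<one> = D" using D_subset subset by (intro coset_mult_one) auto
  then show ?thesis
    using assms ir by (intro A.inv_equality) (auto simp: mult_A carrier_A one_A)
qed

lemma coset_self: "r \<in> R \<Longrightarrow> r \<in> D #> r"
  using rcos_self[of r D] normal_imp_subgroup[OF D_normal] subset by auto

text \<open>A scalar acts as a finite product of integer powers of conjugates, so invariance under
  conjugation turns a subgroup into a submodule.\<close>

lemma smult_mem:
  assumes H: "subgroup H A" and a: "a \<in> carrier (integral_group_ring (F Mod R))" and x: "x \<in> H"
    and conj: "\<And>f r. f \<in> carrier F \<Longrightarrow> r \<in> R \<Longrightarrow> D #> r \<in> H \<Longrightarrow> D #> (f \<otimes> r \<otimes> inv f) \<in> H"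
  shows "a \<odot>\<^bsub>relation_module F R\<^esub> x \<in> H"
proof -
  interpret A: comm_group A by (rule A_comm_group)
  have "conj_action F g x [^]\<^bsub>A\<^esub> Poly_Mapping.lookup a g \<in> H" if "g \<in> Poly_Mapping.keys a" for g
  proof -
    have "g \<in> carrier (F Mod R)" using a that by (auto simp: integral_group_ring_def)
    then obtain f where f: "f \<in> carrier F" "g = R #> f" by (auto simp: carrier_FactGroup)
    obtain r where r: "r \<in> R" "x = D #> r"
      using x subgroup.subset[OF H] by (auto simp: carrier_A)
    have "conj_action F g x = D #> (f \<otimes> r \<otimes> inv f)"
      unfolding f r by (rule conj_action_coset[OF normal_axioms f(1) r(1)])
    then show ?thesis
      using conj[OF f(1) r(1)] x r A.subgroup_int_pow_closed[OF H] by simp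
  qed
  then show ?thesis
    by (simp add: relation_module_def A.finprod_mem_subgroup[OF H])
qed

text \<open>
  A homomorphism from \<open>R\<close> to an abelian group that is invariant under conjugation factors through
  the coinvariants of the relation module.
\<close>

lemma invariant_hom_eq_0:
  fixes \<psi> :: "'a \<Rightarrow> 'c::ab_group_add"
  assumes gen: "module_generates (integral_group_ring (F Mod R)) (relation_module F R) X"
    and mult: "\<And>r s. r \<in> R \<Longrightarrow> s \<in> R \<Longrightarrow> \<psi> (r \<otimes> s) = \<psi> r + \<psi> s"
    and conj: "\<And>f r. f \<in> carrier F \<Longrightarrow> r \<in> R \<Longrightarrow> \<psi> (f \<otimes> r \<otimes> inv f) = \<psi> r"
    and X: "\<And>x. x \<in> X \<Longrightarrow> \<exists>r\<in>R. x = D #> r \<and> \<psi> r = 0"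
    and r: "r \<in> R"
  shows "\<psi> r = 0"
proof -
  interpret A: comm_group A by (rule A_comm_group)
  define N where "N = {r \<in> R. \<psi> r = 0}"
  have \<psi>1: "\<psi> \<one> = 0" using mult[of \<one> \<one>] one_closed by simp
  have \<psi>inv: "\<psi> (inv r) = - \<psi> r" if "r \<in> R" for r
    using mult[OF that m_inv_closed[OF that]] that \<psi>1 subset
    by (auto simp: eq_neg_iff_add_eq_0 add.commute)
  have sub: "subgroup N F"
  proof (rule subgroupI)
    have "\<one> \<in> N" using one_closed \<psi>1 by (simp add: N_def)
    then show "N \<noteq> {}" by blast
  qed (use \<psi>inv mult subset in \<open>auto simp: N_def\<close>)
  have "derived_set F R \<subseteq> N"
  proof clarify
    fix x y assume xy: "x \<in> R" "y \<in> R"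
    have "\<psi> (x \<otimes> y \<otimes> inv x \<otimes> inv y) = 0"
      using xy by (simp add: mult m_closed m_inv_closed \<psi>inv)
    then show "x \<otimes> y \<otimes> inv x \<otimes> inv y \<in> N"
      using xy by (simp add: N_def m_closed m_inv_closed)
  qed
  then have D0: "D \<subseteq> N"
    unfolding derived_def by (rule generate_subgroup_incl[OF _ sub])
  define H where "H = (\<lambda>r. D #> r) ` N"
  have NR: "N \<subseteq> R" by (auto simp: N_def)
  have H: "subgroup H A"
  proof (rule A.subgroupI)
    show "H \<subseteq> carrier A" using NR by (auto simp: H_def carrier_A)
    show "H \<noteq> {}" using subgroup.one_closed[OF sub] by (auto simp: H_def)
    show "inv\<^bsub>A\<^esub> c \<in> H" if "c \<in> H" for c
      using that NR subgroup.m_inv_closed[OF sub] by (auto simp: H_def inv_A subset_iff)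
    show "b \<otimes>\<^bsub>A\<^esub> c \<in> H" if "b \<in> H" "c \<in> H" for b c
      using that NR subgroup.m_closed[OF sub] by (auto simp: H_def mult_A subset_iff)
  qed
  \<comment> \<open>The target is abelian, so \<open>N\<close> contains \<open>D\<close>, and
    membership in \<open>N\<close> can be tested on cosets of \<open>D\<close>.\<close>
  have memH: "s \<in> N" if s: "s \<in> R" "D #> s \<in> H" for s
  proof -
    obtain t where t: "t \<in> N" "D #> s = D #> t" using s(2) by (auto simp: H_def)
    then have "s \<in> D #> t" using coset_self[OF s(1)] by simp
    then obtain d where "d \<in> D" "s = d \<otimes> t" by (auto simp: r_coset_def)
    then show ?thesis using D0 t(1) subgroup.m_closed[OF sub] by blast
  qed
  have "submodule H (integral_group_ring (F Mod R)) (relation_module F R)"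
  proof (intro submodule.intro submodule_axioms.intro)
    show "subgroup H (add_monoid (relation_module F R))"
      using H by (simp only: subgroup_add_monoid_relation_module)
    fix a x assume "a \<in> carrier (integral_group_ring (F Mod R))" "x \<in> H"
    then show "a \<odot>\<^bsub>relation_module F R\<^esub> x \<in> H"
    proof (rule smult_mem[OF H])
      fix f s assume f: "f \<in> carrier F" and s: "s \<in> R" "D #> s \<in> H"
      have "f \<otimes> s \<otimes> inv f \<in> N"
        using memH[OF s] conj[OF f s(1)] inv_op_closed2[OF f s(1)] by (simp add: N_def)
      then show "D #> (f \<otimes> s \<otimes> inv f) \<in> H" by (auto simp: H_def)
    qed
  qed
  moreover have "X \<subseteq> H" using X by (fastforce simp: H_def N_def)
  ultimately have "H = carrier (relation_module F R)"
    using gen by (auto simp: module_generates_def)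
  then have "D #> r \<in> H" using r by (simp add: relation_module_def carrier_A)
  then show ?thesis using memH[OF r] by (simp add: N_def)
qed

text \<open>The preimage in \<open>R\<close> of a submodule is normal in \<open>F\<close>, so it is
  all of \<open>R\<close> once it contains normal generators. This ensures that the
  \<open>LEAST\<close> in \<open>min_generators\<close> is attained by an actual generating
  set.\<close>

lemma relation_module_finitely_generated:
  assumes T: "finite T" "T \<subseteq> carrier F" and R: "R = normal_closure F T"
  shows "\<exists>X. finite X \<and> module_generates (integral_group_ring (F Mod R)) (relation_module F R) X"
proof (intro exI conjI)
  interpret A: comm_group A by (rule A_comm_group)
  let ?M = "relation_module F R"
  have TR: "T \<subseteq> R" unfolding R by (rule normal_closure_incl)
  show "finite ((\<lambda>r. D #> r) ` T)" using T by simp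
  show "module_generates (integral_group_ring (F Mod R)) ?M ((\<lambda>r. D #> r) ` T)"
    unfolding module_generates_def
  proof (intro conjI allI impI; (elim conjE)?)
    show "(\<lambda>r. D #> r) ` T \<subseteq> carrier ?M" using TR by (auto simp: relation_module_def carrier_A)
    fix H assume sm: "submodule H (integral_group_ring (F Mod R)) ?M" and TH: "(\<lambda>r. D #> r) ` T \<subseteq> H"
    have H: "subgroup H A"
      using submodule.axioms(1)[OF sm] by (simp only: subgroup_add_monoid_relation_module)
    define N where "N = {r \<in> R. D #> r \<in> H}"
    have D1: "D #> \<one> = D" using D_subset subset by (intro coset_mult_one) auto
    have sub: "subgroup N F"
    proof (rule subgroupI)
      show "N \<subseteq> carrier F" using subset by (auto simp: N_def)
      have "\<one> \<in> N" using subgroup.one_closed[OF H] by (simp add: N_def D1 one_A)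
      then show "N \<noteq> {}" by blast
      show "inv r \<in> N" if "r \<in> N" for r
        using that subgroup.m_inv_closed[OF H, of "D #> r"] by (simp add: N_def inv_A)
      show "r \<otimes> s \<in> N" if "r \<in> N" "s \<in> N" for r s
        using that subgroup.m_closed[OF H, of "D #> r" "D #> s"] by (simp add: N_def mult_A)
    qed
    have "N \<lhd> F"
    proof (rule normal_invI[OF sub])
      fix f r assume f: "f \<in> carrier F" and "r \<in> N"
      then have r: "r \<in> R" "D #> r \<in> H" by (auto simp: N_def)
      \<comment> \<open>This basis element of the group ring acts as conjugation by
        \<open>f\<close>, so closure under scalars becomes normality of \<open>N\<close>.\<close>
      let ?a = "frag_of (R #> f)"
      have "?a \<in> carrier (integral_group_ring (F Mod R))"
        using f by (auto simp: integral_group_ring_def carrier_FactGroup)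
      then have "?a \<odot>\<^bsub>?M\<^esub> (D #> r) \<in> H"
        by (rule submodule.smult_closed[OF sm _ r(2)])
      moreover have fr: "f \<otimes> r \<otimes> inv f \<in> R" by (rule inv_op_closed2[OF f r(1)])
      moreover have "?a \<odot>\<^bsub>?M\<^esub> (D #> r) = D #> (f \<otimes> r \<otimes> inv f)"
      proof -
        have "D #> (f \<otimes> r \<otimes> inv f) \<in> carrier A" using fr by (simp add: carrier_A)
        then show ?thesis
          by (simp add: relation_module_def conj_action_coset[OF normal_axioms f r(1)] A.int_pow_1)
      qed
      ultimately show "f \<otimes> r \<otimes> inv f \<in> N" by (simp add: N_def)
    qed
    moreover have "T \<subseteq> N" using TH TR by (auto simp: N_def)
    ultimately have "R \<subseteq> N" using normal_closure_least R by metis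
    then have "carrier ?M \<subseteq> H" by (auto simp: relation_module_def carrier_A N_def)
    then show "H = carrier ?M" using subgroup.subset[OF H] by (auto simp: relation_module_def)
  qed
qed

end

lemma min_generators_attained:
  assumes "finite Y" "module_generates S M Y"
  obtains X where "finite X" "card X = min_generators S M" "module_generates S M X"
proof -
  have "\<exists>d X. finite X \<and> card X = d \<and> module_generates S M X" using assms by blast
  then have "\<exists>X. finite X \<and> card X = min_generators S M \<and> module_generates S M X"
    unfolding min_generators_def by (rule LeastI_ex)
  then show ?thesis using that by blast
qed

section \<open>Finite presentations of the groups \<open>\<Gamma>\<^sub>n\<close>\<close>

lemma exponent_sum_simps [simp]:
  "exponent_sum [] = 0" "exponent_sum (l # w) = (if snd l then 1 else -1) + exponent_sum w"
  "exponent_sum (u @ v) = exponent_sum u + exponent_sum v"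
  by (simp_all add: exponent_sum_def)

lemma exponent_sum_inv_word [simp]: "exponent_sum (inv_word w) = - exponent_sum w"
  by (induction w) (auto simp: inv_letter_def)

lemma exponent_sum_replicate [simp]: "exponent_sum (replicate m (x, True)) = int m"
  by (induction m) auto

lemma (in labelled_group) hom_eq_pend:
  assumes h: "h \<in> hom (free_group S) G" and gen: "\<And>i. i \<in> S \<Longrightarrow> h [(i, True)] = e i"
    and w: "w \<in> carrier (free_group S)"
  shows "h w = pend \<one> w"
  using w
proof (induction w)
  interpret h: group_hom "free_group S" G h
    by (simp add: group_hom_def group_hom_axioms_def h group_free_group group_axioms)
  {
    case Nil
    show ?case using h.hom_one by (simp add: one_free_group)
  next
    case (Cons l w)
    have w: "w \<in> carrier (free_group S)" and l: "fst l \<in> S"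
      using Cons.prems by (auto simp: free_group_def dest: reduced_word_tl)
    then have ll: "[l] \<in> carrier (free_group S)" "[(fst l, True)] \<in> carrier (free_group S)"
      by (simp_all add: free_group_def)
    have "h [l] = letter_val G e l"
      using l gen[OF l] h.hom_inv[OF ll(2)] inv_free_group_single[OF l, of True]
      by (cases l; cases "snd l") (auto simp: letter_val_def)
    moreover have "[l] \<otimes>\<^bsub>free_group S\<^esub> w = l # w"
      using Cons.prems by (cases w) (auto simp: free_group_def reduced_word_Cons)
    ultimately have "h (l # w) = letter_val G e l \<otimes> pend \<one> w"
      using h.hom_mult[OF ll(1) w] Cons.IH[OF w] by simp
    also have "\<dots> = pend \<one> (l # w)"
      using pend_eq[OF letter_val_closed[OF l] carrier_free_groupD(2)[OF w]] l by simp
    finally show ?case .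
  }
qed

lemma (in labelled_group) psum_const:
  "psum (\<lambda>i _. lam i) g w = psum (\<lambda>i _. lam i) g' w"
proof (induction w arbitrary: g g')
  case (Cons l w)
  show ?case
    using Cons.IH[of "g \<otimes> letter_val G e l" "g' \<otimes> letter_val G e l"] by simp
qed simp

lemma (in labelled_group) psum_zero [simp]: "psum (\<lambda>_ _. 0) g w = 0"
  by (induction w arbitrary: g) auto

lemma (in labelled_group) psum_mem:
  assumes Q: "additive_subgroup Q" and d: "\<And>i g. i \<in> S \<Longrightarrow> g \<in> carrier G \<Longrightarrow> d i g \<in> Q"
  shows "g \<in> carrier G \<Longrightarrow> fst ` set w \<subseteq> S \<Longrightarrow> psum d g w \<in> Q"
proof (induction w arbitrary: g)
  case Nil
  then show ?case using additive_subgroupD(1)[OF Q] by simp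
next
  case (Cons l w)
  have "psum d (g \<otimes> letter_val G e l) w \<in> Q" using Cons by simp
  then show ?case
    using d Cons.prems additive_subgroupD(3,4)[OF Q] by auto
qed

lemma (in labelled_group) pend_cancel:
  assumes "g \<in> carrier G" "fst ` set a \<subseteq> S" "fst ` set b \<subseteq> S"
  shows "pend g (a @ inv_word b @ b @ x) = pend g (a @ x)"
  using pend_inv_word[of "pend g a" "inv_word b"] assms by simp

lemma (in labelled_group) psum_cancel:
  assumes "g \<in> carrier G" "fst ` set a \<subseteq> S" "fst ` set b \<subseteq> S"
  shows "psum d g (a @ inv_word b @ b @ x) = psum d g (a @ x)"
  using pend_inv_word[of "pend g a" "inv_word b"] psum_inv_word[of "pend g a" "inv_word b" d] assms
  by (simp add: add.assoc)

text \<open>The isomorphism with \<open>\<Gamma>\<^sub>n\<close> is unpacked into a homomorphism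
  \<open>\<theta>\<close> from the free group to the whole Artin group. Words over the generators
  and words over the vertices then trace paths in the same group and can be compared at their end
  points.\<close>

locale Gamma_presentation =
  fixes K :: "'v set set" and n k :: nat and R :: "nat word set" and \<theta> :: "nat word \<Rightarrow> 'v word set"
  assumes conn: "connected_complex K"
    and n_pos: "0 < n"
    and R_normal: "R \<lhd> free_group {..<k}"
    and \<theta>_hom: "\<theta> \<in> hom (free_group {..<k}) (raag K)"
    and \<theta>_image: "\<theta> ` carrier (free_group {..<k}) = {g \<in> carrier (raag K). int n dvd raag_pi g}"
    and \<theta>_kernel: "f \<in> carrier (free_group {..<k}) \<Longrightarrow> \<theta> f = \<one>\<^bsub>raag K\<^esub> \<longleftrightarrow> f \<in> R"
begin

abbreviation "F \<equiv> free_group {..<k}"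
abbreviation "G \<equiv> raag K"
abbreviation "V \<equiv> vertices K"
abbreviation "e \<equiv> raag_gen K"

definition gam :: "nat \<Rightarrow> 'v word set" where
  "gam i = \<theta> [(i, True)]"

lemma gen_carrier: "i < k \<Longrightarrow> [(i, b)] \<in> carrier F"
  by (simp add: free_group_def)

sublocale E: labelled_group G V e
  by (rule labelled_group_raag)

sublocale X: labelled_group G "{..<k}" gam
proof
  show "gam i \<in> carrier G" if "i \<in> {..<k}" for i
    using hom_in_carrier[OF \<theta>_hom] gen_carrier that by (simp add: gam_def)
qed

sublocale F: group F
  by (rule group_free_group)

sublocale N: normal_relations R F
  by (simp add: normal_relations_def R_normal)

lemma \<theta>_eq: "w \<in> carrier F \<Longrightarrow> \<theta> w = X.pend \<one>\<^bsub>G\<^esub> w"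
  by (rule X.hom_eq_pend[OF \<theta>_hom]) (auto simp: gam_def)

lemma raag_pi_mult:
  "g \<in> carrier G \<Longrightarrow> h \<in> carrier G \<Longrightarrow> raag_pi (g \<otimes>\<^bsub>G\<^esub> h) = raag_pi g + raag_pi h"
  using hom_mult[OF raag_pi_hom] by simp

lemma raag_pi_one: "raag_pi \<one>\<^bsub>G\<^esub> = 0"
  using raag_pi_mult[of "\<one>\<^bsub>G\<^esub>" "\<one>\<^bsub>G\<^esub>"] by simp

lemma raag_pi_inv: "g \<in> carrier G \<Longrightarrow> raag_pi (inv\<^bsub>G\<^esub> g) = - raag_pi g"
  using raag_pi_mult[of g "inv\<^bsub>G\<^esub> g"] by (simp add: raag_pi_one)

lemma raag_pi_pend:
  "g \<in> carrier G \<Longrightarrow> fst ` set w \<subseteq> V \<Longrightarrow> raag_pi (E.pend g w) = raag_pi g + exponent_sum w"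
  by (induction w arbitrary: g)
    (auto simp: raag_pi_mult raag_pi_inv raag_pi_gen letter_val_def)

lemma X_pend_dvd:
  assumes "fst ` set w \<subseteq> {..<k}"
  shows "int n dvd raag_pi (X.pend \<one>\<^bsub>G\<^esub> w)"
proof -
  have "X.pend \<one>\<^bsub>G\<^esub> w = \<theta> (reduction w)"
    using X.pend_reduction[OF E.one_closed assms] \<theta>_eq[OF reduction_in_carrier[OF assms]] by simp
  then show ?thesis using \<theta>_image reduction_in_carrier[OF assms] by blast
qed

section \<open>Translating words over the generators of the presentation into words over the
  vertices\<close>

definition om :: "nat \<Rightarrow> 'v word" where
  "om i = (SOME w. w \<in> carrier (free_group V) \<and> E.pend \<one>\<^bsub>G\<^esub> w = gam i)"

lemma om:
  assumes "i < k"
  shows "fst ` set (om i) \<subseteq> V" "g \<in> carrier G \<Longrightarrow> E.pend g (om i) = g \<otimes>\<^bsub>G\<^esub> gam i"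
proof -
  have "\<exists>w. w \<in> carrier (free_group V) \<and> E.pend \<one>\<^bsub>G\<^esub> w = gam i"
    using raag_surj[OF X.label_closed[of i]] assms by (metis lessThan_iff)
  then have "om i \<in> carrier (free_group V) \<and> E.pend \<one>\<^bsub>G\<^esub> (om i) = gam i"
    unfolding om_def by (rule someI_ex)
  then show "fst ` set (om i) \<subseteq> V" and "g \<in> carrier G \<Longrightarrow> E.pend g (om i) = g \<otimes>\<^bsub>G\<^esub> gam i"
    using E.pend_eq[of g "om i"] carrier_free_groupD(2)[of "om i" V] by auto
qed

definition lift_word :: "nat word \<Rightarrow> 'v word" where
  "lift_word w = concat (map (\<lambda>l. if snd l then om (fst l) else inv_word (om (fst l))) w)"

text \<open>The summand \<open>lam i\<close> is constant in \<open>g\<close>: it adds the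
  homomorphism on the free group with these values on the generators. Letting it vary produces the
  factor \<open>card Q ^ k\<close> in \<open>card_bound\<close>.\<close>

definition pull :: "('v \<Rightarrow> 'v word set \<Rightarrow> 'a::ab_group_add) \<Rightarrow> (nat \<Rightarrow> 'a) \<Rightarrow> nat \<Rightarrow> 'v word set \<Rightarrow> 'a" where
  "pull d lam i g = E.psum d g (om i) + lam i"

lemma lift_word_letters: "fst ` set w \<subseteq> {..<k} \<Longrightarrow> fst ` set (lift_word w) \<subseteq> V"
proof (induction w)
  case (Cons l w)
  then show ?case using om(1)[of "fst l"] by (auto simp: lift_word_def image_Un)
qed (simp add: lift_word_def)

lemma lift_word_Cons:
  "lift_word (l # w) = (if snd l then om (fst l) else inv_word (om (fst l))) @ lift_word w"
  by (simp add: lift_word_def)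

lemma lift_word_aux:
  assumes "fst ` set w \<subseteq> {..<k}" "g \<in> carrier G"
  shows "E.pend g (lift_word w) = X.pend g w \<and>
    X.psum (pull d lam) g w = E.psum d g (lift_word w) + X.psum (\<lambda>i _. lam i) \<one>\<^bsub>G\<^esub> w"
  using assms
proof (induction w arbitrary: g)
  case (Cons l w)
  let ?i = "fst l" and ?g = "g \<otimes>\<^bsub>G\<^esub> letter_val G gam l"
  let ?u = "if snd l then om ?i else inv_word (om ?i)"
  have i: "?i < k" and w: "fst ` set w \<subseteq> {..<k}" and g: "g \<in> carrier G" "?g \<in> carrier G"
    using Cons.prems by auto
  have gi: "gam ?i \<in> carrier G" using i by simp
  have p: "E.pend g ?u = ?g" and
    s: "(if snd l then pull d lam ?i g else - pull d lam ?i (g \<otimes>\<^bsub>G\<^esub> inv\<^bsub>G\<^esub> gam ?i)) =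
      E.psum d g ?u + (if snd l then lam ?i else - lam ?i)"
  proof -
    let ?h = "g \<otimes>\<^bsub>G\<^esub> inv\<^bsub>G\<^esub> gam ?i"
    have h: "?h \<in> carrier G" "E.pend ?h (om ?i) = g"
      using om(2)[OF i, of ?h] g gi by (simp_all add: E.m_assoc)
    have "E.pend g (inv_word (om ?i)) = ?h" "E.psum d g (inv_word (om ?i)) = - E.psum d ?h (om ?i)"
      using E.pend_inv_word[OF h(1) om(1)[OF i]] E.psum_inv_word[OF h(1) om(1)[OF i], of d] h(2) by auto
    then show "E.pend g ?u = ?g"
      "(if snd l then pull d lam ?i g else - pull d lam ?i (g \<otimes>\<^bsub>G\<^esub> inv\<^bsub>G\<^esub> gam ?i)) =
      E.psum d g ?u + (if snd l then lam ?i else - lam ?i)"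
      using om(2)[OF i g(1)] by (auto simp: letter_val_def pull_def)
  qed
  have "X.psum (\<lambda>i _. lam i) \<one>\<^bsub>G\<^esub> (l # w) =
    (if snd l then lam ?i else - lam ?i) + X.psum (\<lambda>i _. lam i) \<one>\<^bsub>G\<^esub> w"
    using X.psum_const[of lam "\<one>\<^bsub>G\<^esub> \<otimes>\<^bsub>G\<^esub> letter_val G gam l" w "\<one>\<^bsub>G\<^esub>"] by simp
  then show ?case
    using Cons.IH[OF w g(2)] p s by (simp add: lift_word_Cons algebra_simps)
qed (simp_all add: lift_word_def)

lemma lift_word:
  assumes "fst ` set w \<subseteq> {..<k}" "g \<in> carrier G"
  shows "E.pend g (lift_word w) = X.pend g w"
    and "X.psum (pull d lam) g w = E.psum d g (lift_word w) + X.psum (\<lambda>i _. lam i) \<one>\<^bsub>G\<^esub> w"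
  using lift_word_aux[OF assms, of "\<lambda>_ _. 0 :: int" "\<lambda>_. 0"] lift_word_aux[OF assms, of d lam]
  by blast+

section \<open>The invariant homomorphism on relations defined by a cochain\<close>

definition cobounds :: "('v \<Rightarrow> 'v word set \<Rightarrow> 'a::ab_group_add) \<Rightarrow> (int \<Rightarrow> 'v \<Rightarrow> 'v \<Rightarrow> 'a) \<Rightarrow> bool" where
  "cobounds d c \<longleftrightarrow> (\<forall>u v. adjacent K u v \<longrightarrow> (\<forall>g\<in>carrier G.
     d u g + d v (g \<otimes>\<^bsub>G\<^esub> e u) - d v g - d u (g \<otimes>\<^bsub>G\<^esub> e v) = c (raag_pi g mod int n) u v))"

text \<open>A loop is a consequence of the commutators, and the integral around a square is a value
  of \<open>c\<close>, which depends on the corner only through its height modulo \<open>n\<close>.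
  Thus loop integrals are periodic and lie in \<open>Q\<close>, although neither is asked of
  \<open>d\<close> itself.\<close>

lemma loop_psum:
  assumes d: "cobounds d c" and y: "fst ` set y \<subseteq> V" "E.pend \<one>\<^bsub>G\<^esub> y = \<one>\<^bsub>G\<^esub>"
    and Q: "additive_subgroup Q" "\<And>h u v. adjacent K u v \<Longrightarrow> c h u v \<in> Q"
    and g: "g \<in> carrier G"
  shows "E.psum d g y \<in> Q"
    and "g' \<in> carrier G \<Longrightarrow> raag_pi g mod int n = raag_pi g' mod int n \<Longrightarrow> E.psum d g y = E.psum d g' y"
proof -
  have "E.pend \<one>\<^bsub>G\<^esub> (reduction y) = \<one>\<^bsub>G\<^esub>" using E.pend_reduction[OF E.one_closed y(1)] y(2) by simp
  then have mem: "reduction y \<in> normal_closure (free_group V) (raag_relators K)"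
    using raag_path_end_one_iff[OF reduction_in_carrier[OF y(1)]] by simp
  have \<rho>: "raag_pi (g \<otimes>\<^bsub>G\<^esub> h) mod int n = raag_pi (g' \<otimes>\<^bsub>G\<^esub> h) mod int n"
    if "g \<in> carrier G" "g' \<in> carrier G" "h \<in> carrier G" "raag_pi g mod int n = raag_pi g' mod int n" for g g' h
    using that by (simp add: raag_pi_mult) (metis mod_add_left_eq)
  note * = raag_loop[OF labelled_group_raag Q(1), where \<rho> = "\<lambda>g. raag_pi g mod int n" and d = d and
      r = "\<lambda>u v h. c h u v", OF \<rho> raag_comm _ Q(2) mem]
  have cob: "d u g + d v (g \<otimes>\<^bsub>G\<^esub> e u) - d v g - d u (g \<otimes>\<^bsub>G\<^esub> e v) = c (raag_pi g mod int n) u v"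
    if "adjacent K u v" "g \<in> carrier G" for u v g
    using d that by (simp add: cobounds_def)
  have "E.psum d g (reduction y) \<in> Q"
    by (rule *(2)) (use cob g in auto)
  then show "E.psum d g y \<in> Q" by (simp add: E.psum_reduction[OF g y(1)])
  show "E.psum d g y = E.psum d g' y"
    if g': "g' \<in> carrier G" and eq: "raag_pi g mod int n = raag_pi g' mod int n"
  proof -
    have "E.psum d g (reduction y) = E.psum d g' (reduction y)"
      by (rule *(3)) (use cob g g' eq in auto)
    then show ?thesis by (simp add: E.psum_reduction[OF g y(1)] E.psum_reduction[OF g' y(1)])
  qed
qed

abbreviation phi :: "('v \<Rightarrow> 'v word set \<Rightarrow> 'a::ab_group_add) \<Rightarrow> (nat \<Rightarrow> 'a) \<Rightarrow> nat word \<Rightarrow> 'a" where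
  "phi d lam w \<equiv> X.psum (pull d lam) \<one>\<^bsub>G\<^esub> w"

lemma loop_in_R:
  assumes "fst ` set w \<subseteq> {..<k}" "X.pend \<one>\<^bsub>G\<^esub> w = \<one>\<^bsub>G\<^esub>"
  shows "reduction w \<in> R"
  using assms X.pend_reduction[OF E.one_closed assms(1)]
    \<theta>_eq[OF reduction_in_carrier[OF assms(1)]] \<theta>_kernel[OF reduction_in_carrier[OF assms(1)]]
  by simp

lemma R_loop:
  assumes "r \<in> R"
  shows "fst ` set r \<subseteq> {..<k}" "X.pend \<one>\<^bsub>G\<^esub> r = \<one>\<^bsub>G\<^esub>" "g \<in> carrier G \<Longrightarrow> X.pend g r = g"
proof -
  have r: "r \<in> carrier F" using assms N.subset by blast
  then show 1: "fst ` set r \<subseteq> {..<k}" by (rule carrier_free_groupD(2))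
  show 2: "X.pend \<one>\<^bsub>G\<^esub> r = \<one>\<^bsub>G\<^esub>" using \<theta>_eq[OF r] \<theta>_kernel[OF r] assms by simp
  show "g \<in> carrier G \<Longrightarrow> X.pend g r = g" using X.pend_eq[of g r] 1 2 by simp
qed

text \<open>The lift of a relation is a loop, so \<open>loop_psum\<close> applies to the part of the
  integral that comes from \<open>d\<close>; the part from \<open>lam\<close> is the same at every
  base point.\<close>

lemma phi_invariant:
  assumes d: "cobounds d c" and r: "r \<in> R" and g: "g \<in> carrier G" "int n dvd raag_pi g"
  shows "X.psum (pull d lam) g r = phi d lam r"
proof -
  note r' = R_loop[OF r]
  have "E.psum d g (lift_word r) = E.psum d \<one>\<^bsub>G\<^esub> (lift_word r)"
    \<comment> \<open>\<open>Q = UNIV\<close> is chosen because only independence of the base point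
      is wanted here.\<close>
    by (rule loop_psum(2)[OF d, where Q = UNIV])
      (use r' g lift_word(1)[OF r'(1) E.one_closed] lift_word_letters[OF r'(1)] in
        \<open>auto simp: additive_subgroup_def raag_pi_one\<close>)
  then show ?thesis
    using lift_word(2)[OF r'(1) g(1), of d lam] lift_word(2)[OF r'(1) E.one_closed, of d lam] by simp
qed

lemma phi_mult:
  assumes "r \<in> R" "s \<in> R"
  shows "phi d lam (r \<otimes>\<^bsub>F\<^esub> s) = phi d lam r + phi d lam s"
  using R_loop[OF assms(1)] by (simp add: mult_free_group X.psum_foldr)

text \<open>Conjugation by \<open>f\<close> moves the base point of the loop \<open>r\<close> to the
  image of \<open>f\<close>. This lies in \<open>\<Gamma>\<^sub>n\<close>, hence has height 0 modulo
  \<open>n\<close>, and \<open>phi_invariant\<close> applies; the integrals along \<open>f\<close>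
  and back cancel.\<close>

lemma phi_conj:
  assumes d: "cobounds d c" and r: "r \<in> R" and f: "f \<in> carrier F"
  shows "phi d lam (f \<otimes>\<^bsub>F\<^esub> r \<otimes>\<^bsub>F\<^esub> inv\<^bsub>F\<^esub> f) = phi d lam r"
proof -
  note f' = carrier_free_groupD(2)[OF f] and r' = R_loop[OF r]
  have fi: "inv\<^bsub>F\<^esub> f \<in> carrier F" using f by simp
  let ?g = "X.pend \<one>\<^bsub>G\<^esub> f"
  have g: "?g \<in> carrier G" "int n dvd raag_pi ?g" using f' X_pend_dvd by auto
  have fr: "fst ` set (foldr cancel_cons f r) \<subseteq> {..<k}"
  proof -
    have "f \<otimes>\<^bsub>F\<^esub> r \<in> carrier F" using f r N.subset by auto
    then show ?thesis using carrier_free_groupD(2)[of "f \<otimes>\<^bsub>F\<^esub> r" "{..<k}"]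
      by (simp add: mult_free_group)
  qed
  have "f \<otimes>\<^bsub>F\<^esub> inv\<^bsub>F\<^esub> f = []" using f by (simp add: one_free_group)
  then have "X.psum (pull d lam) \<one>\<^bsub>G\<^esub> (foldr cancel_cons f (inv\<^bsub>F\<^esub> f)) = 0"
    by (simp add: mult_free_group)
  then have "phi d lam f + X.psum (pull d lam) ?g (inv\<^bsub>F\<^esub> f) = 0"
    using X.psum_foldr[OF E.one_closed f', of "pull d lam"] by simp
  moreover have "phi d lam (f \<otimes>\<^bsub>F\<^esub> r \<otimes>\<^bsub>F\<^esub> inv\<^bsub>F\<^esub> f) =
      phi d lam f + X.psum (pull d lam) ?g r + X.psum (pull d lam) ?g (inv\<^bsub>F\<^esub> f)"
    using X.psum_foldr[OF E.one_closed fr, of "pull d lam"] X.pend_foldr[OF E.one_closed f']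
      X.psum_foldr[OF E.one_closed f', of "pull d lam"] r'(3)[OF g(1)]
    by (simp add: mult_free_group add.assoc)
  ultimately show ?thesis
    using phi_invariant[OF d r g] by (simp add: algebra_simps)
qed

lemma phi_mem:
  assumes d: "cobounds d c" and r: "r \<in> R" and Q: "additive_subgroup Q"
    and c: "\<And>h u v. adjacent K u v \<Longrightarrow> c h u v \<in> Q" and lam: "\<And>i. i < k \<Longrightarrow> lam i \<in> Q"
  shows "phi d lam r \<in> Q"
proof -
  note r' = R_loop[OF r]
  have "E.psum d \<one>\<^bsub>G\<^esub> (lift_word r) \<in> Q"
    by (rule loop_psum(1)[OF d _ _ Q])
      (use r' c lift_word(1)[OF r'(1) E.one_closed] lift_word_letters[OF r'(1)] in auto)
  moreover have "X.psum (\<lambda>i _. lam i) \<one>\<^bsub>G\<^esub> r \<in> Q"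
    by (rule X.psum_mem[OF Q]) (use lam r' in auto)
  ultimately show ?thesis
    using lift_word(2)[OF r'(1) E.one_closed, of d lam] additive_subgroupD(4)[OF Q] by simp
qed

section \<open>Extending the homomorphism to words that represent elements of
  \<open>\<Gamma>\<^sub>n\<close>\<close>

definition closed_mod :: "'v word \<Rightarrow> bool" where
  "closed_mod y \<longleftrightarrow> fst ` set y \<subseteq> V \<and> int n dvd exponent_sum y"

text \<open>The choice depends on \<open>y\<close> only through the element that it represents,
  which \<open>kap_cong\<close> exploits.\<close>

definition word_of :: "'v word \<Rightarrow> nat word" where
  "word_of y = (SOME w. w \<in> carrier F \<and> X.pend \<one>\<^bsub>G\<^esub> w = E.pend \<one>\<^bsub>G\<^esub> y)"

lemma word_of:
  assumes "closed_mod y"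
  shows "word_of y \<in> carrier F" "X.pend \<one>\<^bsub>G\<^esub> (word_of y) = E.pend \<one>\<^bsub>G\<^esub> y"
    "fst ` set (word_of y) \<subseteq> {..<k}"
proof -
  have "E.pend \<one>\<^bsub>G\<^esub> y \<in> {g \<in> carrier G. int n dvd raag_pi g}"
    using assms by (simp add: closed_mod_def raag_pi_pend raag_pi_one)
  then obtain w where "w \<in> carrier F" "\<theta> w = E.pend \<one>\<^bsub>G\<^esub> y"
    unfolding \<theta>_image[symmetric] by auto
  then have "\<exists>w. w \<in> carrier F \<and> X.pend \<one>\<^bsub>G\<^esub> w = E.pend \<one>\<^bsub>G\<^esub> y" using \<theta>_eq by auto
  then have "word_of y \<in> carrier F \<and> X.pend \<one>\<^bsub>G\<^esub> (word_of y) = E.pend \<one>\<^bsub>G\<^esub> y"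
    unfolding word_of_def by (rule someI_ex)
  then show "word_of y \<in> carrier F" "X.pend \<one>\<^bsub>G\<^esub> (word_of y) = E.pend \<one>\<^bsub>G\<^esub> y"
    "fst ` set (word_of y) \<subseteq> {..<k}" using carrier_free_groupD(2)[of "word_of y"] by auto
qed

text \<open>
  If \<open>phi d lam\<close> vanishes on \<open>R\<close>, then the invariant homomorphism that \<open>d\<close> defines on the words
  representing the identity extends to a homomorphism on all words representing elements of
  \<open>\<Gamma>\<^sub>n\<close>. The negative of such an extension is \<open>kap\<close>.
\<close>

definition kap :: "('v \<Rightarrow> 'v word set \<Rightarrow> 'a::ab_group_add) \<Rightarrow> (nat \<Rightarrow> 'a) \<Rightarrow> 'v word \<Rightarrow> 'a" where
  "kap d lam y = phi d lam (word_of y) - E.psum d \<one>\<^bsub>G\<^esub> y"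

lemma closed_mod_append: "closed_mod y \<Longrightarrow> closed_mod y' \<Longrightarrow> closed_mod (y @ y')"
  by (auto simp: closed_mod_def image_Un)

lemma closed_mod_inv: "closed_mod y \<Longrightarrow> closed_mod (inv_word y)"
  by (auto simp: closed_mod_def)

text \<open>Two words over the generators with the same end differ by a relation, on which
  \<open>phi\<close> vanishes; so the choice made in \<open>word_of\<close> does not affect
  \<open>kap\<close>.\<close>

lemma kap_eq:
  assumes van: "\<And>r. r \<in> R \<Longrightarrow> phi d lam r = 0"
    and y: "closed_mod y" and w: "fst ` set w \<subseteq> {..<k}" "X.pend \<one>\<^bsub>G\<^esub> w = E.pend \<one>\<^bsub>G\<^esub> y"
  shows "kap d lam y = phi d lam w - E.psum d \<one>\<^bsub>G\<^esub> y"
proof -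
  note wy = word_of[OF y]
  let ?u = "w @ inv_word (word_of y)"
  have u: "fst ` set ?u \<subseteq> {..<k}" using w wy by (auto simp: image_Un)
  have "X.pend \<one>\<^bsub>G\<^esub> ?u = \<one>\<^bsub>G\<^esub>"
    using X.pend_inv_word[OF E.one_closed wy(3)] w(2) wy(2) by simp
  then have "phi d lam (reduction ?u) = 0" by (intro van loop_in_R u)
  then have "phi d lam ?u = 0" by (simp add: X.psum_reduction[OF E.one_closed u])
  then have "phi d lam w = phi d lam (word_of y)"
    using X.psum_inv_word[OF E.one_closed wy(3), of "pull d lam"] w(2) wy(2) by simp
  then show ?thesis by (simp add: kap_def)
qed

text \<open>Up to the homomorphism \<open>lam\<close>, \<open>kap d lam y'\<close> is the integral
  around the loop that follows the lift of \<open>word_of y'\<close> and returns along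
  \<open>y'\<close>. In the product this loop is based at the end of \<open>y\<close>, an element of
  \<open>\<Gamma>\<^sub>n\<close>, and \<open>loop_psum\<close> moves it back to the
  identity.\<close>

lemma kap_append:
  assumes van: "\<And>r. r \<in> R \<Longrightarrow> phi d lam r = 0" and d: "cobounds d c"
    and y: "closed_mod y" "closed_mod y'"
  shows "kap d lam (y @ y') = kap d lam y + kap d lam y'"
proof -
  note w = word_of[OF y(1)] and w' = word_of[OF y(2)]
  let ?g = "E.pend \<one>\<^bsub>G\<^esub> y" and ?w' = "word_of y'"
  have yV: "fst ` set y \<subseteq> V" "fst ` set y' \<subseteq> V" using y by (auto simp: closed_mod_def)
  have g: "?g \<in> carrier G" using yV by simp
  have lV: "fst ` set (lift_word ?w') \<subseteq> V" by (rule lift_word_letters[OF w'(3)])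
  let ?u = "lift_word ?w' @ inv_word y'"
  have uV: "fst ` set ?u \<subseteq> V" using lV yV by (auto simp: image_Un)
  have same: "E.pend h (lift_word ?w') = E.pend h y'" if "h \<in> carrier G" for h
    using that w'(2) E.pend_eq[OF that lV] E.pend_eq[OF that yV(2)] lift_word(1)[OF w'(3) E.one_closed]
    by simp
  have split: "E.psum d h ?u = E.psum d h (lift_word ?w') - E.psum d h y'" if "h \<in> carrier G" for h
    using E.psum_inv_word[OF that yV(2), of d] same[OF that] by simp
  have "E.pend \<one>\<^bsub>G\<^esub> ?u = \<one>\<^bsub>G\<^esub>"
    using E.pend_inv_word[OF E.one_closed yV(2)] same[OF E.one_closed] by simp
  then have "E.psum d ?g ?u = E.psum d \<one>\<^bsub>G\<^esub> ?u"
    by (intro loop_psum(2)[OF d uV, where Q = UNIV])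
      (use y g yV in \<open>auto simp: additive_subgroup_def raag_pi_pend raag_pi_one closed_mod_def\<close>)
  then have *: "E.psum d ?g (lift_word ?w') - E.psum d ?g y' = E.psum d \<one>\<^bsub>G\<^esub> (lift_word ?w') - E.psum d \<one>\<^bsub>G\<^esub> y'"
    using split[OF g] split[OF E.one_closed] by simp
  have ww: "fst ` set (word_of y @ ?w') \<subseteq> {..<k}" using w w' by (auto simp: image_Un)
  have "X.pend \<one>\<^bsub>G\<^esub> (word_of y @ ?w') = E.pend \<one>\<^bsub>G\<^esub> (y @ y')"
    using w(2) w'(2) X.pend_eq[OF g w'(3)] E.pend_eq[OF g yV(2)] by simp
  then have "kap d lam (y @ y') = phi d lam (word_of y @ ?w') - E.psum d \<one>\<^bsub>G\<^esub> (y @ y')"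
    by (intro kap_eq[OF van closed_mod_append[OF y] ww])
  also have "\<dots> = kap d lam y + (X.psum (pull d lam) ?g ?w' - E.psum d ?g y')"
    using w(2) by (simp add: kap_def algebra_simps)
  also have "X.psum (pull d lam) ?g ?w' - E.psum d ?g y' = kap d lam y'"
    using * lift_word(2)[OF w'(3) g, of d lam] lift_word(2)[OF w'(3) E.one_closed, of d lam]
    by (simp add: kap_def algebra_simps)
  finally show ?thesis .
qed

lemma kap_loop:
  assumes van: "\<And>r. r \<in> R \<Longrightarrow> phi d lam r = 0"
    and y: "closed_mod y" "E.pend \<one>\<^bsub>G\<^esub> y = \<one>\<^bsub>G\<^esub>"
  shows "kap d lam y = - E.psum d \<one>\<^bsub>G\<^esub> y"
  using kap_eq[OF van y(1), of "[]"] y(2) by simp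

lemma kap_inv:
  assumes van: "\<And>r. r \<in> R \<Longrightarrow> phi d lam r = 0" and d: "cobounds d c" and y: "closed_mod y"
  shows "kap d lam (inv_word y) = - kap d lam y"
proof -
  have yV: "fst ` set y \<subseteq> V" using y by (simp add: closed_mod_def)
  have "kap d lam (y @ inv_word y) = - E.psum d \<one>\<^bsub>G\<^esub> (y @ inv_word y)"
    by (rule kap_loop[OF van closed_mod_append[OF y closed_mod_inv[OF y]]])
      (simp_all add: E.pend_inv_word[OF E.one_closed yV])
  also have "\<dots> = 0" using E.psum_inv_word[OF E.one_closed yV, of d] by simp
  finally show ?thesis
    using kap_append[OF van d y closed_mod_inv[OF y]] by (simp add: add_eq_0_iff)
qed

lemma kap_cong:
  assumes "E.pend \<one>\<^bsub>G\<^esub> y = E.pend \<one>\<^bsub>G\<^esub> y'" "E.psum d \<one>\<^bsub>G\<^esub> y = E.psum d \<one>\<^bsub>G\<^esub> y'"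
  shows "kap d lam y = kap d lam y'"
  using assms by (simp add: kap_def word_of_def)

section \<open>Edge words, and detecting a cocycle at a single height\<close>

definition base :: 'v where
  "base = (SOME v. v \<in> V)"

lemma base: "base \<in> V"
  using conn unfolding base_def connected_complex_def by (meson all_not_in_conv someI_ex)

definition tpow :: "nat \<Rightarrow> 'v word" where
  "tpow j = replicate j (base, True)"

lemma tpow_letters [simp]: "fst ` set (tpow j) \<subseteq> V"
  using base by (auto simp: tpow_def)

lemma exponent_sum_tpow [simp]: "exponent_sum (tpow j) = int j"
  by (simp add: tpow_def)

lemma tpow_add: "tpow (i + j) = tpow i @ tpow j"
  by (simp add: tpow_def replicate_add)

text \<open>The path climbs to height \<open>j\<close> along powers of the base generator, crosses
  the \<open>u\<close>-edge there and descends again. Its end has height 0, so it lies in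
  \<open>\<Gamma>\<^sub>n\<close> for every \<open>n\<close>.\<close>

definition edge_word :: "nat \<Rightarrow> 'v \<Rightarrow> 'v word" where
  "edge_word j u = tpow j @ [(u, True)] @ inv_word (tpow (Suc j))"

lemma closed_mod_edge_word: "u \<in> V \<Longrightarrow> closed_mod (edge_word j u)"
  using tpow_letters[of j] tpow_letters[of "Suc j"]
  by (simp add: closed_mod_def edge_word_def image_Un)

text \<open>The corresponding product of edge words and inverses cancels to the boundary of one
  square at height \<open>j\<close>, conjugated by a power of the base generator. On such a loop
  \<open>kap\<close> is minus the integral of \<open>d\<close>, that is, minus the prescribed
  value.\<close>

lemma kap_square:
  assumes van: "\<And>r. r \<in> R \<Longrightarrow> phi d lam r = 0" and d: "cobounds d c" and adj: "adjacent K u v"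
  shows "kap d lam (edge_word j u) + kap d lam (edge_word (Suc j) v)
    - kap d lam (edge_word (Suc j) u) - kap d lam (edge_word j v) = - c (int j mod int n) u v"
proof -
  have uv [simp]: "u \<in> V" "v \<in> V" using adjacent_vertices[OF adj] by auto
  note cl = closed_mod_edge_word[OF uv(1)] closed_mod_edge_word[OF uv(2)]
  let ?s = "[(u, True), (v, True), (u, False), (v, False)]"
  let ?T = "\<lambda>j. inv_word (tpow j) @ tpow j"
  let ?y = "edge_word j u @ edge_word (Suc j) v @ inv_word (edge_word (Suc j) u) @ inv_word (edge_word j v)"
  let ?z = "tpow j @ ?s @ inv_word (tpow j)"
  have il: "inv_letter (x, True) = (x, False)" for x :: 'v by (simp add: inv_letter_def)
  have y: "?y = (tpow j @ [(u, True)]) @ inv_word (tpow (Suc j)) @ tpow (Suc j) @ ([(v, True)] @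
    inv_word (tpow (Suc (Suc j))) @ tpow (Suc (Suc j)) @ [(u, False)] @
    inv_word (tpow (Suc j)) @ tpow (Suc j) @ [(v, False)] @ inv_word (tpow j))"
    by (simp add: edge_word_def il)
  let ?a = "tpow j @ [(u, True), (v, True)]"
  have aV: "fst ` set (tpow j @ [(u, True)]) \<subseteq> V" "fst ` set ?a \<subseteq> V" "fst ` set (?a @ [(u, False)]) \<subseteq> V"
    using tpow_letters[of j] by (auto simp: image_Un)
  \<comment> \<open>Deleting a factor \<open>inv_word b @ b\<close> changes neither the end nor the
    integral; three deletions turn \<open>?y\<close> into \<open>?z\<close>.\<close>
  have e1: "E.pend \<one>\<^bsub>G\<^esub> ?y = E.pend \<one>\<^bsub>G\<^esub> ?z"
    unfolding y E.pend_cancel[OF E.one_closed aV(1) tpow_letters]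
    using E.pend_cancel[OF E.one_closed aV(2) tpow_letters[of "Suc (Suc j)"]]
      E.pend_cancel[OF E.one_closed aV(3) tpow_letters[of "Suc j"]]
    by (simp del: E.pend_append path_end.simps)
  have e2: "E.psum d \<one>\<^bsub>G\<^esub> ?y = E.psum d \<one>\<^bsub>G\<^esub> ?z"
    unfolding y E.psum_cancel[OF E.one_closed aV(1) tpow_letters]
    using E.psum_cancel[OF E.one_closed aV(2) tpow_letters[of "Suc (Suc j)"], of d]
      E.psum_cancel[OF E.one_closed aV(3) tpow_letters[of "Suc j"], of d]
    by (simp del: E.psum_append path_sum.simps)
  let ?g = "E.pend \<one>\<^bsub>G\<^esub> (tpow j)"
  have g: "?g \<in> carrier G" by simp
  have comm: "?g \<otimes>\<^bsub>G\<^esub> e u \<otimes>\<^bsub>G\<^esub> e v = ?g \<otimes>\<^bsub>G\<^esub> e v \<otimes>\<^bsub>G\<^esub> e u"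
    using g raag_comm[OF adj] by (simp add: E.m_assoc)
  then have c1: "?g \<otimes>\<^bsub>G\<^esub> e u \<otimes>\<^bsub>G\<^esub> e v \<otimes>\<^bsub>G\<^esub> inv\<^bsub>G\<^esub> e u = ?g \<otimes>\<^bsub>G\<^esub> e v"
    using g by (simp add: E.m_assoc)
  have ends: "E.pend ?g ?s = ?g"
    using g c1 by (simp add: letter_val_def E.m_assoc)
  have c2: "?g \<otimes>\<^bsub>G\<^esub> e v \<otimes>\<^bsub>G\<^esub> inv\<^bsub>G\<^esub> e v = ?g" using g by (simp add: E.m_assoc)
  have "E.psum d ?g ?s = d u ?g + d v (?g \<otimes>\<^bsub>G\<^esub> e u) - d v ?g - d u (?g \<otimes>\<^bsub>G\<^esub> e v)"
    by (simp add: letter_val_def c1 c2)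
  also have "\<dots> = c (int j mod int n) u v"
    using d adj g by (simp add: cobounds_def raag_pi_pend raag_pi_one)
  finally have sq: "E.psum d ?g ?s = c (int j mod int n) u v" .
  have pz: "E.psum d \<one>\<^bsub>G\<^esub> ?z = c (int j mod int n) u v"
    unfolding E.psum_append ends sq using E.psum_inv_word[OF E.one_closed tpow_letters, of d j] by simp
  have ez: "E.pend \<one>\<^bsub>G\<^esub> ?z = \<one>\<^bsub>G\<^esub>"
    unfolding E.pend_append ends by (rule E.pend_inv_word[OF E.one_closed tpow_letters])
  have cy: "closed_mod ?y"
    by (intro closed_mod_append closed_mod_inv cl)
  have "kap d lam ?y = - E.psum d \<one>\<^bsub>G\<^esub> ?y"
    by (rule kap_loop[OF van cy trans[OF e1 ez]])
  also have "\<dots> = - c (int j mod int n) u v" by (simp only: e2 pz)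
  finally have "kap d lam ?y = - c (int j mod int n) u v" .
  moreover have "kap d lam ?y = kap d lam (edge_word j u) + kap d lam (edge_word (Suc j) v)
    - kap d lam (edge_word (Suc j) u) - kap d lam (edge_word j v)"
    by (simp add: kap_append[OF van d] kap_inv[OF van d] closed_mod_append closed_mod_inv cl)
  ultimately show ?thesis by simp
qed

text \<open>Rearranging \<open>kap_square\<close> exhibits the increment of \<open>kap\<close> on
  edge words, from \<open>j\<close> to \<open>Suc j\<close>, as a potential for \<open>c\<close> at
  height \<open>j\<close>. The bound \<open>j < n\<close> makes reduction modulo \<open>n\<close>
  harmless.\<close>

lemma vanishing_imp_coboundary:
  assumes "\<And>r. r \<in> R \<Longrightarrow> phi d lam r = 0" and "cobounds d c" and "j < n"
  shows "\<exists>f. \<forall>u v. adjacent K u v \<longrightarrow> c (int j) u v = f u - f v"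
proof (intro exI allI impI)
  fix u v assume adj: "adjacent K u v"
  show "c (int j) u v = (\<lambda>u. kap d lam (edge_word (Suc j) u) - kap d lam (edge_word j u)) u -
    (\<lambda>u. kap d lam (edge_word (Suc j) u) - kap d lam (edge_word j u)) v"
    using kap_square[OF assms(1,2) adj, of j] assms(3) by (simp add: algebra_simps)
qed

lemma pull_0: "pull (\<lambda>_ _. 0) lam = (\<lambda>i _. lam i)"
  by (intro ext) (simp add: pull_def)

lemma cobounds_0: "cobounds (\<lambda>_ _. 0) (\<lambda>_ _ _. 0)"
  by (simp add: cobounds_def)

text \<open>
  The abelianization of \<open>\<Gamma>\<^sub>n\<close> is generated by the classes of the elements \<open>e u \<otimes> inv (e base)\<close> and
  of the \<open>n\<close>-th power of \<open>e base\<close>, because conjugating the former by powers of \<open>e base\<close> does not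
  change their classes. So its rank is bounded independently of \<open>n\<close>.
\<close>

lemma hom_eq_0:
  fixes lam :: "nat \<Rightarrow> 'a::ab_group_add"
  defines "L \<equiv> X.psum (\<lambda>i _. lam i) \<one>\<^bsub>G\<^esub>"
  assumes van: "\<And>r. r \<in> R \<Longrightarrow> L r = 0"
    and u: "\<And>u. u \<in> V \<Longrightarrow> L (word_of (edge_word 0 u)) = 0"
    and t: "L (word_of (tpow n)) = 0"
    and i: "i < k"
  shows "lam i = 0"
proof -
  \<comment> \<open>With the zero cochain, \<open>kap\<close> is just the homomorphism given by
    \<open>lam\<close>, read as a function of words over the vertices.\<close>
  let ?d = "\<lambda>(_::'v) (_::'v word set). 0::'a"
  let ?kap = "kap ?d lam"
  have van: "phi ?d lam r = 0" if "r \<in> R" for r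
    using van[OF that] by (simp add: L_def pull_0)
  have kapL: "?kap y = L (word_of y)" for y by (simp add: kap_def L_def pull_0)
  have app: "?kap (y @ y') = ?kap y + ?kap y'" if "closed_mod y" "closed_mod y'" for y y'
    by (rule kap_append[OF van cobounds_0 that])
  have inv: "?kap (inv_word y) = - ?kap y" if "closed_mod y" for y
    by (rule kap_inv[OF van cobounds_0 that])
  have loop: "?kap y = 0" if "closed_mod y" "E.pend \<one>\<^bsub>G\<^esub> y = \<one>\<^bsub>G\<^esub>" for y
    using kap_loop[OF van that] by simp
  have cong: "?kap y = ?kap y'" if "E.pend \<one>\<^bsub>G\<^esub> y = E.pend \<one>\<^bsub>G\<^esub> y'" for y y'
    by (rule kap_cong[OF that]) simp
  have edge: "?kap (edge_word j u) = 0" if "u \<in> V" for j u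
    using that
  proof (induction j arbitrary: u)
    case 0
    then show ?case by (simp add: kapL u)
  next
    case (Suc j)
    \<comment> \<open>Once the values at \<open>j\<close> vanish, the square relation makes those at
      \<open>Suc j\<close> agree along each edge of \<open>K\<close>. Connectedness then compares
      them with the base vertex, whose edge word is trivial.\<close>
    have step: "?kap (edge_word (Suc j) v) = ?kap (edge_word (Suc j) w)" if "adjacent K v w" for v w
      using kap_square[OF van cobounds_0 that, of j] Suc.IH[of v] Suc.IH[of w] adjacent_vertices[OF that]
      by simp
    have "(adjacent K)\<^sup>*\<^sup>* base u"
      using conn base Suc.prems by (auto simp: connected_complex_def)
    then have "?kap (edge_word (Suc j) base) = ?kap (edge_word (Suc j) u)"
      by (induction rule: rtranclp_induct) (auto dest: step)
    moreover have "edge_word (Suc j) base = tpow (Suc (Suc j)) @ inv_word (tpow (Suc (Suc j)))"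
      by (simp add: edge_word_def tpow_def replicate_append_same)
    then have "?kap (edge_word (Suc j) base) = 0"
      using loop[OF closed_mod_edge_word[OF base], of "Suc j"]
        E.pend_inv_word[OF E.one_closed tpow_letters[of "Suc (Suc j)"]] by simp
    ultimately show ?case by simp
  qed
  have tn: "closed_mod (tpow (n * m))" for m by (simp add: closed_mod_def)
  have tnm: "?kap (tpow (n * m)) = 0" for m
  proof (induction m)
    case 0
    show ?case by (rule loop[OF tn]) (simp add: tpow_def)
  next
    case (Suc m)
    then show ?case
      using app[OF tn[of 1] tn[of m]] t by (simp add: tpow_add kapL)
  qed
  \<comment> \<open>Letters are peeled off the right of \<open>y\<close>, each as an edge word or
    its inverse; the power of the base generator behind \<open>y\<close> keeps the height a multiple
    of \<open>n\<close>.\<close>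
  have main: "?kap (y @ inv_word (tpow s)) = 0"
    if "fst ` set y \<subseteq> V" "int n dvd exponent_sum y - int s" for y s
    using that
  proof (induction y arbitrary: s rule: rev_induct)
    case Nil
    then have "n dvd s" by (simp add: dvd_diff_commute)
    then obtain m where "s = n * m" by blast
    then show ?case using inv[OF tn[of m]] tnm[of m] by simp
  next
    case (snoc l y)
    have l: "fst l \<in> V" and y: "fst ` set y \<subseteq> V" using snoc.prems by auto
    show ?case
    proof (cases "snd l")
      case True
      then have leq: "l = (fst l, True)" by (simp add: prod_eq_iff)
      \<comment> \<open>The exponent in front of a positive letter would be \<open>s - 1\<close>,
        which is negative for \<open>s = 0\<close>. Adding \<open>n\<close> keeps it natural and
        costs a factor \<open>tpow n\<close>, on which \<open>?kap\<close> vanishes.\<close>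
      define s' where "s' = s + n - 1"
      have s': "Suc s' = s + n" using n_pos by (simp add: s'_def)
      have eq: "exponent_sum y - int s' = (exponent_sum (y @ [l]) - int s) - int n"
        using True s' by simp
      have dvd: "int n dvd exponent_sum y - int s'"
        unfolding eq by (rule dvd_diff[OF snoc.prems(2) dvd_refl])
      have cl: "closed_mod (y @ inv_word (tpow s'))" "closed_mod (edge_word s' (fst l))"
        "closed_mod (tpow n)"
        using y dvd tpow_letters[of s'] closed_mod_edge_word[OF l] tn[of 1]
        by (auto simp: closed_mod_def image_Un)
      let ?z = "(y @ inv_word (tpow s')) @ edge_word s' (fst l) @ tpow n"
      have yl: "fst ` set (y @ [l]) \<subseteq> V" using y l by auto
      have zz: "?z = y @ inv_word (tpow s') @ tpow s' @ ([l] @ inv_word (tpow (Suc s')) @ tpow n)"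
        using leq by (simp add: edge_word_def)
      have "E.pend \<one>\<^bsub>G\<^esub> ?z = E.pend \<one>\<^bsub>G\<^esub> ((y @ [l]) @ inv_word (tpow (s + n)) @ tpow n)"
        unfolding zz E.pend_cancel[OF E.one_closed y tpow_letters] by (simp add: s')
      also have "inv_word (tpow (s + n)) = inv_word (tpow s) @ inv_word (tpow n)"
        by (simp add: add.commute[of s] tpow_add)
      also have "E.pend \<one>\<^bsub>G\<^esub> ((y @ [l]) @ (inv_word (tpow s) @ inv_word (tpow n)) @ tpow n) =
          E.pend \<one>\<^bsub>G\<^esub> (((y @ [l]) @ inv_word (tpow s)) @ inv_word (tpow n) @ tpow n @ [])" by simp
      also have "\<dots> = E.pend \<one>\<^bsub>G\<^esub> (((y @ [l]) @ inv_word (tpow s)) @ [])"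
        by (rule E.pend_cancel) (use yl tpow_letters[of s] tpow_letters[of n] in \<open>auto simp: image_Un\<close>)
      finally have "?kap ((y @ [l]) @ inv_word (tpow s)) = ?kap ?z" by (intro cong) simp
      also have "\<dots> = ?kap (y @ inv_word (tpow s')) + (?kap (edge_word s' (fst l)) + ?kap (tpow n))"
        by (simp only: app[OF cl(1) closed_mod_append[OF cl(2,3)]] app[OF cl(2,3)])
      also have "\<dots> = 0"
        using snoc.IH[OF y dvd] edge[OF l] tnm[of 1] by simp
      finally show ?thesis .
    next
      case False
      then have leq: "l = (fst l, False)" by (simp add: prod_eq_iff)
      have dvd: "int n dvd exponent_sum y - int (Suc s)"
        using snoc.prems False by (simp add: algebra_simps)
      have cl: "closed_mod (y @ inv_word (tpow (Suc s)))" "closed_mod (edge_word s (fst l))"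
        using y dvd tpow_letters[of "Suc s"] closed_mod_edge_word[OF l]
        by (auto simp: closed_mod_def image_Un algebra_simps)
      let ?z = "(y @ inv_word (tpow (Suc s))) @ inv_word (edge_word s (fst l))"
      have zz: "?z = y @ inv_word (tpow (Suc s)) @ tpow (Suc s) @ ([l] @ inv_word (tpow s))"
        using leq by (simp add: edge_word_def) (simp add: inv_letter_def)
      have "E.pend \<one>\<^bsub>G\<^esub> ?z = E.pend \<one>\<^bsub>G\<^esub> ((y @ [l]) @ inv_word (tpow s))"
        unfolding zz E.pend_cancel[OF E.one_closed y tpow_letters] by simp
      then have "?kap ((y @ [l]) @ inv_word (tpow s)) = ?kap ?z" by (intro cong) simp
      also have "\<dots> = ?kap (y @ inv_word (tpow (Suc s))) + ?kap (inv_word (edge_word s (fst l)))"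
        by (rule app[OF cl(1) closed_mod_inv[OF cl(2)]])
      also have "\<dots> = 0"
        using snoc.IH[OF y dvd] edge[OF l] inv[OF cl(2)] by simp
      finally show ?thesis .
    qed
  qed
  let ?w = "[(i, True)]" and ?y = "lift_word [(i, True)]"
  have w: "fst ` set ?w \<subseteq> {..<k}" using i by simp
  have yV: "fst ` set ?y \<subseteq> V" by (rule lift_word_letters[OF w])
  have ends: "E.pend \<one>\<^bsub>G\<^esub> ?y = X.pend \<one>\<^bsub>G\<^esub> ?w" using lift_word(1)[OF w E.one_closed] by simp
  have dvd: "int n dvd exponent_sum ?y"
    using X_pend_dvd[OF w] raag_pi_pend[OF E.one_closed yV] ends by (simp add: raag_pi_one)
  then have cl: "closed_mod ?y" using yV by (simp add: closed_mod_def)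
  have "?kap ?y = 0" using main[OF yV, of 0] dvd by (simp add: tpow_def)
  moreover have "?kap ?y = phi ?d lam ?w - E.psum ?d \<one>\<^bsub>G\<^esub> ?y"
    by (rule kap_eq[OF van cl w ends[symmetric]])
  ultimately show ?thesis by (simp add: pull_0)
qed

section \<open>Counting pairs of a homomorphism and a set of residues\<close>

lemma pull_diff:
  "pull (\<lambda>i g. d i g - d' i g) (\<lambda>i. lam i - lam' i) = (\<lambda>i g. pull d lam i g - pull d' lam' i g)"
  by (intro ext) (simp add: pull_def E.psum_diff)

lemma cobounds_diff:
  "cobounds d c \<Longrightarrow> cobounds d' c' \<Longrightarrow>
    cobounds (\<lambda>i g. d i g - d' i g) (\<lambda>h u v. c h u v - c' h u v)"
  unfolding cobounds_def by (simp add: algebra_simps)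

text \<open>A pair \<open>(lam, S)\<close> is recorded by the values of \<open>phi\<close> on
  representatives of \<open>Y\<close>, and by the values of \<open>lam\<close> on the elements that
  \<open>hom_eq_0\<close> shows to control homomorphisms on \<open>\<Gamma>\<^sub>n\<close>: one
  edge word for each vertex, and \<open>tpow n\<close>. The three factors of \<open>?cod\<close>
  give the exponents \<open>card Y\<close>, \<open>card V\<close> and 1.\<close>

lemma card_bound:
  fixes z :: "'v \<Rightarrow> 'v \<Rightarrow> 'a::ab_group_add"
  assumes finV: "finite V" and Q: "additive_subgroup Q" "finite Q"
    and zQ: "\<And>u v. adjacent K u v \<Longrightarrow> z u v \<in> Q"
    and anti: "\<And>u v. adjacent K u v \<Longrightarrow> z v u = - z u v"
    and cocycle: "\<And>u v w. adjacent K u v \<Longrightarrow> adjacent K v w \<Longrightarrow> adjacent K u w \<Longrightarrow>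
      z u w = z u v + z v w"
    and nontriv: "\<nexists>f. \<forall>u v. adjacent K u v \<longrightarrow> z u v = f u - f v"
    and X: "finite Y" "module_generates (integral_group_ring (F Mod R)) (relation_module F R) Y"
  shows "card Q ^ k * 2 ^ n \<le> card Q ^ (card Y + card V + 1)"
proof -
  \<comment> \<open>In \<open>cobounds\<close> the argument \<open>h\<close> is a residue modulo
    \<open>n\<close>, hence nonnegative, so \<open>nat\<close> loses nothing.\<close>
  define c where "c S h u v = (if nat h \<in> S then z u v else 0)" for S h u v
  have cQ: "c S h u v \<in> Q" if "adjacent K u v" for S h u v
    using zQ[OF that] additive_subgroupD(1)[OF Q(1)] by (simp add: c_def)
  have "\<exists>d. cobounds d (c S)" for S
  proof -
    have "\<exists>d. \<forall>u\<in>V. \<forall>v\<in>V. adjacent K u v \<longrightarrow> (\<forall>g\<in>carrier G.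
      d u g + d v (g \<otimes>\<^bsub>G\<^esub> e u) - d v g - d u (g \<otimes>\<^bsub>G\<^esub> e v) =
        (\<lambda>h u v. c S (h mod int n) u v) (raag_pi g) u v)"
    proof (rule raag_cochain_exists)
      show "c S (h mod int n) v u = - c S (h mod int n) u v" if "adjacent K u v" for h u v
        using anti[OF that] by (simp add: c_def)
      show "c S (h mod int n) u w = c S (h mod int n) u v + c S (h mod int n) v w"
        if "adjacent K u v" "adjacent K v w" "adjacent K u w" for h u v w
        using cocycle[OF that] by (simp add: c_def)
    qed (use finV in auto)
    then obtain d where d: "\<forall>u\<in>V. \<forall>v\<in>V. adjacent K u v \<longrightarrow> (\<forall>g\<in>carrier G.
      d u g + d v (g \<otimes>\<^bsub>G\<^esub> e u) - d v g - d u (g \<otimes>\<^bsub>G\<^esub> e v) = c S (raag_pi g mod int n) u v)"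
      by blast
    have "cobounds d (c S)" unfolding cobounds_def
    proof (intro allI impI ballI)
      fix u v g assume "adjacent K u v" "g \<in> carrier G"
      then show "d u g + d v (g \<otimes>\<^bsub>G\<^esub> e u) - d v g - d u (g \<otimes>\<^bsub>G\<^esub> e v) = c S (raag_pi g mod int n) u v"
        using d adjacent_vertices[of K u v] by simp
    qed
    then show ?thesis by (rule exI[of "\<lambda>d. cobounds d (c S)"])
  qed
  then obtain dd where dd: "\<And>S. cobounds (dd S) (c S)" by metis
  define rep where "rep x = (SOME r. r \<in> R \<and> x = N.D #>\<^bsub>F\<^esub> r)" for x
  have rep: "rep x \<in> R \<and> x = N.D #>\<^bsub>F\<^esub> rep x" if "x \<in> Y" for x
  proof -
    have "x \<in> carrier N.A" using X(2) that by (auto simp: module_generates_def relation_module_def)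
    then have "\<exists>r. r \<in> R \<and> x = N.D #>\<^bsub>F\<^esub> r" unfolding N.carrier_A by blast
    then show ?thesis unfolding rep_def by (rule someI_ex)
  qed
  define L where "L lam w = X.psum (\<lambda>i _. lam i) \<one>\<^bsub>G\<^esub> w" for lam :: "nat \<Rightarrow> 'a" and w
  define \<Psi> where "\<Psi> = (\<lambda>(lam, S). (restrict (\<lambda>x. phi (dd S) lam (rep x)) Y,
    restrict (\<lambda>u. L lam (word_of (edge_word 0 u))) V, L lam (word_of (tpow n))))"
  let ?dom = "(\<Pi>\<^sub>E i\<in>{..<k}. Q) \<times> Pow {..<n}"
  let ?cod = "(\<Pi>\<^sub>E x\<in>Y. Q) \<times> (\<Pi>\<^sub>E u\<in>V. Q) \<times> Q"
  have LQ: "L lam w \<in> Q" if "\<And>i. i < k \<Longrightarrow> lam i \<in> Q" "fst ` set w \<subseteq> {..<k}" for lam w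
    unfolding L_def by (rule X.psum_mem[OF Q(1)]) (use that in auto)
  have tn: "closed_mod (tpow n)" by (simp add: closed_mod_def)
  have "\<Psi> ` ?dom \<subseteq> ?cod"
  proof (rule image_subsetI)
    fix p assume "p \<in> ?dom"
    then obtain lam S where p: "p = (lam, S)" and lam: "lam \<in> (\<Pi>\<^sub>E i\<in>{..<k}. Q)"
      by (rule SigmaE)
    have lQ: "lam i \<in> Q" if "i < k" for i using lam that by auto
    have "phi (dd S) lam (rep x) \<in> Q" if "x \<in> Y" for x
      by (rule phi_mem[OF dd _ Q(1) cQ lQ]) (use rep[OF that] in auto)
    moreover have "L lam (word_of (edge_word 0 u)) \<in> Q" if "u \<in> V" for u
      using word_of(3)[OF closed_mod_edge_word[OF that]] by (intro LQ lQ)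
    moreover have "L lam (word_of (tpow n)) \<in> Q"
      using word_of(3)[OF tn] by (intro LQ lQ)
    ultimately show "\<Psi> p \<in> ?cod" by (simp add: \<Psi>_def p)
  qed
  moreover have "inj_on \<Psi> ?dom"
  proof (rule inj_onI)
    fix p p' assume "p \<in> ?dom" "p' \<in> ?dom" and eq': "\<Psi> p = \<Psi> p'"
    then obtain lam S lam' S' where p: "p = (lam, S)" "p' = (lam', S')"
      and lam: "lam \<in> (\<Pi>\<^sub>E i\<in>{..<k}. Q)" "lam' \<in> (\<Pi>\<^sub>E i\<in>{..<k}. Q)"
      and S: "S \<subseteq> {..<n}" "S' \<subseteq> {..<n}"
      by (elim SigmaE) blast
    have eq: "\<Psi> (lam, S) = \<Psi> (lam', S')" using eq' p by simp
    \<comment> \<open>By additivity injectivity concerns the difference of the two data: its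
      \<open>phi\<close> vanishes on representatives of \<open>Y\<close>, hence on \<open>R\<close>,
      and a residue in only one of \<open>S\<close> and \<open>S'\<close> would make
      \<open>z\<close> or its negative a coboundary.\<close>
    define d where "d i g = dd S i g - dd S' i g" for i g
    define mu where "mu i = lam i - lam' i" for i
    define c' where "c' h u v = c S h u v - c S' h u v" for h u v
    have d: "cobounds d c'" unfolding d_def c'_def by (rule cobounds_diff[OF dd dd])
    have phi: "phi d mu w = phi (dd S) lam w - phi (dd S') lam' w" for w
      unfolding d_def mu_def pull_diff X.psum_diff ..
    have Lmu: "L mu w = L lam w - L lam' w" for w
      unfolding L_def mu_def by (rule X.psum_diff)
    have "phi (dd S) lam (rep x) = phi (dd S') lam' (rep x)" if "x \<in> Y" for x
    proof -
      have "restrict (\<lambda>x. phi (dd S) lam (rep x)) Y = restrict (\<lambda>x. phi (dd S') lam' (rep x)) Y"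
        using eq by (simp add: \<Psi>_def)
      from fun_cong[OF this, of x] show ?thesis using that by simp
    qed
    then have rep0: "phi d mu (rep x) = 0" if "x \<in> Y" for x using that by (simp add: phi)
    have van: "phi d mu r = 0" if r: "r \<in> R" for r
    proof (rule N.invariant_hom_eq_0[OF X(2) _ _ _ r])
      show "phi d mu (r \<otimes>\<^bsub>F\<^esub> s) = phi d mu r + phi d mu s" if "r \<in> R" "s \<in> R" for r s
        by (rule phi_mult[OF that])
      show "phi d mu (f \<otimes>\<^bsub>F\<^esub> r \<otimes>\<^bsub>F\<^esub> inv\<^bsub>F\<^esub> f) = phi d mu r" if "f \<in> carrier F" "r \<in> R" for f r
        by (rule phi_conj[OF d that(2,1)])
      show "\<exists>r\<in>R. x = N.D #>\<^bsub>F\<^esub> r \<and> phi d mu r = 0" if "x \<in> Y" for x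
        using rep[OF that] rep0[OF that] by blast
    qed
    have "S = S'"
    proof (rule ccontr)
      assume "S \<noteq> S'"
      then obtain j where j: "j < n" "j \<in> S \<longleftrightarrow> j \<notin> S'" using S by blast
      obtain f where f: "\<And>u v. adjacent K u v \<Longrightarrow> c' (int j) u v = f u - f v"
        using vanishing_imp_coboundary[OF van d j(1)] by blast
      show False
      proof (cases "j \<in> S")
        case True
        then have "\<forall>u v. adjacent K u v \<longrightarrow> z u v = f u - f v"
          using j f by (simp add: c'_def c_def)
        then show False using nontriv by blast
      next
        case False
        then have "z u v = (- f u) - (- f v)" if "adjacent K u v" for u v
          using j f[OF that] by (simp add: c'_def c_def algebra_simps)
        then show False using spec[OF nontriv[unfolded not_ex], of "\<lambda>u. - f u"] by blast
      qed
    qed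
    \<comment> \<open>Equal sets received the same cochain \<open>dd S\<close>, so the difference is
      exactly zero and \<open>phi\<close> reduces to the homomorphism given by
      \<open>mu\<close>.\<close>
    then have d0: "d = (\<lambda>_ _. 0)" by (intro ext) (simp add: d_def)
    have L0: "L mu r = 0" if "r \<in> R" for r
      using van[OF that] by (simp add: d0 pull_0 L_def)
    have "L mu (word_of (edge_word 0 u)) = 0" if "u \<in> V" for u
    proof -
      have "restrict (\<lambda>u. L lam (word_of (edge_word 0 u))) V = restrict (\<lambda>u. L lam' (word_of (edge_word 0 u))) V"
        using eq by (simp add: \<Psi>_def)
      from fun_cong[OF this, of u] show ?thesis using that by (simp add: Lmu)
    qed
    moreover have "L mu (word_of (tpow n)) = 0" using eq by (simp add: \<Psi>_def Lmu)
    ultimately have "mu i = 0" if "i < k" for i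
      using hom_eq_0[of mu i] L0 that unfolding L_def by blast
    then have "lam i = lam' i" if "i \<in> {..<k}" for i using that by (simp add: mu_def)
    then have "lam = lam'" using lam by (rule PiE_ext[rotated 2])
    then show "p = p'" using \<open>S = S'\<close> p by simp
  qed
  moreover have "finite ?cod" using X(1) finV Q(2) by (auto intro!: finite_PiE)
  ultimately have "card ?dom \<le> card ?cod" by (intro card_inj_on_le)
  then show ?thesis
    using X(1) finV by (simp add: card_cartesian_product card_PiE card_Pow power_add algebra_simps)
qed

end

section \<open>From finite presentations to the limit\<close>

lemma finite_presentation_Gamma_presentation:
  assumes conn: "connected_complex K" and n: "0 < n" and fp: "finite_presentation k R (raag_Gamma K n)"
  obtains \<theta> where "Gamma_presentation K n k R \<theta>"
proof -
  let ?F = "free_group {..<k}" and ?G = "raag K" and ?H = "raag_Gamma K n"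
  interpret F: group ?F by (rule group_free_group)
  obtain T where T: "T \<subseteq> carrier ?F" "R = normal_closure ?F T"
    using fp by (auto simp: finite_presentation_def)
  interpret R: normal R ?F using F.normal_closure_normal[OF T(1)] by (simp add: T(2))
  obtain h where h: "h \<in> iso (?F Mod R) ?H"
    using fp by (auto simp: finite_presentation_def is_iso_def)
  have hh: "h \<in> hom (?F Mod R) ?H" and bij: "bij_betw h (carrier (?F Mod R)) (carrier ?H)"
    using h by (auto simp: iso_def)
  have carH: "carrier ?H = {g \<in> carrier ?G. int n dvd raag_pi g}"
    by (simp add: raag_Gamma_def)
  define \<theta> where "\<theta> f = h (R #>\<^bsub>?F\<^esub> f)" for f
  have cos: "R #>\<^bsub>?F\<^esub> f \<in> carrier (?F Mod R)" if "f \<in> carrier ?F" for f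
    using that by (auto simp: carrier_FactGroup)
  interpret FR: group "?F Mod R" by (rule R.factorgroup_is_group)
  have hmem: "h x \<in> carrier ?G" if "x \<in> carrier (?F Mod R)" for x
    using bij_betwE[OF bij] that carH by blast
  have hmult: "h (x \<otimes>\<^bsub>?F Mod R\<^esub> y) = h x \<otimes>\<^bsub>?G\<^esub> h y"
    if "x \<in> carrier (?F Mod R)" "y \<in> carrier (?F Mod R)" for x y
    using hom_mult[OF hh that] by (simp add: raag_Gamma_def)
  interpret h: group_hom "?F Mod R" ?G h
    by (simp add: group_hom_def group_hom_axioms_def hom_def FR.group_axioms group_raag hmem hmult
        del: mult_FactGroup)
  have "Gamma_presentation K n k R \<theta>"
  proof (rule Gamma_presentation.intro)
    show "connected_complex K" "0 < n" "R \<lhd> ?F" by (fact conn n R.normal_axioms)+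
    show "\<theta> \<in> hom ?F ?G"
      using hmem[OF cos] hmult[OF cos cos] by (auto simp: hom_def \<theta>_def R.rcos_sum)
    have "\<theta> ` carrier ?F = h ` carrier (?F Mod R)"
      by (auto simp: \<theta>_def carrier_FactGroup)
    then show "\<theta> ` carrier ?F = {g \<in> carrier ?G. int n dvd raag_pi g}"
      using bij by (simp add: bij_betw_def carH)
    fix f assume f: "f \<in> carrier ?F"
    have "\<theta> f = \<one>\<^bsub>?G\<^esub> \<longleftrightarrow> h (R #>\<^bsub>?F\<^esub> f) = h \<one>\<^bsub>?F Mod R\<^esub>" unfolding \<theta>_def h.hom_one ..
    also have "\<dots> \<longleftrightarrow> R #>\<^bsub>?F\<^esub> f = \<one>\<^bsub>?F Mod R\<^esub>"
      by (rule inj_on_eq_iff[OF bij_betw_imp_inj_on[OF bij] cos[OF f] FR.one_closed])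
    also have "\<dots> \<longleftrightarrow> f \<in> R"
      using F.coset_join1[OF _ f R.subgroup_axioms] F.coset_join2[OF f R.subgroup_axioms]
      unfolding one_FactGroup by (rule iffI)
    finally show "\<theta> f = \<one>\<^bsub>?G\<^esub> \<longleftrightarrow> f \<in> R" .
  qed
  then show ?thesis by (rule that)
qed

lemma adef_tendsto_infinity:
  fixes z :: "'v \<Rightarrow> 'v \<Rightarrow> 'a::ab_group_add"
  assumes conn: "connected_complex K" and finV: "finite (vertices K)"
    and Q: "additive_subgroup Q" "finite Q"
    and zQ: "\<And>u v. adjacent K u v \<Longrightarrow> z u v \<in> Q"
    and anti: "\<And>u v. adjacent K u v \<Longrightarrow> z v u = - z u v"
    and cocycle: "\<And>u v w. adjacent K u v \<Longrightarrow> adjacent K v w \<Longrightarrow> adjacent K u w \<Longrightarrow>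
      z u w = z u v + z v w"
    and nontriv: "\<nexists>f. \<forall>u v. adjacent K u v \<longrightarrow> z u v = f u - f v"
  shows "(\<lambda>n. adef (raag_Gamma K n)) \<longlonglongrightarrow> \<infinity>"
  unfolding tendsto_PInfty
proof
  fix r :: real
  let ?q = "card Q"
  have q: "?q \<ge> 1" using Q(2) additive_subgroupD(1)[OF Q(1)] by (metis One_nat_def Suc_leI card_gt_0_iff empty_iff)
  obtain B :: nat where B: "r < real B" using reals_Archimedean2 by blast
  \<comment> \<open>If \<open>card Y \<le> k + B\<close>, then cancelling \<open>?q ^ k\<close> in
    \<open>card_bound\<close> leaves \<open>2 ^ n \<le> ?N\<close>, which \<open>n < 2 ^ n\<close>
    excludes for \<open>n \<ge> ?N\<close>. This threshold is the same for all presentations, so the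
    bound passes to the infimum.\<close>
  let ?N = "?q ^ (B + card (vertices K) + 1)"
  have "ereal r < adef (raag_Gamma K n)" if n: "n \<ge> ?N" for n
  proof -
    have npos: "0 < n" using n q by (metis One_nat_def Suc_le_lessD le_trans one_le_power)
    have "real B \<le> real_of_int (presentation_adef k R)" if fp: "finite_presentation k R (raag_Gamma K n)" for k R
    proof -
      obtain \<theta> where "Gamma_presentation K n k R \<theta>"
        using finite_presentation_Gamma_presentation[OF conn npos fp] .
      then interpret Gamma_presentation K n k R \<theta> .
      obtain T where "finite T" "T \<subseteq> carrier F" "R = normal_closure F T"
        using fp by (auto simp: finite_presentation_def)
      then obtain Y0 where "finite Y0" "module_generates (integral_group_ring (F Mod R)) (relation_module F R) Y0"
        using N.relation_module_finitely_generated by blast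
      then obtain Y where Y: "finite Y"
        "card Y = min_generators (integral_group_ring (F Mod R)) (relation_module F R)"
        "module_generates (integral_group_ring (F Mod R)) (relation_module F R) Y"
        by (rule min_generators_attained)
      have le: "?q ^ k * 2 ^ n \<le> ?q ^ (card Y + card V + 1)"
        by (rule card_bound[OF finV Q zQ anti cocycle nontriv Y(1,3)])
      have "card Y > k + B"
      proof (rule ccontr)
        assume "\<not> card Y > k + B"
        then have "?q ^ (card Y + card V + 1) \<le> ?q ^ (k + (B + card V + 1))"
          using q by (intro power_increasing) auto
        also have "\<dots> = ?q ^ k * ?N" by (simp add: power_add)
        finally have "?q ^ k * 2 ^ n \<le> ?q ^ k * ?N" using le by linarith
        then have "2 ^ n \<le> ?N" using q by simp
        then show False using n less_exp[of n] by linarith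
      qed
      then show ?thesis by (simp add: presentation_adef_def Y(2))
    qed
    then have "ereal (real B) \<le> adef (raag_Gamma K n)"
      unfolding adef_def by (intro Inf_greatest) auto
    then show ?thesis using B by (meson ereal_less(2) less_ereal.simps(1) less_le_trans)
  qed
  then show "\<forall>\<^sub>F n in sequentially. ereal r < adef (raag_Gamma K n)"
    unfolding eventually_sequentially by blast
qed

section \<open>Reduced homology in low degrees\<close>

lemma additive_subgroup_Int_dvd:
  fixes J :: "int set"
  assumes J: "additive_subgroup J" "1 \<notin> J"
  obtains q :: nat where "2 \<le> q" "\<And>a. a \<in> J \<Longrightarrow> int q dvd a"
proof (cases "J \<subseteq> {0}")
  case True
  \<comment> \<open>For the zero subgroup every modulus works; 2 is the least one that gives a
    nontrivial quotient.\<close>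
  then show ?thesis using that[of 2] by auto
next
  case False
  then obtain a where a: "a \<in> J" "a \<noteq> 0" by auto
  have "\<bar>a\<bar> \<in> J" using a additive_subgroupD(3)[OF J(1)] by (simp add: abs_if)
  then have ex: "\<exists>m::nat. 0 < m \<and> int m \<in> J" using a(2) by (intro exI[of _ "nat \<bar>a\<bar>"]) auto
  define q where "q = (LEAST m::nat. 0 < m \<and> int m \<in> J)"
  have q: "0 < q" "int q \<in> J" using LeastI_ex[OF ex] by (auto simp: q_def)
  have mult: "int q * int m \<in> J" for m
  proof (induction m)
    case (Suc m)
    then show ?case using additive_subgroupD(4)[OF J(1) q(2) Suc] by (simp add: algebra_simps)
  qed (use additive_subgroupD(1)[OF J(1)] in simp)
  have multi: "int q * b \<in> J" for b
    using mult[of "nat b"] mult[of "nat (- b)"] additive_subgroupD(3)[OF J(1)]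
    by (cases "0 \<le> b") force+
  have "int q dvd b" if b: "b \<in> J" for b
  proof -
    have "b mod int q = b - int q * (b div int q)" by (simp add: minus_mult_div_eq_mod)
    then have "b mod int q \<in> J" using additive_subgroupD(2)[OF J(1) b multi] by simp
    then have "int (nat (b mod int q)) \<in> J" using q(1) by simp
    moreover have "nat (b mod int q) < q" using q(1) by (simp add: nat_less_iff)
    ultimately have "nat (b mod int q) = 0"
      using not_less_Least[of "nat (b mod int q)" "\<lambda>m. 0 < m \<and> int m \<in> J"] by (auto simp: q_def)
    then have "b mod int q = 0" using q(1) pos_mod_sign[of "int q" b] by linarith
    then show ?thesis by auto
  qed
  moreover have "q \<noteq> 1" using q(2) J(2) by auto
  ultimately show ?thesis using that[of q] q(1) by simp
qed

lemma frag_cmul_mem: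
  assumes C: "additive_subgroup C" and s: "s \<in> C"
  shows "frag_cmul a s \<in> C"
proof -
  have nat: "frag_cmul (int m) s \<in> C" for m
  proof (induction m)
    case (Suc m)
    then show ?case using additive_subgroupD(4)[OF C s Suc] by (simp add: frag_cmul_distrib)
  qed (use additive_subgroupD(1)[OF C] in simp)
  show ?thesis
  proof (cases "0 \<le> a")
    case True
    then show ?thesis using nat[of "nat a"] by simp
  next
    case False
    have "frag_cmul a s = - frag_cmul (int (nat (- a))) s"
      using False frag_cmul_cmul[of "-1" "- a" s] by simp
    then show ?thesis using additive_subgroupD(3)[OF C nat] by metis
  qed
qed

text \<open>The \<open>q\<close>-th roots of unity, written additively.\<close>

definition cyclic_circle :: "nat \<Rightarrow> circle set" where
  "cyclic_circle q = range (\<lambda>i::int. circle_of (of_int i / of_nat q))"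

lemma additive_subgroup_cyclic_circle: "additive_subgroup (cyclic_circle q)"
  unfolding additive_subgroup_def
proof (intro conjI ballI)
  have "circle_of (of_int 0 / of_nat q) \<in> cyclic_circle q" unfolding cyclic_circle_def by blast
  then show "0 \<in> cyclic_circle q" by simp
  fix x y assume "x \<in> cyclic_circle q" "y \<in> cyclic_circle q"
  then obtain i j :: int where "x = circle_of (of_int i / of_nat q)" "y = circle_of (of_int j / of_nat q)"
    by (auto simp: cyclic_circle_def)
  then have "x - y = circle_of (of_int (i - j) / of_nat q)"
    by (simp add: circle_of_diff[symmetric] diff_divide_distrib)
  then show "x - y \<in> cyclic_circle q" unfolding cyclic_circle_def by blast
qed

lemma circle_of_frac_eq:
  assumes "int q dvd i - j" "0 < q"
  shows "circle_of (of_int i / of_nat q) = circle_of (of_int j / of_nat q)"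
proof -
  obtain m where m: "i - j = int q * m" using assms(1) by blast
  have "(of_int i / of_nat q :: real) - of_int j / of_nat q = of_int (i - j) / of_nat q"
    by (simp add: diff_divide_distrib)
  also have "\<dots> = of_int m" using assms(2) by (simp add: m)
  finally have "circle_of (of_int i / of_nat q) - circle_of (of_int j / of_nat q) = 0"
    unfolding circle_of_diff[symmetric] by (simp add: circle_of_eq_0_iff)
  then show ?thesis by simp
qed

lemma finite_cyclic_circle:
  assumes "0 < q"
  shows "finite (cyclic_circle q)"
proof -
  have "circle_of (of_int i / of_nat q) \<in> (\<lambda>i. circle_of (of_int i / of_nat q)) ` {0..<int q}" for i :: int
    using assms circle_of_frac_eq[of q i "i mod int q"] by (intro image_eqI[of _ _ "i mod int q"]) auto
  then have "cyclic_circle q \<subseteq> (\<lambda>i. circle_of (of_int i / of_nat q)) ` {0..<int q}"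
    unfolding cyclic_circle_def by blast
  then show ?thesis by (rule finite_subset) simp
qed

text \<open>The hypothesis \<open>gen\<close> says that \<open>Z\<close> is generated by
  \<open>S\<close> modulo \<open>B\<close>. A maximal \<open>I \<subseteq> S\<close> that lies with
  \<open>B\<close> in a proper subgroup \<open>C\<close> makes the quotient of \<open>Z\<close> by
  \<open>C\<close> cyclic and nonzero, and a finite cyclic quotient of this one gives the
  character.\<close>

lemma exists_finite_order_character:
  fixes Z B :: "('b \<Rightarrow>\<^sub>0 int) set"
  assumes Z: "additive_subgroup Z" and B: "additive_subgroup B" "B \<subseteq> Z" "B \<noteq> Z"
    and S: "finite S" "S \<subseteq> Z"
    and gen: "\<And>C. additive_subgroup C \<Longrightarrow> B \<subseteq> C \<Longrightarrow> S \<subseteq> C \<Longrightarrow> Z \<subseteq> C"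
  obtains h :: "('b \<Rightarrow>\<^sub>0 int) \<Rightarrow> circle" and q :: nat where "2 \<le> q"
    "\<And>x y. x \<in> Z \<Longrightarrow> y \<in> Z \<Longrightarrow> h (x - y) = h x - h y" "\<And>x. x \<in> B \<Longrightarrow> h x = 0"
    "\<exists>x\<in>Z. h x \<noteq> 0" "\<And>x. h x \<in> cyclic_circle q"
proof -
  define good where "good I \<longleftrightarrow> I \<subseteq> S \<and> (\<exists>C. additive_subgroup C \<and> B \<union> I \<subseteq> C \<and> C \<subset> Z)" for I
  have "finite {I. good I}" by (rule finite_subset[of _ "Pow S"]) (use S in \<open>auto simp: good_def\<close>)
  moreover have "good {}" using B by (auto simp: good_def)
  ultimately obtain I where I: "good I" and max: "\<And>I'. good I' \<Longrightarrow> I \<subseteq> I' \<Longrightarrow> I' = I"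
    using finite_has_maximal[of "{I. good I}"] by blast
  obtain C where C: "additive_subgroup C" "B \<union> I \<subseteq> C" "C \<subset> Z" using I by (auto simp: good_def)
  then obtain s where s: "s \<in> S" "s \<notin> C" using gen[of C] by blast
  have sZ: "s \<in> Z" using s S by blast
  \<comment> \<open>If \<open>E\<close> were proper, it would witness
    \<open>good (insert s I)\<close> and contradict maximality, since \<open>s\<close> is not in
    \<open>C\<close>. So \<open>s\<close> generates \<open>Z\<close> modulo
    \<open>C\<close>.\<close>
  define E where "E = {c + frag_cmul a s | c a. c \<in> C}"
  have E: "additive_subgroup E"
    unfolding additive_subgroup_def
  proof (intro conjI ballI)
    show "0 \<in> E" using additive_subgroupD(1)[OF C(1)] by (force simp: E_def)
    fix x y assume "x \<in> E" "y \<in> E"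
    then obtain c a c' a' where "x = c + frag_cmul a s" "y = c' + frag_cmul a' s" "c \<in> C" "c' \<in> C"
      by (auto simp: E_def)
    then have "x - y = (c - c') + frag_cmul (a - a') s" "c - c' \<in> C"
      using additive_subgroupD(2)[OF C(1)] by (auto simp: frag_cmul_diff_distrib)
    then show "x - y \<in> E" unfolding E_def by blast
  qed
  have CE: "C \<subseteq> E"
  proof
    fix c assume "c \<in> C"
    then show "c \<in> E" unfolding E_def by (intro CollectI exI[of _ c] exI[of _ 0]) simp
  qed
  have sE: "s \<in> E"
    unfolding E_def using additive_subgroupD(1)[OF C(1)] by (intro CollectI exI[of _ 0] exI[of _ 1]) simp
  have EZ: "E \<subseteq> Z"
    using C(3) additive_subgroupD(4)[OF Z] frag_cmul_mem[OF Z sZ] by (auto simp: E_def)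
  have "E = Z"
  proof (rule ccontr)
    assume "E \<noteq> Z"
    then have "good (insert s I)"
      unfolding good_def using I E EZ CE C(2) sE s(1) by (intro conjI exI[of _ E]) (auto simp: good_def)
    then have "s \<in> I" using max by blast
    then show False using C(2) s(2) by blast
  qed
  \<comment> \<open>The quotient of \<open>Z\<close> by \<open>C\<close> is the quotient of the
    integers by \<open>J\<close>. The coefficient of \<open>s\<close> is determined up to
    \<open>J\<close>, hence modulo \<open>q\<close>, which makes \<open>h\<close> independent of the
    choice in \<open>coef\<close>.\<close>
  define J where "J = {a. frag_cmul a s \<in> C}"
  have "additive_subgroup J"
    unfolding additive_subgroup_def J_def
    using additive_subgroupD(1,2)[OF C(1)] by (auto simp: frag_cmul_diff_distrib)
  moreover have "1 \<notin> J" using s(2) by (simp add: J_def)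
  ultimately obtain q :: nat where q: "2 \<le> q" "\<And>a. a \<in> J \<Longrightarrow> int q dvd a"
    by (rule additive_subgroup_Int_dvd) blast
  define coef where "coef x = (SOME a. x - frag_cmul a s \<in> C)" for x
  define h where "h x = circle_of (of_int (coef x) / of_nat q)" for x
  have coef: "x - frag_cmul (coef x) s \<in> C" if "x \<in> Z" for x
  proof -
    obtain c a where "x = c + frag_cmul a s" "c \<in> C" using \<open>E = Z\<close> \<open>x \<in> Z\<close> by (auto simp: E_def)
    then have "x - frag_cmul a s \<in> C" by simp
    then show ?thesis unfolding coef_def by (rule someI)
  qed
  have h: "h x = circle_of (of_int a / of_nat q)" if x: "x \<in> Z" and a: "x - frag_cmul a s \<in> C" for x a
  proof -
    have "(x - frag_cmul a s) - (x - frag_cmul (coef x) s) \<in> C"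
      by (rule additive_subgroupD(2)[OF C(1) a coef[OF x]])
    moreover have "(x - frag_cmul a s) - (x - frag_cmul (coef x) s) = frag_cmul (coef x - a) s"
    proof -
      have "(x - u) - (x - v) = v - u" for u v :: "'b \<Rightarrow>\<^sub>0 int" by simp
      then show ?thesis unfolding frag_cmul_diff_distrib .
    qed
    ultimately have "coef x - a \<in> J" unfolding J_def by simp
    then show ?thesis unfolding h_def using q by (intro circle_of_frac_eq) auto
  qed
  show ?thesis
  proof (rule that[of q h])
    show "h (x - y) = h x - h y" if "x \<in> Z" "y \<in> Z" for x y
    proof -
      have "(x - frag_cmul (coef x) s) - (y - frag_cmul (coef y) s) \<in> C"
        by (rule additive_subgroupD(2)[OF C(1) coef[OF that(1)] coef[OF that(2)]])
      then have "(x - y) - frag_cmul (coef x - coef y) s \<in> C"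
        by (simp add: frag_cmul_diff_distrib algebra_simps)
      from h[OF additive_subgroupD(2)[OF Z that] this] show ?thesis
        by (simp add: h_def circle_of_diff[symmetric] diff_divide_distrib)
    qed
    show "h x = 0" if "x \<in> B" for x
      using h[of x 0] that B(2) C(2) by auto
    have "h s = circle_of (1 / of_nat q)"
      using h[OF sZ, of 1] additive_subgroupD(1)[OF C(1)] by simp
    moreover have "(1 / of_nat q :: real) \<notin> \<int>"
    proof
      assume "(1 / of_nat q :: real) \<in> \<int>"
      then obtain m :: int where "(1 / of_nat q :: real) = of_int m" by (rule Ints_cases)
      then have "of_int (m * int q) = (1 :: real)" using q(1) by (simp add: field_simps)
      then have "m * int q = 1" by linarith
      then have "int q dvd 1" by (metis dvd_triv_right)
      then show False using q(1) by simp
    qed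
    ultimately show "\<exists>x\<in>Z. h x \<noteq> 0" using sZ
      by (intro bexI[of _ s]) (auto simp: circle_of_eq_0_iff)
    show "h x \<in> cyclic_circle q" for x by (auto simp: h_def cyclic_circle_def)
  qed (use q in simp)
qed

text \<open>The extension is computed on real representatives of the values, where integer multiples
  are ordinary products, and then projected to the circle.\<close>

lemma circle_extend:
  fixes f :: "'b \<Rightarrow> circle"
  obtains F :: "('b \<Rightarrow>\<^sub>0 int) \<Rightarrow> circle" where "\<And>x y. F (x - y) = F x - F y" "\<And>b. F (frag_of b) = f b"
proof -
  have "\<forall>b. \<exists>x. circle_of x = f b" using circle_of_surj by blast
  then obtain r where r: "\<And>b. circle_of (r b) = f b" by metis
  define T where "T x = (\<Sum>b\<in>Poly_Mapping.keys x. real_of_int (Poly_Mapping.lookup x b) * r b)" for x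
  have T: "T x = (\<Sum>b\<in>A. real_of_int (Poly_Mapping.lookup x b) * r b)"
    if "finite A" "Poly_Mapping.keys x \<subseteq> A" for x A
    unfolding T_def by (rule sum.mono_neutral_left) (use that in \<open>auto simp: in_keys_iff\<close>)
  have "T (x - y) = T x - T y" for x y
  proof -
    let ?A = "Poly_Mapping.keys x \<union> Poly_Mapping.keys y"
    have "T (x - y) = (\<Sum>b\<in>?A. real_of_int (Poly_Mapping.lookup (x - y) b) * r b)"
      by (rule T) (use keys_diff[of x y] in auto)
    also have "\<dots> = (\<Sum>b\<in>?A. real_of_int (Poly_Mapping.lookup x b) * r b) -
        (\<Sum>b\<in>?A. real_of_int (Poly_Mapping.lookup y b) * r b)"
      by (simp add: lookup_minus sum_subtractf[symmetric] left_diff_distrib)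
    also have "\<dots> = T x - T y" using T[of ?A x] T[of ?A y] by simp
    finally show ?thesis .
  qed
  moreover have "T (frag_of b) = r b" for b by (simp add: T_def)
  ultimately show ?thesis
    using that[of "\<lambda>x. circle_of (T x)"] by (simp add: circle_of_diff r)
qed

section \<open>Cycles and boundaries in low degrees\<close>

abbreviation "bd \<equiv> simplicial_boundary"

lemma bd_simps [simp]: "bd 0 = 0" "bd (x - y) = bd x - bd y" "bd (x + y) = bd x + bd y"
  by (simp_all add: simplicial_boundary_def frag_extend_diff frag_extend_add)

lemma bd_empty [simp]: "bd (frag_of {}) = 0"
  by (simp add: simplicial_boundary_def)

lemma bd_vertex [simp]: "bd (frag_of {v}) = frag_of {}"
  by (simp add: simplicial_boundary_def)

lemma bd_edge:
  assumes "a < b"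
  shows "bd (frag_of {a, b}) = frag_of {b} - frag_of {a}"
proof -
  have "sorted_list_of_set {a, b} = [a, b]"
    using assms sorted_list_of_set.idem_if_sorted_distinct[of "[a, b]"] by auto
  moreover have "card {a, b} = 2" "{a, b} - {a} = {b}" "{a, b} - {b} = {a}" using assms by auto
  ultimately show ?thesis
    by (simp add: simplicial_boundary_def numeral_2_eq_2)
qed

lemma bd_triangle:
  assumes "a < b" "b < c"
  shows "bd (frag_of {a, b, c}) = frag_of {b, c} - frag_of {a, c} + frag_of {a, b}"
proof -
  have ac: "a < c" using assms by (rule less_trans)
  then have ne: "a \<noteq> b" "b \<noteq> c" "a \<noteq> c" using assms by auto
  have "sorted_list_of_set (set [a, b, c]) = [a, b, c]"
    by (rule sorted_list_of_set.idem_if_sorted_distinct) (use assms ac in auto)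
  then have "sorted_list_of_set {a, b, c} = [a, b, c]" by (simp only: list.set)
  moreover have "card {a, b, c} = 3" "{a, b, c} - {a} = {b, c}" "{a, b, c} - {b} = {a, c}"
    "{a, b, c} - {c} = {a, b}" using ne by auto
  ultimately show ?thesis
    by (simp add: simplicial_boundary_def numeral_3_eq_3)
qed

lemma bd_keys:
  assumes K: "abstract_complex K" and x: "Poly_Mapping.keys x \<subseteq> simplices p K"
  shows "Poly_Mapping.keys (bd x) \<subseteq> simplices (p - 1) K"
  using x
proof (induction x rule: frag_induction)
  case (one \<sigma>)
  have fin: "finite \<sigma>" and \<sigma>: "\<sigma> \<in> K" "int (card \<sigma>) = p + 1"
    using one K by (auto simp: simplices_def abstract_complex_def)
  have "\<sigma> - {sorted_list_of_set \<sigma> ! i} \<in> simplices (p - 1) K" if i: "i < card \<sigma>" for i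
  proof -
    have "sorted_list_of_set \<sigma> ! i \<in> \<sigma>"
      using nth_mem[of i "sorted_list_of_set \<sigma>"] i fin by simp
    moreover have "\<sigma> - {sorted_list_of_set \<sigma> ! i} \<in> K"
      using K \<sigma>(1) by (auto simp: abstract_complex_def)
    ultimately show ?thesis using \<sigma>(2) fin i by (simp add: simplices_def card_Diff_singleton)
  qed
  then show ?case
    unfolding simplicial_boundary_def frag_extend_of
    by (intro order_trans[OF keys_sum]) (auto simp: keys_frag_of)
next
  case (diff a b)
  then show ?case using keys_diff[of "bd a" "bd b"] by auto
qed auto

lemma cycles_iff:
  "x \<in> simplicial_cycles p K \<longleftrightarrow> Poly_Mapping.keys x \<subseteq> simplices p K \<and> bd x = 0"
  by (simp add: simplicial_cycles_def kernel_def simplicial_chain_group_def)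

lemma boundaries_iff:
  "x \<in> simplicial_boundaries p K \<longleftrightarrow> (\<exists>y. Poly_Mapping.keys y \<subseteq> simplices (p + 1) K \<and> x = bd y)"
  by (simp add: simplicial_boundaries_def simplicial_chain_group_def image_iff Bex_def)

lemma additive_subgroup_cycles: "additive_subgroup (simplicial_cycles p K)"
  unfolding additive_subgroup_def
proof (intro conjI ballI)
  fix x y assume "x \<in> simplicial_cycles p K" "y \<in> simplicial_cycles p K"
  then show "x - y \<in> simplicial_cycles p K"
    using keys_diff[of x y] by (auto simp: cycles_iff)
qed (simp add: cycles_iff)

lemma additive_subgroup_boundaries: "additive_subgroup (simplicial_boundaries p K)"
  unfolding additive_subgroup_def
proof (intro conjI ballI)
  show "0 \<in> simplicial_boundaries p K" unfolding boundaries_iff by (intro exI[of _ 0]) simp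
  fix x y assume "x \<in> simplicial_boundaries p K" "y \<in> simplicial_boundaries p K"
  then obtain x' y' where "Poly_Mapping.keys x' \<subseteq> simplices (p + 1) K" "x = bd x'"
    "Poly_Mapping.keys y' \<subseteq> simplices (p + 1) K" "y = bd y'"
    unfolding boundaries_iff by blast
  then show "x - y \<in> simplicial_boundaries p K"
    unfolding boundaries_iff using keys_diff[of x' y'] by (intro exI[of _ "x' - y'"]) auto
qed

lemma trivial_homologyI:
  assumes eq: "simplicial_cycles p K = simplicial_boundaries p K"
  shows "trivial_group (reduced_simplicial_homology p K)"
proof -
  let ?C = "simplicial_chain_group p K" and ?Z = "simplicial_cycles p K"
  interpret C: comm_group ?C unfolding simplicial_chain_group_def by (rule abelian_free_Abelian_group)
  have "subgroup ?Z ?C"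
  proof (rule C.subgroupI)
    show "?Z \<subseteq> carrier ?C" by (auto simp: cycles_iff simplicial_chain_group_def)
    show "?Z \<noteq> {}" using additive_subgroupD(1)[OF additive_subgroup_cycles] by blast
    show "inv\<^bsub>?C\<^esub> x \<in> ?Z" if "x \<in> ?Z" for x
      using that additive_subgroupD(3)[OF additive_subgroup_cycles that]
      by (simp add: cycles_iff simplicial_chain_group_def)
    show "x \<otimes>\<^bsub>?C\<^esub> y \<in> ?Z" if "x \<in> ?Z" "y \<in> ?Z" for x y
      using additive_subgroupD(4)[OF additive_subgroup_cycles that]
      by (simp add: simplicial_chain_group_def)
  qed
  then have car: "carrier (subgroup_generated ?C ?Z) = ?Z"
    by (rule subgroup.carrier_subgroup_generated_subgroup)
  let ?H = "subgroup_generated ?C ?Z"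
  interpret H: comm_group ?H by (rule C.abelian_subgroup_generated[OF C.comm_group_axioms])
  have "?Z \<lhd> ?H" using H.subgroup_self car H.normal_iff_subgroup by simp
  then interpret N: normal ?Z ?H .
  interpret Q: group "?H Mod ?Z" by (rule N.factorgroup_is_group)
  have "carrier (?H Mod ?Z) \<subseteq> {\<one>\<^bsub>?H Mod ?Z\<^esub>}"
    using H.coset_join2[OF _ N.subgroup_axioms] car by (auto simp: carrier_FactGroup)
  then show ?thesis
    using Q.trivial_group_subset by (simp add: reduced_simplicial_homology_def eq[symmetric])
qed

section \<open>The cocycle of a connected flag complex\<close>

locale connected_flag_complex =
  fixes K :: "'v::linorder set set"
  assumes flag: "flag_complex K" and conn: "connected_complex K"
begin

lemma complex: "abstract_complex K"
  using flag by (simp add: flag_complex_def)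

text \<open>Additivity of \<open>z\<close> is required for all mutually adjacent triples, that is,
  for all triples of commuting generators, whereas homology controls it on simplices only. Flagness
  closes this gap.\<close>

lemma triangle:
  assumes "adjacent K u v" "adjacent K v w" "adjacent K u w"
  shows "{u, v, w} \<in> K"
proof -
  have "pairwise (adjacent K) {u, v, w}"
    using assms adjacent_sym[of K] by (auto simp: pairwise_def)
  moreover have "{u, v, w} \<subseteq> vertices K" using assms adjacent_vertices by (metis empty_subsetI insert_subset)
  ultimately show ?thesis using flag by (simp add: flag_complex_def)
qed

lemma edge_cases:
  assumes "\<sigma> \<in> simplices 1 K"
  obtains a b where "a < b" "\<sigma> = {a, b}" "adjacent K a b"
proof -
  have "card \<sigma> = 2" "\<sigma> \<in> K" using assms by (auto simp: simplices_def)
  then obtain a b where "\<sigma> = {a, b}" "a \<noteq> b" by (auto simp: card_2_iff)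
  then show ?thesis
    using that[of a b] that[of b a] \<open>\<sigma> \<in> K\<close> by (cases "a < b") (auto simp: adjacent_def insert_commute)
qed

lemma edge_simplex: "adjacent K a b \<Longrightarrow> {a, b} \<in> simplices 1 K"
  by (auto simp: adjacent_def simplices_def)

lemma triangle_cases:
  assumes "\<sigma> \<in> simplices 2 K"
  obtains a b c where "a < b" "b < c" "\<sigma> = {a, b, c}"
proof -
  have c3: "card \<sigma> = 3" using assms by (simp add: simplices_def)
  then have len: "length (sorted_list_of_set \<sigma>) = 3" and fin: "finite \<sigma>"
    by (simp, metis card.infinite zero_neq_numeral)
  have "\<exists>a b c. xs = [a, b, c]" if "length xs = 3" for xs :: "'v list"
    using that by (auto simp: numeral_3_eq_3 length_Suc_conv)
  from this[OF len] obtain a b c where abc: "sorted_list_of_set \<sigma> = [a, b, c]" by blast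
  have "\<sigma> = {a, b, c}" using set_sorted_list_of_set[OF fin] abc by auto
  moreover have "a < b" "b < c" using strict_sorted_list_of_set[of \<sigma>] abc by auto
  ultimately show ?thesis using that by blast
qed

lemma bd_bd_0: "Poly_Mapping.keys x \<subseteq> simplices 1 K \<Longrightarrow> bd (bd x) = 0"
  by (induction x rule: frag_induction) (auto elim!: edge_cases simp: bd_edge)

lemma bd_bd_1: "Poly_Mapping.keys x \<subseteq> simplices 2 K \<Longrightarrow> bd (bd x) = 0"
proof (induction x rule: frag_induction)
  case (one \<sigma>)
  then obtain a b c where "a < b" "b < c" "\<sigma> = {a, b, c}" by (rule triangle_cases)
  then show ?case by (simp add: bd_triangle bd_edge order_less_trans[of a b c])
qed auto

definition base_vertex :: 'v where
  "base_vertex = (SOME v. v \<in> vertices K)"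

lemma base_vertex: "base_vertex \<in> vertices K"
  using conn unfolding base_vertex_def connected_complex_def by (meson all_not_in_conv someI_ex)

lemma path_chain:
  assumes "v \<in> vertices K"
  shows "\<exists>c. Poly_Mapping.keys c \<subseteq> simplices 1 K \<and> bd c = frag_of {v} - frag_of {base_vertex}"
proof -
  have "(adjacent K)\<^sup>*\<^sup>* base_vertex v"
    using conn base_vertex assms by (auto simp: connected_complex_def)
  then show ?thesis
  proof (induction rule: rtranclp_induct)
    case base
    show ?case by (intro exI[of _ 0]) simp
  next
    case (step u v)
    then obtain c where c: "Poly_Mapping.keys c \<subseteq> simplices 1 K" "bd c = frag_of {u} - frag_of {base_vertex}"
      by blast
    have e: "{u, v} \<in> simplices 1 K" "{v, u} \<in> simplices 1 K"
      using edge_simplex[OF step(2)] by (auto simp: insert_commute)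
    show ?case
    proof (cases "u < v")
      case True
      have "bd (c - (0 - frag_of {u, v})) = frag_of {v} - frag_of {base_vertex}"
        unfolding bd_simps bd_edge[OF True] c(2) by simp
      moreover have "Poly_Mapping.keys (c - (0 - frag_of {u, v})) \<subseteq> simplices 1 K"
        using keys_diff[of c "0 - frag_of {u, v}"] c e by (auto simp: keys_frag_of)
      ultimately show ?thesis by blast
    next
      case False
      then have vu: "v < u" using step(2) by (auto simp: adjacent_def)
      have "bd (c - frag_of {v, u}) = frag_of {v} - frag_of {base_vertex}"
        unfolding bd_simps bd_edge[OF vu] c(2) by simp
      moreover have "Poly_Mapping.keys (c - frag_of {v, u}) \<subseteq> simplices 1 K"
        using keys_diff[of c "frag_of {v, u}"] c e by (auto simp: keys_frag_of)
      ultimately show ?thesis by blast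
    qed
  qed
qed

definition path_of :: "'v \<Rightarrow> 'v set \<Rightarrow>\<^sub>0 int" where
  "path_of v = (SOME c. Poly_Mapping.keys c \<subseteq> simplices 1 K \<and> bd c = frag_of {v} - frag_of {base_vertex})"

lemma path_of:
  assumes "v \<in> vertices K"
  shows "Poly_Mapping.keys (path_of v) \<subseteq> simplices 1 K" "bd (path_of v) = frag_of {v} - frag_of {base_vertex}"
  using someI_ex[OF path_chain[OF assms]] by (auto simp: path_of_def)

text \<open>A chain contraction in degree 0: each vertex is joined to the base vertex by a chosen
  path.\<close>

definition cone :: "('v set \<Rightarrow>\<^sub>0 int) \<Rightarrow> ('v set \<Rightarrow>\<^sub>0 int)" where
  "cone = frag_extend (\<lambda>\<sigma>. path_of (the_elem \<sigma>))"

lemma cone_simps [simp]: "cone 0 = 0" "cone (x - y) = cone x - cone y"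
  by (simp_all add: cone_def frag_extend_diff)

lemma vertex_cases:
  assumes "\<sigma> \<in> simplices 0 K"
  obtains v where "\<sigma> = {v}" "v \<in> vertices K"
  using assms by (auto simp: simplices_def vertices_def card_1_singleton_iff)

lemma cone:
  assumes "Poly_Mapping.keys x \<subseteq> simplices 0 K"
  shows "Poly_Mapping.keys (cone x) \<subseteq> simplices 1 K"
    "bd (cone x) = x - frag_extend (\<lambda>_. frag_of {base_vertex}) (bd x)"
proof -
  have "Poly_Mapping.keys (cone x) \<subseteq> simplices 1 K \<and>
    bd (cone x) = x - frag_extend (\<lambda>_. frag_of {base_vertex}) (bd x)"
    using assms
  proof (induction x rule: frag_induction)
    case (one \<sigma>)
    then obtain v where "\<sigma> = {v}" "v \<in> vertices K" by (rule vertex_cases)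
    then show ?case using path_of by (simp add: cone_def)
  next
    case (diff a b)
    then show ?case using keys_diff[of "cone a" "cone b"] by (auto simp: frag_extend_diff)
  qed simp
  then show "Poly_Mapping.keys (cone x) \<subseteq> simplices 1 K"
    "bd (cone x) = x - frag_extend (\<lambda>_. frag_of {base_vertex}) (bd x)" by auto
qed

lemma cycles_eq_boundaries_neg:
  assumes "p \<le> -2"
  shows "simplicial_cycles p K = simplicial_boundaries p K"
proof -
  have e: "simplices p K = {}" using assms by (auto simp: simplices_def)
  \<comment> \<open>Degree \<open>p + 1\<close> may be -1, where the empty simplex sits; its
    boundary is an empty sum.\<close>
  have s: "\<sigma> = {}" if "\<sigma> \<in> simplices (p + 1) K" for \<sigma>
  proof -
    have "int (card \<sigma>) = p + 2" "finite \<sigma>"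
      using that complex by (auto simp: simplices_def abstract_complex_def)
    moreover from this have "card \<sigma> = 0" using assms by linarith
    ultimately show ?thesis by simp
  qed
  have bd: "bd y = 0" if "Poly_Mapping.keys y \<subseteq> simplices (p + 1) K" for y
    unfolding simplicial_boundary_def
  proof (rule frag_extend_eq_0)
    fix \<sigma> assume "\<sigma> \<in> Poly_Mapping.keys y"
    then have "\<sigma> = {}" using that s by blast
    then show "(\<Sum>i<card \<sigma>. frag_cmul ((-1) ^ i) (frag_of (\<sigma> - {sorted_list_of_set \<sigma> ! i}))) = 0" by simp
  qed
  have "x \<in> simplicial_cycles p K \<longleftrightarrow> x = 0" for x
    by (auto simp: cycles_iff e)
  moreover have "x \<in> simplicial_boundaries p K \<longleftrightarrow> x = 0" for x
    using bd additive_subgroupD(1)[OF additive_subgroup_boundaries, of p K]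
    by (auto simp: boundaries_iff)
  ultimately show ?thesis by blast
qed

lemma cycles_eq_boundaries_minus_one: "simplicial_cycles (-1) K = simplicial_boundaries (-1) K"
proof (intro equalityI subsetI)
  have e: "simplices (-1) K \<subseteq> {{}}"
    using complex by (auto simp: simplices_def abstract_complex_def)
  fix x
  {
    assume "x \<in> simplicial_cycles (-1) K"
    then have x: "Poly_Mapping.keys x \<subseteq> {{}}" using e by (auto simp: cycles_iff)
    have v: "{base_vertex} \<in> simplices 0 K"
      using base_vertex complex by (auto simp: simplices_def vertices_def abstract_complex_def)
    have "bd (frag_extend (\<lambda>_. frag_of {base_vertex}) x) = x \<and>
        Poly_Mapping.keys (frag_extend (\<lambda>_. frag_of {base_vertex}) x) \<subseteq> simplices 0 K" using x
    proof (induction x rule: frag_induction)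
      case (diff a b)
      then show ?case
        using keys_diff[of "frag_extend (\<lambda>_. frag_of {base_vertex}) a" "frag_extend (\<lambda>_. frag_of {base_vertex}) b"]
        by (auto simp: frag_extend_diff)
    qed (use v in \<open>auto simp: keys_frag_of\<close>)
    then show "x \<in> simplicial_boundaries (-1) K" unfolding boundaries_iff by auto
  next
    assume "x \<in> simplicial_boundaries (-1) K"
    then obtain y where "Poly_Mapping.keys y \<subseteq> simplices 0 K" "x = bd y" by (auto simp: boundaries_iff)
    then have x: "Poly_Mapping.keys x \<subseteq> simplices (-1) K" using bd_keys[OF complex, of y 0] by simp
    moreover have "bd x = 0"
      unfolding simplicial_boundary_def by (rule frag_extend_eq_0) (use x e in auto)
    ultimately show "x \<in> simplicial_cycles (-1) K" by (simp add: cycles_iff)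
  }
qed

lemma cycles_eq_boundaries_zero: "simplicial_cycles 0 K = simplicial_boundaries 0 K"
proof (intro equalityI subsetI)
  fix x assume "x \<in> simplicial_cycles 0 K"
  then have x: "Poly_Mapping.keys x \<subseteq> simplices 0 K" "bd x = 0" by (auto simp: cycles_iff)
  then have "x = bd (cone x)" using cone(2)[OF x(1)] by simp
  then show "x \<in> simplicial_boundaries 0 K" using cone(1)[OF x(1)] by (auto simp: boundaries_iff)
next
  fix x assume "x \<in> simplicial_boundaries 0 K"
  then obtain y where "Poly_Mapping.keys y \<subseteq> simplices 1 K" "x = bd y" by (auto simp: boundaries_iff)
  then show "x \<in> simplicial_cycles 0 K"
    using bd_keys[OF complex, of y 1] bd_bd_0[of y] by (simp add: cycles_iff)
qed

lemma boundaries_subset_cycles: "simplicial_boundaries 1 K \<subseteq> simplicial_cycles 1 K"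
proof
  fix x assume "x \<in> simplicial_boundaries 1 K"
  then obtain y where "Poly_Mapping.keys y \<subseteq> simplices 2 K" "x = bd y" by (auto simp: boundaries_iff)
  then show "x \<in> simplicial_cycles 1 K"
    using bd_keys[OF complex, of y 2] bd_bd_1[of y] by (simp add: cycles_iff)
qed

text \<open>A retraction of 1-chains onto 1-cycles. It yields finitely many generators of the cycles
  and extends a character of the cycles to all 1-chains.\<close>

definition close_up :: "('v set \<Rightarrow>\<^sub>0 int) \<Rightarrow> ('v set \<Rightarrow>\<^sub>0 int)" where
  "close_up x = x - cone (bd x)"

lemma close_up_diff: "close_up (x - y) = close_up x - close_up y"
  by (simp add: close_up_def)

lemma close_up_mem:
  assumes "Poly_Mapping.keys x \<subseteq> simplices 1 K"
  shows "close_up x \<in> simplicial_cycles 1 K"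
proof -
  have b: "Poly_Mapping.keys (bd x) \<subseteq> simplices 0 K" using bd_keys[OF complex assms] by simp
  then show ?thesis
    using assms cone[OF b] keys_diff[of x "cone (bd x)"] bd_bd_0[OF assms]
    by (auto simp: cycles_iff close_up_def)
qed

lemma close_up_cycle: "bd x = 0 \<Longrightarrow> close_up x = x"
  by (simp add: close_up_def)

text \<open>Connectedness kills reduced homology below degree 1, so the failure of acyclicity sits
  in degree 1 and provides a nonzero character \<open>h\<close> of finite order on cycles modulo
  boundaries; \<open>z\<close> is its extension through \<open>close_up\<close>. Nontriviality is
  proved against all circle-valued \<open>f\<close>, because the potentials found in
  \<open>vanishing_imp_coboundary\<close> are not confined to the finite subgroup.\<close>

lemma exists_cocycle:
  assumes fin: "finite K" and nonacyclic: "\<not> acyclic_up_to 1 K"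
  obtains z :: "'v \<Rightarrow> 'v \<Rightarrow> circle" and q :: nat where "2 \<le> q"
    "\<And>u v. adjacent K u v \<Longrightarrow> z u v \<in> cyclic_circle q"
    "\<And>u v. adjacent K u v \<Longrightarrow> z v u = - z u v"
    "\<And>u v w. adjacent K u v \<Longrightarrow> adjacent K v w \<Longrightarrow> adjacent K u w \<Longrightarrow> z u w = z u v + z v w"
    "\<nexists>f. \<forall>u v. adjacent K u v \<longrightarrow> z u v = f u - f v"
proof -
  let ?Z = "simplicial_cycles 1 K" and ?B = "simplicial_boundaries 1 K"
  have "?Z \<noteq> ?B"
  proof
    assume eq: "?Z = ?B"
    have "simplicial_cycles p K = simplicial_boundaries p K" if "p \<le> 1" for p
    proof -
      consider "p \<le> -2" | "p = -1" | "p = 0" | "p = 1" using \<open>p \<le> 1\<close> by linarith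
      then show ?thesis
        by cases (use eq cycles_eq_boundaries_neg cycles_eq_boundaries_minus_one cycles_eq_boundaries_zero in auto)
    qed
    then have "trivial_group (reduced_simplicial_homology p K)" if "p \<le> 1" for p
      using that by (intro trivial_homologyI)
    then show False using nonacyclic by (auto simp: acyclic_up_to_def)
  qed
  define S where "S = (\<lambda>\<sigma>. close_up (frag_of \<sigma>)) ` simplices 1 K"
  have S: "finite S" "S \<subseteq> ?Z"
    using fin by (auto simp: S_def simplices_def) (auto intro!: close_up_mem simp: simplices_def keys_frag_of)
  have gen: "?Z \<subseteq> C" if C: "additive_subgroup C" "?B \<subseteq> C" "S \<subseteq> C" for C
  proof
    fix x assume "x \<in> ?Z"
    then have x: "Poly_Mapping.keys x \<subseteq> simplices 1 K" "bd x = 0" by (auto simp: cycles_iff)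
    have "close_up x \<in> C" using x(1)
    proof (induction x rule: frag_induction)
      case zero
      show ?case using additive_subgroupD(1)[OF C(1)] by (simp add: close_up_def)
    next
      case (one \<sigma>)
      then show ?case using C(3) by (auto simp: S_def)
    next
      case (diff a b)
      then show ?case using additive_subgroupD(2)[OF C(1)] by (simp add: close_up_diff)
    qed
    then show "x \<in> C" using close_up_cycle[OF x(2)] by simp
  qed
  obtain h :: "('v set \<Rightarrow>\<^sub>0 int) \<Rightarrow> circle" and q where q: "2 \<le> q"
    and h: "\<And>x y. x \<in> ?Z \<Longrightarrow> y \<in> ?Z \<Longrightarrow> h (x - y) = h x - h y"
    and hB: "\<And>x. x \<in> ?B \<Longrightarrow> h x = 0" and h0: "\<exists>x\<in>?Z. h x \<noteq> 0"
    and hq: "\<And>x. h x \<in> cyclic_circle q"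
    by (rule exists_finite_order_character[OF additive_subgroup_cycles additive_subgroup_boundaries
        boundaries_subset_cycles \<open>?Z \<noteq> ?B\<close>[symmetric] S gen]) blast+
  define \<eta> where "\<eta> x = h (close_up x)" for x
  have \<eta>: "\<eta> (x - y) = \<eta> x - \<eta> y"
    if "Poly_Mapping.keys x \<subseteq> simplices 1 K" "Poly_Mapping.keys y \<subseteq> simplices 1 K" for x y
    unfolding \<eta>_def close_up_diff by (rule h[OF close_up_mem[OF that(1)] close_up_mem[OF that(2)]])
  \<comment> \<open>Chains orient an edge by the order of its vertices; the sign makes
    \<open>z\<close> antisymmetric, as swapping the two generators reverses a commutator
    square.\<close>
  define z where "z u v = (if u < v then \<eta> (frag_of {u, v}) else - \<eta> (frag_of {u, v}))" for u v
  note Q = additive_subgroup_cyclic_circle[of q]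
  have anti: "z v u = - z u v" if "adjacent K u v" for u v
    using that by (auto simp: z_def adjacent_def insert_commute not_less_iff_gr_or_eq)
  have sorted: "z a c = z a b + z b c"
    if "adjacent K a b" "adjacent K b c" "adjacent K a c" "a < b" "b < c" for a b c
  proof -
    have K: "{a, b, c} \<in> K" by (rule triangle[OF that(1-3)])
    have ac: "a < c" using that(4,5) by (rule less_trans)
    then have ne: "a \<noteq> b" "b \<noteq> c" "a \<noteq> c" using that(4,5) by auto
    have e: "{a, b} \<in> simplices 1 K" "{b, c} \<in> simplices 1 K" "{a, c} \<in> simplices 1 K"
      using edge_simplex that by auto
    let ?ab = "frag_of {a, b}" and ?bc = "frag_of {b, c}" and ?ac = "frag_of {a, c}"
    let ?t = "?bc - (?ac - ?ab)"
    have t: "?t = bd (frag_of {a, b, c})" using bd_triangle[OF that(4,5)] by simp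
    have "{a, b, c} \<in> simplices 2 K" using K ne by (auto simp: simplices_def)
    then have B: "?t \<in> ?B" unfolding t boundaries_iff by (intro exI[of _ "frag_of {a, b, c}"]) (simp add: keys_frag_of)
    then have "?t \<in> ?Z" using boundaries_subset_cycles by blast
    then have "bd ?t = 0" by (simp only: cycles_iff)
    then have "\<eta> ?t = 0" by (simp only: \<eta>_def close_up_cycle hB[OF B])
    moreover have "Poly_Mapping.keys (?ac - ?ab) \<subseteq> simplices 1 K"
      using keys_diff[of ?ac ?ab] e by (auto simp: keys_frag_of)
    ultimately have "\<eta> ?bc - (\<eta> ?ac - \<eta> ?ab) = 0"
      using \<eta>[of ?bc "?ac - ?ab"] \<eta>[of ?ac ?ab] e by (simp add: keys_frag_of)
    then show ?thesis using that(4,5) ac by (simp add: z_def algebra_simps)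
  qed
  show ?thesis
  proof (rule that[of q z])
    show "z u v \<in> cyclic_circle q" for u v
      using hq additive_subgroupD(3)[OF Q hq] by (simp add: z_def \<eta>_def)
    show "z u w = z u v + z v w" if adj: "adjacent K u v" "adjacent K v w" "adjacent K u w" for u v w
    proof -
      note adj' = adj[THEN adjacent_sym]
      note z' = adj[THEN anti]
      have ne: "u \<noteq> v" "v \<noteq> w" "u \<noteq> w" using adj by (auto simp: adjacent_def)
      then consider "u < v" "v < w" | "u < w" "w < v" | "v < u" "u < w" | "v < w" "w < u"
        | "w < u" "u < v" | "w < v" "v < u" by (meson linorder_neqE)
      then show ?thesis
      proof cases
        case 1 then show ?thesis using sorted[OF adj] by simp
      next
        case 2 then show ?thesis using sorted[OF adj(3) adj'(2) adj(1)] z' by simp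
      next
        case 3 then show ?thesis using sorted[OF adj'(1) adj(3) adj(2)] z' by simp
      next
        case 4 then show ?thesis using sorted[OF adj(2) adj'(3) adj'(1)] z' by (simp add: algebra_simps)
      next
        case 5 then show ?thesis using sorted[OF adj'(3) adj(1) adj'(2)] z' by (simp add: algebra_simps)
      next
        case 6 then show ?thesis using sorted[OF adj'(2) adj'(1) adj'(3)] z' by (simp add: algebra_simps)
      qed
    qed
    show "\<nexists>f. \<forall>u v. adjacent K u v \<longrightarrow> z u v = f u - f v"
    proof
      assume "\<exists>f. \<forall>u v. adjacent K u v \<longrightarrow> z u v = f u - f v"
      then obtain f where f: "\<And>u v. adjacent K u v \<Longrightarrow> z u v = f u - f v" by blast
      obtain F :: "('v set \<Rightarrow>\<^sub>0 int) \<Rightarrow> circle" where F: "\<And>x y. F (x - y) = F x - F y"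
        "\<And>\<sigma>. F (frag_of \<sigma>) = f (the_elem \<sigma>)"
        using circle_extend[of "\<lambda>\<sigma>. f (the_elem \<sigma>)"] by blast
      have F0: "F 0 = 0" using F(1)[of 0 0] by simp
      \<comment> \<open>The boundary of an edge is its larger vertex minus its smaller one, opposite
        to \<open>f u - f v\<close>; this explains the sign. On a cycle the right-hand side
        vanishes, while \<open>h\<close> is nonzero on some cycle.\<close>
      have "\<eta> x = - F (bd x)" if "Poly_Mapping.keys x \<subseteq> simplices 1 K" for x
      proof -
        have "Poly_Mapping.keys x \<subseteq> simplices 1 K \<and> \<eta> x = - F (bd x)" using that
        proof (induction x rule: frag_induction)
          case zero
          have "0 \<in> ?Z" by (rule additive_subgroupD(1)[OF additive_subgroup_cycles])
          then show ?case using h[of 0 0] by (simp add: \<eta>_def close_up_def F0)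
        next
          case (one \<sigma>)
          then obtain a b where ab: "a < b" "\<sigma> = {a, b}" "adjacent K a b" by (rule edge_cases)
          have "\<eta> (frag_of \<sigma>) = f a - f b" using f[OF ab(3)] ab by (simp add: z_def)
          then show ?case using one ab(1,2) by (simp add: bd_edge F keys_frag_of)
        next
          case (diff a b)
          then show ?case using keys_diff[of a b] by (auto simp: \<eta> F)
        qed
        then show ?thesis by blast
      qed
      moreover obtain x where x: "Poly_Mapping.keys x \<subseteq> simplices 1 K" "bd x = 0" "h x \<noteq> 0"
        using h0 by (auto simp: cycles_iff)
      ultimately have "\<eta> x = 0" by (simp add: F0)
      then show False using x close_up_cycle[OF x(2)] by (simp add: \<eta>_def)
    qed
  qed (use q anti in auto)
qed

end

theorem proposition9p4:
  fixes \<Sigma> :: "'v::linorder set set"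
  assumes "flag_complex \<Sigma>"
    and "finite \<Sigma>"
    and "connected_complex \<Sigma>"
    and "dim_le 2 \<Sigma>"
    and "\<not> acyclic_up_to 1 \<Sigma>"
  shows "(\<lambda>n. adef (raag_Gamma \<Sigma> n)) \<longlonglongrightarrow> \<infinity>"
proof -
  interpret connected_flag_complex \<Sigma> using assms by unfold_locales
  have fin: "finite (vertices \<Sigma>)"
    using assms(2) complex by (auto simp: vertices_def abstract_complex_def)
  obtain z :: "'v \<Rightarrow> 'v \<Rightarrow> circle" and q :: nat where q: "2 \<le> q" and z:
    "\<And>u v. adjacent \<Sigma> u v \<Longrightarrow> z u v \<in> cyclic_circle q"
    "\<And>u v. adjacent \<Sigma> u v \<Longrightarrow> z v u = - z u v"
    "\<And>u v w. adjacent \<Sigma> u v \<Longrightarrow> adjacent \<Sigma> v w \<Longrightarrow> adjacent \<Sigma> u w \<Longrightarrow> z u w = z u v + z v w"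
    "\<nexists>f. \<forall>u v. adjacent \<Sigma> u v \<longrightarrow> z u v = f u - f v"
    using exists_cocycle[OF assms(2,5)] by metis
  have "finite (cyclic_circle q)" using q by (intro finite_cyclic_circle) simp
  then show ?thesis
    by (rule adef_tendsto_infinity[OF conn fin additive_subgroup_cyclic_circle _ z])
qed

end
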